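(* (Branching rule) Let $\lambda$ be a dominant integral weight, and let $\mathcal{A}$ be the collection of admissible subsets corresponding to an arbitrary $\lambda$-chain $\{\beta_i\}_{i\in I}$. Given $P\subseteq\{1,\ldots,r\}$, the character $\chi(\lambda)$ decomposes as a sum of Weyl characters relative to $\Phi_P$ by the rule $$\chi(\lambda)=\sum\chi(\mu(J);P),$$ where the summation is over all $J$ in $\mathcal{A}$ satisfying $\langle\mu(J),\alpha_p^\vee\rangle=M(J,p)$ for all $p\in P$.
   Context: Root system. Let $V$ be a finite-dimensional real vector space with a nondegenerate symmetric bilinear form $\langle\cdot,\cdot\rangle$, and let $\Phi\subset V$ be the set of real roots of a complex symmetrizable Kac-Moody algebra $\mathfrak{g}$, with simple roots $\alpha_1,\ldots,\alpha_r$. Put $\alpha^\vee=2\alpha/\langle\alpha,\alpha\rangle$ for $\alpha\in\Phi$, $s_\alpha(v)=v-\langle v,\alpha^\vee\rangle\alpha$ and $s_{\alpha,k}(v)=s_\alpha(v)+k\alpha$ ($k\in\mathbb{Z}$). Let $W\subset GL(V)$ be the Weyl group generated by the $s_\alpha$, $\alpha\in\Phi$, with length function $\ell$ with respect to the simple reflections $s_p=s_{\alpha_p}$. Thus: $\alpha_1,\dots,\alpha_r$ are linearly independent; $\langle\alpha_p,\alpha_p\rangle>0$; $\langle\alpha_p,\alpha_q^\vee\rangle\in\mathbb{Z}_{\le0}$ for $p\ne q$; and $\Phi=\bigcup_p W\alpha_p$. $\Phi^+$ is the set of roots in the nonnegative span of the simple roots, $\Phi=\Phi^+\sqcup(-\Phi^+)$;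 $\mathrm{sgn}(\alpha)=1$ (we write $\alpha>0$) for $\alpha\in\Phi^+$ and $\mathrm{sgn}(\alpha)=-1$ ($\alpha<0$) for $\alpha\in-\Phi^+$. In Bruhat order, $w\lessdot ws_\alpha$ ($\alpha\in\Phi^+$) means $\ell(ws_\alpha)=\ell(w)+1$. Let $\Lambda=\{v\in V\mid\langle v,\alpha_p^\vee\rangle\in\mathbb{Z}\ \forall p\}$; $v\in\Lambda$ is dominant if $\langle v,\alpha^\vee\rangle\ge0$ for all $\alpha\in\Phi^+$. Fix $\rho\in\Lambda$ with $\langle\rho,\alpha_p^\vee\rangle=1$ for all $p$. Characters. Fix a linear map $\mathrm{ht}:V\to\mathbb{R}$ with $\mathrm{ht}(\alpha_p)=1$ for all $p$. $R$ is the ring of formal sums $\sum_{\nu\in\Lambda}c_\nu e^\nu$, $c_\nu\in\mathbb{Z}$, with finitely many $\nu$ with $c_\nu\ne0$ and $\mathrm{ht}(\nu)>h$ for every $h\in\mathbb{R}$; $e^\mu e^\nu=e^{\mu+\nu}$. For dominant $\lambda\in\Lambda$, $$\chi(\lambda)=\frac{\sum_{w\in W}(-1)^{\ell(w)}e^{w(\lambda+\rho)-\rho}}{\sum_{w\in W}(-1)^{\ell(w)}e^{w(\rho)-\rho}}\in R,$$ which is the character of the irreducible integrable $\mathfrak{g}$-module of highest weight $\lambda$. Relative characters. For $P\subseteq\{1,\dots,r\}$, $\Phi_P$ is the root subsystem of $\Phi$ with simple roots $\{\alpha_p\mid p\in P\}$, $W_P\subseteq W$ is its Weyl group (generated by $s_p$,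 $p\in P$), $\Lambda_P=\{v\in V\mid\langle v,\alpha_p^\vee\rangle\in\mathbb{Z}\ \forall p\in P\}\supseteq\Lambda$ its weight lattice, $\Lambda_P^+=\{v\in\Lambda_P\mid\langle v,\alpha_p^\vee\rangle\ge0\ \forall p\in P\}$, and $R_P\supseteq R$ the ring defined like $R$ with $\Lambda_P$ in place of $\Lambda$ and the same height function. For $\nu\in\Lambda_P^+$, $\chi(\nu;P)\in R_P$ is the Weyl character relative to $\Phi_P$: $$\chi(\nu;P)=\frac{\sum_{w\in W_P}(-1)^{\ell(w)}e^{w(\nu+\rho)-\rho}}{\sum_{w\in W_P}(-1)^{\ell(w)}e^{w(\rho)-\rho}}.$$ $\lambda$-chains. A $\lambda$-chain is a family $\{\beta_i\}_{i\in I}$ of positive roots indexed by a totally ordered set $I$ such that: (1) for each $\alpha\in\Phi^+$, $\#\{i\in I\mid\beta_i=\alpha\}=\langle\lambda,\alpha^\vee\rangle$; (2) for any roots $\alpha,\beta,\gamma\in\Phi$ with $\alpha\ne\pm\beta$ and $\gamma^\vee=\alpha^\vee+k\beta^\vee$ for some integer $k$, and any $i\in I$ with $\beta_i=\beta$, one has $N_i(\gamma)=N_i(\alpha)+kN_i(\beta)$. Here, for $\alpha\in\Phi^+$, $N_i(\alpha)=\#\{j<i\mid\beta_j=\alpha\}$ and $N_i(-\alpha)=1-N_i(\alpha)$. Admissible subsets. Put $r_i=s_{\beta_i}$, $l_i^\emptyset=\#\{j<i\mid\beta_j=\beta_i\}$, $\widehat r_i=s_{\beta_i,l_i^\emptyset}$.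 A finite (possibly empty) subset $J=\{j_1<\dots<j_s\}\subseteq I$ is admissible if $1\lessdot r_{j_1}\lessdot r_{j_1}r_{j_2}\lessdot\cdots\lessdot r_{j_1}\cdots r_{j_s}$. Its weight is $\mu(J)=\widehat r_{j_1}\cdots\widehat r_{j_s}(\lambda)$. $\mathcal{A}$ is the set of admissible subsets. Foldings. $\Gamma(\emptyset)=(\{(\beta_i,1)\}_{i\in I},\rho)$. For $\Gamma=(\{(\gamma_i,\varepsilon_i)\}_{i\in I},\gamma_\infty)$ with $\gamma_i\in\Phi$, $\varepsilon_i=\pm1$, $\gamma_\infty\in W\rho$, let $\phi_i(\Gamma)=(\{(\delta_j,\zeta_j)\}_{j\in I},s_{\gamma_i}(\gamma_\infty))$, where $(\delta_j,\zeta_j)$ is $(\gamma_j,\varepsilon_j)$ if $j<i$, $(\gamma_i,-\varepsilon_i)$ if $j=i$, and $(s_{\gamma_i}(\gamma_j),\varepsilon_j)$ if $j>i$. For finite $J=\{j_1<\dots<j_s\}$, $\Gamma(J)=\phi_{j_1}\cdots\phi_{j_s}(\Gamma(\emptyset))$. For $\Gamma=\Gamma(J)=(\{(\gamma_i,\varepsilon_i)\},\gamma_\infty)$, the levels are $$l_i=\delta_i'+\sum_{j<i,\ \varepsilon_j=1,\ \gamma_j=\pm\gamma_i}\mathrm{sgn}(\gamma_j),\qquad\delta_i'=0\text{ if }\gamma_i>0,\quad\delta_i'=-1\text{ if }\gamma_i<0.$$ For $J\in\mathcal{A}$ and $p\in\{1,\ldots,r\}$, with $\Gamma(J)$ and its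 levels as defined here, let $I_{\alpha_p}=\{i\in I\mid\gamma_i=\pm\alpha_p\}$ (a finite set) and $M(J,p)=\max(\{l_i\mid i\in I_{\alpha_p}\}\cup\{\langle\mu(J),\alpha_p^\vee\rangle\})$. *)

theory Defs
  imports "HOL-Analysis.Analysis"
begin

section \<open>Root data of symmetrizable Kac-Moody type\<close>

text \<open>
  The Kac-Moody algebra enters only through the data below. The simple roots are indexed by
  \<open>1, \<dots>, num_simple\<close>; values of \<open>simple_root\<close> at other indices are irrelevant.
\<close>

record 'v root_datum =
  form :: "'v \<Rightarrow> 'v \<Rightarrow> real"
  num_simple :: nat
  simple_root :: "nat \<Rightarrow> 'v"
  weyl_vec :: 'v
  height :: "'v \<Rightarrow> real"

definition coroot :: "'v::real_vector root_datum \<Rightarrow> 'v \<Rightarrow> 'v" where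
  "coroot D \<alpha> = (2 / form D \<alpha> \<alpha>) *\<^sub>R \<alpha>"

definition pairing :: "'v::real_vector root_datum \<Rightarrow> 'v \<Rightarrow> 'v \<Rightarrow> real" where
  "pairing D v \<alpha> = form D v (coroot D \<alpha>)"

definition root_refl :: "'v::real_vector root_datum \<Rightarrow> 'v \<Rightarrow> 'v \<Rightarrow> 'v" where
  "root_refl D \<alpha> v = v - pairing D v \<alpha> *\<^sub>R \<alpha>"

definition affine_refl :: "'v::real_vector root_datum \<Rightarrow> 'v \<Rightarrow> int \<Rightarrow> 'v \<Rightarrow> 'v" where
  "affine_refl D \<alpha> k v = root_refl D \<alpha> v + of_int k *\<^sub>R \<alpha>"

definition indices :: "'v root_datum \<Rightarrow> nat set" where
  "indices D = {1..num_simple D}"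

definition kac_moody_datum :: "'v::real_vector root_datum \<Rightarrow> bool" where
  "kac_moody_datum D \<longleftrightarrow>
     (\<exists>S :: 'v set. finite S \<and> span S = UNIV) \<and>
     bilinear (form D) \<and>
     (\<forall>u v. form D u v = form D v u) \<and>
     (\<forall>u. (\<forall>v. form D u v = 0) \<longrightarrow> u = 0) \<and>
     inj_on (simple_root D) (indices D) \<and>
     independent (simple_root D ` indices D) \<and>
     (\<forall>p\<in>indices D. form D (simple_root D p) (simple_root D p) > 0) \<and>
     (\<forall>p\<in>indices D. \<forall>q\<in>indices D. p \<noteq> q \<longrightarrow>
        pairing D (simple_root D p) (simple_root D q) \<in> \<int> \<and>
        pairing D (simple_root D p) (simple_root D q) \<le> 0) \<and>
     (\<forall>p\<in>indices D. pairing D (weyl_vec D) (simple_root D p) = 1) \<and>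
     linear (height D) \<and>
     (\<forall>p\<in>indices D. height D (simple_root D p) = 1)"

definition refl_prod :: "'v::real_vector root_datum \<Rightarrow> 'v list \<Rightarrow> 'v \<Rightarrow> 'v" where
  "refl_prod D xs = foldr (\<lambda>\<alpha> w. root_refl D \<alpha> \<circ> w) xs id"

text \<open>Reflections are involutions, so products of reflections already form a group.\<close>

definition refl_group :: "'v::real_vector root_datum \<Rightarrow> 'v set \<Rightarrow> ('v \<Rightarrow> 'v) set" where
  "refl_group D S = {refl_prod D xs | xs. set xs \<subseteq> S}"

definition parabolic :: "'v::real_vector root_datum \<Rightarrow> nat set \<Rightarrow> ('v \<Rightarrow> 'v) set" where
  "parabolic D P = refl_group D (simple_root D ` P)"

text \<open>
  To avoid a circular definition of roots and Weyl group, the latter is generated by the simple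
  reflections; \<open>weyl_group_eq\<close> below shows that all reflections generate the same group.
\<close>

definition weyl_group :: "'v::real_vector root_datum \<Rightarrow> ('v \<Rightarrow> 'v) set" where
  "weyl_group D = parabolic D (indices D)"

definition roots :: "'v::real_vector root_datum \<Rightarrow> 'v set" where
  "roots D = {w (simple_root D p) | w p. w \<in> weyl_group D \<and> p \<in> indices D}"

definition pos_roots :: "'v::real_vector root_datum \<Rightarrow> 'v set" where
  "pos_roots D = {\<alpha> \<in> roots D. \<exists>c. (\<forall>p. c p \<ge> 0) \<and>
     \<alpha> = (\<Sum>p\<in>indices D. c p *\<^sub>R simple_root D p)}"

definition root_sgn :: "'v::real_vector root_datum \<Rightarrow> 'v \<Rightarrow> int" where
  "root_sgn D \<alpha> = (if \<alpha> \<in> pos_roots D then 1 else -1)"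

definition len :: "'v::real_vector root_datum \<Rightarrow> ('v \<Rightarrow> 'v) \<Rightarrow> nat" where
  "len D w = (LEAST n. \<exists>xs. set xs \<subseteq> simple_root D ` indices D \<and> length xs = n \<and>
     w = refl_prod D xs)"

definition bruhat_cover ::
    "'v::real_vector root_datum \<Rightarrow> ('v \<Rightarrow> 'v) \<Rightarrow> ('v \<Rightarrow> 'v) \<Rightarrow> bool" where
  "bruhat_cover D u w \<longleftrightarrow> (\<exists>\<alpha>\<in>pos_roots D. w = u \<circ> root_refl D \<alpha>) \<and> len D w = len D u + 1"

definition weight_lattice :: "'v::real_vector root_datum \<Rightarrow> nat set \<Rightarrow> 'v set" where
  "weight_lattice D P = {v. \<forall>p\<in>P. pairing D v (simple_root D p) \<in> \<int>}"

definition rel_dominant :: "'v::real_vector root_datum \<Rightarrow> nat set \<Rightarrow> 'v set" where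
  "rel_dominant D P =
     {v \<in> weight_lattice D P. \<forall>p\<in>P. pairing D v (simple_root D p) \<ge> 0}"

definition dominant_weights :: "'v::real_vector root_datum \<Rightarrow> 'v set" where
  "dominant_weights D =
     {v \<in> weight_lattice D (indices D). \<forall>\<alpha>\<in>pos_roots D. pairing D v \<alpha> \<ge> 0}"


section \<open>Weyl characters\<close>

text \<open>
  The formal sum of all \<open>c\<^sub>\<nu> e^\<nu>\<close> is represented by its coefficient function \<open>\<nu> \<mapsto> c\<^sub>\<nu>\<close>.
  For elements of \<open>char_ring\<close> the index set of the sum in \<open>char_mult\<close> is finite.
\<close>

definition char_ring :: "'v::real_vector root_datum \<Rightarrow> nat set \<Rightarrow> ('v \<Rightarrow> int) set" where
  "char_ring D P = {f. (\<forall>\<nu>. f \<nu> \<noteq> 0 \<longrightarrow> \<nu> \<in> weight_lattice D P) \<and>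
     (\<forall>h. finite {\<nu>. f \<nu> \<noteq> 0 \<and> height D \<nu> > h})}"

definition char_mult :: "('v::real_vector \<Rightarrow> int) \<Rightarrow> ('v \<Rightarrow> int) \<Rightarrow> 'v \<Rightarrow> int" where
  "char_mult f g \<nu> = (\<Sum>\<mu> | f \<mu> \<noteq> 0 \<and> g (\<nu> - \<mu>) \<noteq> 0. f \<mu> * g (\<nu> - \<mu>))"

text \<open>
  The coefficients of the sum of all \<open>(-1)^\<ell>(w) e^(w(\<nu> + \<rho>) - \<rho>)\<close> over the parabolic subgroup. For
  relatively dominant \<open>\<nu>\<close> the vector \<open>\<nu> + \<rho>\<close> has trivial stabilizer, so that at most one \<open>w\<close>
  contributes to each coefficient.
\<close>

definition weyl_sum :: "'v::real_vector root_datum \<Rightarrow> nat set \<Rightarrow> 'v \<Rightarrow> 'v \<Rightarrow> int" where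
  "weyl_sum D P \<nu> = (\<lambda>x.
     \<Sum>w | w \<in> parabolic D P \<and> w (\<nu> + weyl_vec D) - weyl_vec D = x. (-1) ^ len D w)"

text \<open>
  The quotient of the two alternating sums; the denominator \<open>weyl_sum D P 0\<close> has leading term
  \<open>e^0\<close> and is therefore a unit.
\<close>

definition rel_char :: "'v::real_vector root_datum \<Rightarrow> nat set \<Rightarrow> 'v \<Rightarrow> 'v \<Rightarrow> int" where
  "rel_char D P \<nu> =
     (THE f. f \<in> char_ring D P \<and> char_mult f (weyl_sum D P 0) = weyl_sum D P \<nu>)"

definition weyl_char :: "'v::real_vector root_datum \<Rightarrow> 'v \<Rightarrow> 'v \<Rightarrow> int" where
  "weyl_char D lam = rel_char D (indices D) lam"

text \<open>
  Possibly infinite sums of formal sums, taken coefficientwise; each coefficient must receive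
  only finitely many nonzero contributions.
\<close>

definition has_formal_sum :: "('j \<Rightarrow> 'v \<Rightarrow> int) \<Rightarrow> 'j set \<Rightarrow> ('v \<Rightarrow> int) \<Rightarrow> bool" where
  "has_formal_sum F A f \<longleftrightarrow>
     (\<forall>\<nu>. finite {J \<in> A. F J \<nu> \<noteq> 0} \<and> f \<nu> = (\<Sum>J | J \<in> A \<and> F J \<nu> \<noteq> 0. F J \<nu>))"


section \<open>Chains\<close>

text \<open>
  A family indexed by a totally ordered set is a function on a linearly ordered type together
  with a subset \<open>I\<close>; its values outside \<open>I\<close> are irrelevant.
\<close>

definition chain_count :: "'v::real_vector root_datum \<Rightarrow> 'i::linorder set \<Rightarrow> ('i \<Rightarrow> 'v) \<Rightarrow>
    'i \<Rightarrow> 'v \<Rightarrow> int" where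
  "chain_count D I \<beta> i \<alpha> =
     (if \<alpha> \<in> pos_roots D then int (card {j \<in> I. j < i \<and> \<beta> j = \<alpha>})
      else 1 - int (card {j \<in> I. j < i \<and> \<beta> j = - \<alpha>}))"

definition lambda_chain :: "'v::real_vector root_datum \<Rightarrow> 'v \<Rightarrow> 'i::linorder set \<Rightarrow>
    ('i \<Rightarrow> 'v) \<Rightarrow> bool" where
  "lambda_chain D lam I \<beta> \<longleftrightarrow>
     (\<forall>i\<in>I. \<beta> i \<in> pos_roots D) \<and>
     (\<forall>\<alpha>\<in>pos_roots D. finite {i \<in> I. \<beta> i = \<alpha>} \<and>
        real (card {i \<in> I. \<beta> i = \<alpha>}) = pairing D lam \<alpha>) \<and>
     (\<forall>\<alpha>\<in>roots D. \<forall>\<beta>'\<in>roots D. \<forall>\<gamma>\<in>roots D. \<forall>k::int. \<forall>i\<in>I.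
        \<alpha> \<noteq> \<beta>' \<and> \<alpha> \<noteq> - \<beta>' \<and> coroot D \<gamma> = coroot D \<alpha> + of_int k *\<^sub>R coroot D \<beta>' \<and> \<beta> i = \<beta>'
        \<longrightarrow> chain_count D I \<beta> i \<gamma> = chain_count D I \<beta> i \<alpha> + k * chain_count D I \<beta> i \<beta>')"


section \<open>Admissible subsets and foldings\<close>

definition admissible :: "'v::real_vector root_datum \<Rightarrow> 'i::linorder set \<Rightarrow> ('i \<Rightarrow> 'v) \<Rightarrow>
    'i set \<Rightarrow> bool" where
  "admissible D I \<beta> J \<longleftrightarrow> finite J \<and> J \<subseteq> I \<and>
     (let xs = map \<beta> (sorted_list_of_set J) in
      \<forall>k<length xs. bruhat_cover D (refl_prod D (take k xs)) (refl_prod D (take (Suc k) xs)))"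

definition level0 :: "'i::linorder set \<Rightarrow> ('i \<Rightarrow> 'v) \<Rightarrow> 'i \<Rightarrow> int" where
  "level0 I \<beta> i = int (card {j \<in> I. j < i \<and> \<beta> j = \<beta> i})"

definition weight :: "'v::real_vector root_datum \<Rightarrow> 'v \<Rightarrow> 'i::linorder set \<Rightarrow> ('i \<Rightarrow> 'v) \<Rightarrow>
    'i set \<Rightarrow> 'v" where
  "weight D lam I \<beta> J =
     foldr (\<lambda>j. affine_refl D (\<beta> j) (level0 I \<beta> j)) (sorted_list_of_set J) lam"

type_synonym ('i, 'v) folding = "('i \<Rightarrow> 'v \<times> int) \<times> 'v"

definition fold_op :: "'v::real_vector root_datum \<Rightarrow> 'i::linorder \<Rightarrow> ('i, 'v) folding \<Rightarrow>
    ('i, 'v) folding" where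
  "fold_op D i \<Gamma> = (case \<Gamma> of (g, \<gamma>_inf) \<Rightarrow>
     let s = root_refl D (fst (g i)) in
     (\<lambda>j. if j < i then g j
          else if j = i then (fst (g i), - snd (g i))
          else (s (fst (g j)), snd (g j)),
      s \<gamma>_inf))"

definition folding_of :: "'v::real_vector root_datum \<Rightarrow> ('i::linorder \<Rightarrow> 'v) \<Rightarrow> 'i set \<Rightarrow>
    ('i, 'v) folding" where
  "folding_of D \<beta> J =
     foldr (fold_op D) (sorted_list_of_set J) (\<lambda>i. (\<beta> i, 1), weyl_vec D)"

definition gam :: "('i, 'v) folding \<Rightarrow> 'i \<Rightarrow> 'v" where
  "gam \<Gamma> i = fst (fst \<Gamma> i)"

definition eps :: "('i, 'v) folding \<Rightarrow> 'i \<Rightarrow> int" where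
  "eps \<Gamma> i = snd (fst \<Gamma> i)"

definition level :: "'v::real_vector root_datum \<Rightarrow> 'i::linorder set \<Rightarrow> ('i, 'v) folding \<Rightarrow>
    'i \<Rightarrow> int" where
  "level D I \<Gamma> i =
     (if gam \<Gamma> i \<in> pos_roots D then 0 else -1) +
     (\<Sum>j | j \<in> I \<and> j < i \<and> eps \<Gamma> j = 1 \<and> (gam \<Gamma> j = gam \<Gamma> i \<or> gam \<Gamma> j = - gam \<Gamma> i).
        root_sgn D (gam \<Gamma> j))"

definition max_level :: "'v::real_vector root_datum \<Rightarrow> 'v \<Rightarrow> 'i::linorder set \<Rightarrow> ('i \<Rightarrow> 'v) \<Rightarrow>
    'i set \<Rightarrow> nat \<Rightarrow> real" where
  "max_level D lam I \<beta> J p =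
     (let \<Gamma> = folding_of D \<beta> J;
          a = simple_root D p;
          Ia = {i \<in> I. gam \<Gamma> i = a \<or> gam \<Gamma> i = - a}
      in Max ((\<lambda>i. of_int (level D I \<Gamma> i)) ` Ia \<union> {pairing D (weight D lam I \<beta> J) a}))"


section \<open>The Weyl group is generated by all reflections\<close>

lemma refl_prod_simps:
  "refl_prod D [] = id"
  "refl_prod D (x # xs) = root_refl D x \<circ> refl_prod D xs"
  by (simp_all add: refl_prod_def)

lemma refl_prod_append: "refl_prod D (xs @ ys) = refl_prod D xs \<circ> refl_prod D ys"
  by (induction xs) (simp_all add: refl_prod_simps o_assoc)

lemma root_refl_alt:
  assumes "bilinear (form D)"
  shows "root_refl D \<alpha> v = v - (2 * form D v \<alpha> / form D \<alpha> \<alpha>) *\<^sub>R \<alpha>"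
  using assms by (simp add: root_refl_def pairing_def coroot_def bilinear_rmul)

lemma
  assumes bil: "bilinear (form D)" and sym: "\<And>u v. form D u v = form D v u"
    and nz: "form D x x \<noteq> 0"
  shows root_refl_involution: "root_refl D x (root_refl D x v) = v"
    and form_root_refl: "form D (root_refl D x u) (root_refl D x v) = form D u v"
    and root_refl_refl: "form D y y \<noteq> 0 \<Longrightarrow>
      root_refl D (root_refl D x y) = root_refl D x \<circ> root_refl D y \<circ> root_refl D x"
proof -
  note b = bilinear_rmul[OF bil] bilinear_lmul[OF bil] bilinear_rsub[OF bil] bilinear_lsub[OF bil]
  have lin: "root_refl D x (a - c *\<^sub>R d) = root_refl D x a - c *\<^sub>R root_refl D x d" for a c d
    using nz by (simp add: root_refl_alt[OF bil] b algebra_simps diff_divide_distrib)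
  have inv: "root_refl D x (root_refl D x v) = v" for v
    using nz by (simp add: root_refl_alt[OF bil] b algebra_simps)
  have iso: "form D (root_refl D x u) (root_refl D x v) = form D u v" for u v
    using nz by (simp add: root_refl_alt[OF bil] b field_simps sym[of x v])
  show "root_refl D x (root_refl D x v) = v"
    "form D (root_refl D x u) (root_refl D x v) = form D u v"
    by (rule inv iso)+
  show "root_refl D (root_refl D x y) = root_refl D x \<circ> root_refl D y \<circ> root_refl D x"
    if "form D y y \<noteq> 0"
  proof
    fix v
    have "form D (root_refl D x v) y = form D v (root_refl D x y)"
      using iso[of "root_refl D x v" y] by (simp add: inv)
    then show "root_refl D (root_refl D x y) v = (root_refl D x \<circ> root_refl D y \<circ> root_refl D x) v"
      using lin inv iso by (simp add: root_refl_alt[OF bil, of "root_refl D x y"] root_refl_alt[OF bil, of y])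
  qed
qed

lemma weyl_group_eq:
  assumes "kac_moody_datum D"
  shows "weyl_group D = refl_group D (roots D)"
proof -
  have bil: "bilinear (form D)" and sym: "\<And>u v. form D u v = form D v u"
    and pos: "\<And>p. p \<in> indices D \<Longrightarrow> form D (simple_root D p) (simple_root D p) > 0"
    using assms by (auto simp: kac_moody_datum_def)
  let ?S = "simple_root D ` indices D"
  have nz: "form D x x \<noteq> 0" if "x \<in> ?S" for x
    using that pos by fastforce
  have conj: "form D (refl_prod D xs a) (refl_prod D xs a) \<noteq> 0 \<and>
      root_refl D (refl_prod D xs a) = refl_prod D (xs @ a # rev xs)"
    if "set xs \<subseteq> ?S" "a \<in> ?S" for xs a
    using that
  proof (induction xs)
    case Nil
    then show ?case using nz by (simp add: refl_prod_simps)
  next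
    case (Cons x xs)
    then have x: "form D x x \<noteq> 0" using nz by auto
    from Cons have IH: "form D (refl_prod D xs a) (refl_prod D xs a) \<noteq> 0"
      "root_refl D (refl_prod D xs a) = refl_prod D (xs @ a # rev xs)" by auto
    show ?case
      using IH by (simp add: refl_prod_simps refl_prod_append form_root_refl[OF bil sym x]
          root_refl_refl[OF bil sym x IH(1)] o_assoc)
  qed
  have W: "weyl_group D = refl_group D ?S"
    by (simp add: weyl_group_def parabolic_def)
  have "?S \<subseteq> roots D"
  proof
    fix x assume "x \<in> ?S"
    moreover have "id \<in> weyl_group D"
      unfolding W refl_group_def by (auto intro!: exI[of _ "[]"] simp: refl_prod_simps)
    ultimately show "x \<in> roots D"
      unfolding roots_def by (auto intro!: exI[of _ id])
  qed
  then have 1: "refl_group D ?S \<subseteq> refl_group D (roots D)"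
    unfolding refl_group_def by blast
  have single: "\<exists>zs. set zs \<subseteq> ?S \<and> root_refl D x = refl_prod D zs" if "x \<in> roots D" for x
  proof -
    from that obtain ys p where "set ys \<subseteq> ?S" "p \<in> indices D"
      "x = refl_prod D ys (simple_root D p)"
      by (auto simp: roots_def W refl_group_def)
    then show ?thesis
      using conj[of ys "simple_root D p"]
      by (intro exI[of _ "ys @ simple_root D p # rev ys"]) auto
  qed
  have "\<exists>zs. set zs \<subseteq> ?S \<and> refl_prod D xs = refl_prod D zs" if "set xs \<subseteq> roots D" for xs
    using that
  proof (induction xs)
    case Nil
    then show ?case by (intro exI[of _ "[]"]) simp
  next
    case (Cons x xs)
    then obtain ys where "set ys \<subseteq> ?S" "refl_prod D xs = refl_prod D ys" by auto
    moreover obtain zs where "set zs \<subseteq> ?S" "root_refl D x = refl_prod D zs"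
      using single[of x] Cons.prems by auto
    ultimately show ?case
      by (intro exI[of _ "zs @ ys"]) (simp add: refl_prod_simps refl_prod_append)
  qed
  then have "refl_group D (roots D) \<subseteq> refl_group D ?S"
    unfolding refl_group_def by blast
  with 1 W show ?thesis by blast
qed

end

theory Submission
  imports Defs
begin

text \<open>
  An admissible subset is read as a folded gallery. For a simple root \<open>a\<close> one records the walls of
  the gallery orthogonal to \<open>a\<close> together with their levels; this gives a lattice path from \<open>0\<close> to
  \<open>\<langle>\<mu>(J), a\<^sup>\<or>\<rangle>\<close>. Because a Bruhat cover that is not a reflection in \<open>a\<close> cannot turn an ascent
  by \<open>a\<close> into a descent (the lifting property), reflecting the segment of the gallery before the
  first maximum of the path, or after the last one, preserves admissibility and changes the weight
  by \<open>a\<close>. These operators generate all admissible subsets from the empty one, and reversing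
  strings shows that the multiset of weights is invariant under the Weyl group. Multiplying
  \<open>\<Sum>\<^sub>J e\<^sup>\<mu>\<^sup>(\<^sup>J\<^sup>)\<close> by the Weyl denominator of \<open>P\<close> therefore gives the sum of all
  \<open>sgn(w) e\<^sup>w\<^sup>(\<^sup>\<mu>\<^sup>(\<^sup>J\<^sup>)\<^sup>+\<^sup>\<rho>\<^sup>)\<^sup>-\<^sup>\<rho>\<close>, in which the terms whose path ends below its maximum for some
  \<open>p \<in> P\<close> cancel: take the last wall at which this is visible and reverse the corresponding string
  without its top element, which does not alter the gallery beyond that wall. For \<open>P\<close> the set of
  all indices only the empty set survives, which identifies \<open>\<Sum>\<^sub>J e\<^sup>\<mu>\<^sup>(\<^sup>J\<^sup>)\<close> with \<open>\<chi>(\<lambda>)\<close>.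
\<close>

section \<open>The Weyl group and its roots\<close>

text \<open>No character is computed. The quotient defining it is unique, so identities are proved
  by multiplying with the denominator of \<open>P\<close> and comparing one coefficient at a time;
  the group, the chain and the sums may be infinite, and heights keep each coefficient finite. The
  alternating sum so obtained has to be cancelled by an involution that reflects
  \<open>\<mu>(J) + \<rho>\<close> rather than \<open>\<mu>(J)\<close>. As \<open>\<rho>\<close>
  pairs to 1 with every simple coroot, the weight must move by one multiple of \<open>a\<close> more
  than in an ordinary string reversal, and this 1 is why strings lose their top element. The
  obstacle is the choice of \<open>a\<close>, which must be the same for a set and its partner.
  Refolding changes the levels before the refolded walls relative to the endpoint, but beyond them
  it translates everything, and comparing a level with the endpoint is insensitive to translation:
  hence the last violation and not the first. Levels enter through a single fact: moved past the
  preceding folds, the affine reflection at a wall orthogonal to \<open>a\<close> is the reflection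
  in the hyperplane orthogonal to \<open>a\<close> at the height given by the level.\<close>

locale kac_moody =
  fixes D :: "'v::real_vector root_datum"
  assumes datum: "kac_moody_datum D"
begin

abbreviation simples :: "'v set" ("\<Delta>") where "\<Delta> \<equiv> simple_root D ` indices D"
abbreviation refl :: "'v \<Rightarrow> 'v \<Rightarrow> 'v" ("\<sigma>") where "\<sigma> \<equiv> root_refl D"

lemma bil: "bilinear (form D)"
  and form_sym: "form D u v = form D v u"
  and independent_simples: "independent \<Delta>"
  using datum by (auto simp: kac_moody_datum_def)

lemma finite_simples: "finite \<Delta>"
  by (simp add: indices_def)

lemma form_simple_pos: "a \<in> \<Delta> \<Longrightarrow> form D a a > 0"
  using datum by (auto simp: kac_moody_datum_def)

lemmas form_bilinear = bilinear_rmul[OF bil] bilinear_lmul[OF bil] bilinear_rsub[OF bil]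
  bilinear_lsub[OF bil] bilinear_ladd[OF bil] bilinear_radd[OF bil] bilinear_lneg[OF bil]
  bilinear_rneg[OF bil] bilinear_lzero[OF bil] bilinear_rzero[OF bil]

lemma pairing_alt: "pairing D v a = 2 * form D v a / form D a a"
  by (simp add: pairing_def coroot_def form_bilinear)

lemma pairing_linear: "linear (\<lambda>v. pairing D v a)"
  by (rule linearI) (simp_all add: pairing_alt form_bilinear algebra_simps add_divide_distrib)

lemmas pairing_simps = linear_add[OF pairing_linear] linear_diff[OF pairing_linear]
  linear_scale[OF pairing_linear] linear_neg[OF pairing_linear] linear_0[OF pairing_linear]

lemma pairing_minus_right: "pairing D v (- a) = - pairing D v a"
  by (simp add: pairing_alt form_bilinear)

lemma refl_minus: "\<sigma> (- a) = \<sigma> a"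
  by (rule ext) (simp add: root_refl_def pairing_minus_right)

lemma refl_scale: "t \<noteq> 0 \<Longrightarrow> \<sigma> (t *\<^sub>R a) = \<sigma> a"
  by (rule ext) (simp add: root_refl_alt[OF bil] form_bilinear)

lemma refl_linear: "linear (\<sigma> a)"
  by (rule linearI) (simp_all add: root_refl_def pairing_simps algebra_simps)

lemma pairing_self: "form D a a \<noteq> 0 \<Longrightarrow> pairing D a a = 2"
  by (simp add: pairing_alt)

lemma refl_self: "form D a a \<noteq> 0 \<Longrightarrow> \<sigma> a a = - a"
  by (simp add: root_refl_def pairing_self scaleR_2)

lemma refl_invol: "form D a a \<noteq> 0 \<Longrightarrow> \<sigma> a (\<sigma> a v) = v"
  by (rule root_refl_involution[OF bil form_sym])

lemma refl_invol_comp: "form D a a \<noteq> 0 \<Longrightarrow> \<sigma> a \<circ> \<sigma> a = id"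
  by (rule ext) (simp add: refl_invol)

section \<open>Isometries of the form\<close>

definition isometry :: "('v \<Rightarrow> 'v) \<Rightarrow> bool" where
  "isometry w \<longleftrightarrow> linear w \<and> bij w \<and> (\<forall>u v. form D (w u) (w v) = form D u v)"

lemma isometry_pairing: "isometry w \<Longrightarrow> pairing D (w u) (w v) = pairing D u v"
  by (simp add: isometry_def pairing_alt)

lemma isometry_refl: "isometry w \<Longrightarrow> w \<circ> \<sigma> a = \<sigma> (w a) \<circ> w"
  by (rule ext)
    (simp add: root_refl_def isometry_pairing linear_diff linear_scale isometry_def[THEN iffD1])

lemma isometry_comp: "isometry u \<Longrightarrow> isometry w \<Longrightarrow> isometry (u \<circ> w)"
  by (auto simp: isometry_def linear_compose bij_comp)

lemma isometry_id: "isometry id"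
  by (auto simp: isometry_def linear_id)

lemma isometry_inv: "isometry w \<Longrightarrow> isometry (inv w)"
proof -
  assume w: "isometry w"
  then have fi: "w (inv w x) = x" for x by (simp add: isometry_def bij_is_surj surj_f_inv_f)
  have inj: "w x = w y \<Longrightarrow> x = y" for x y using w by (metis isometry_def bij_is_inj injD)
  have lin: "linear w" using w by (simp add: isometry_def)
  have "linear (inv w)"
    by (rule linearI; rule inj) (simp_all add: fi linear_add[OF lin] linear_scale[OF lin])
  moreover have "form D (inv w u) (inv w v) = form D u v" for u v
    using w fi unfolding isometry_def by metis
  ultimately show ?thesis using w by (simp add: isometry_def bij_imp_bij_inv)
qed

lemma refl_isometry: "form D a a \<noteq> 0 \<Longrightarrow> isometry (\<sigma> a)"
  by (auto simp: isometry_def refl_linear form_root_refl[OF bil form_sym] refl_invol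
      intro!: involuntory_imp_bij)

section \<open>Coordinates and the lattice spanned by a set of simple roots\<close>

definition crd :: "'v \<Rightarrow> 'v \<Rightarrow> real" where
  "crd a = (SOME g. linear g \<and> (\<forall>b\<in>\<Delta>. g b = (if b = a then 1 else 0)))"

lemma crd_spec: "linear (crd a) \<and> (\<forall>b\<in>\<Delta>. crd a b = (if b = a then 1 else 0))"
proof -
  have "\<exists>g. linear g \<and> (\<forall>b\<in>\<Delta>. g b = (if b = a then 1 else 0 :: real))"
    by (rule linear_independent_extend[OF independent_simples])
  from someI_ex[OF this] show ?thesis unfolding crd_def .
qed

lemma crd_linear: "linear (crd a)" using crd_spec by blast
lemma crd_simple: "b \<in> \<Delta> \<Longrightarrow> crd a b = (if b = a then 1 else 0)" using crd_spec by blast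

lemmas crd_simps = linear_add[OF crd_linear] linear_diff[OF crd_linear]
  linear_scale[OF crd_linear] linear_neg[OF crd_linear] linear_0[OF crd_linear]

text \<open>The simple roots need not span the space, and \<open>crd a\<close> is an arbitrary
  linear extension of a dual basis functional. Integral coordinates therefore do not suffice and the
  expansion itself is demanded.\<close>

definition Qlat :: "'v set \<Rightarrow> 'v set" where
  "Qlat S = {x. (\<forall>a\<in>S. crd a x \<in> \<int>) \<and> x = (\<Sum>a\<in>S. crd a x *\<^sub>R a)}"

definition Qpos :: "'v set \<Rightarrow> 'v set" where
  "Qpos S = {x \<in> Qlat S. \<forall>a\<in>S. crd a x \<ge> 0}"

lemma finite_sub: "S \<subseteq> \<Delta> \<Longrightarrow> finite S"
  using finite_simples finite_subset by blast

lemma Qlat_add: "x \<in> Qlat S \<Longrightarrow> y \<in> Qlat S \<Longrightarrow> x + y \<in> Qlat S"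
  unfolding Qlat_def by (simp add: crd_simps scaleR_add_left sum.distrib)

lemma Qlat_scale: "x \<in> Qlat S \<Longrightarrow> k \<in> \<int> \<Longrightarrow> k *\<^sub>R x \<in> Qlat S"
  unfolding Qlat_def by (simp add: crd_simps flip: scaleR_scaleR scaleR_sum_right)

lemma Qlat_neg: "x \<in> Qlat S \<Longrightarrow> - x \<in> Qlat S"
  using Qlat_scale[of x S "-1"] by simp

lemma Qlat_simple:
  assumes "S \<subseteq> \<Delta>" "a \<in> S" shows "a \<in> Qlat S"
proof -
  have "(\<Sum>b\<in>S. crd b a *\<^sub>R b) = (\<Sum>b\<in>S. if b = a then b else 0)"
    using assms by (intro sum.cong) (auto simp: crd_simple)
  then show ?thesis
    using assms finite_sub[OF assms(1)] by (auto simp: Qlat_def crd_simple)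
qed

lemma Qpos_add: "x \<in> Qpos S \<Longrightarrow> y \<in> Qpos S \<Longrightarrow> x + y \<in> Qpos S"
  unfolding Qpos_def by (auto simp: crd_simps Qlat_add)

lemma Qpos_scale: "x \<in> Qpos S \<Longrightarrow> k \<in> \<int> \<Longrightarrow> k \<ge> 0 \<Longrightarrow> k *\<^sub>R x \<in> Qpos S"
  unfolding Qpos_def by (auto simp: crd_simps Qlat_scale)

lemma Qpos_zero: "0 \<in> Qpos S"
  by (auto simp: Qpos_def Qlat_def crd_simps)

lemma Qpos_simple: "S \<subseteq> \<Delta> \<Longrightarrow> a \<in> S \<Longrightarrow> a \<in> Qpos S"
  by (auto simp: Qpos_def Qlat_simple crd_simple)

lemma Qpos_Qlat: "x \<in> Qpos S \<Longrightarrow> x \<in> Qlat S"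
  by (simp add: Qpos_def)

lemma Qlat_crd_outside:
  assumes "x \<in> Qlat S" "S \<subseteq> \<Delta>" "b \<notin> S" shows "crd b x = 0"
proof -
  have "crd b x = crd b (\<Sum>a\<in>S. crd a x *\<^sub>R a)" using assms(1) by (simp add: Qlat_def)
  also have "\<dots> = (\<Sum>a\<in>S. crd a x * crd b a)"
    by (simp add: linear_sum[OF crd_linear] crd_simps)
  also have "\<dots> = 0" using assms by (intro sum.neutral) (auto simp: crd_simple subset_iff)
  finally show ?thesis .
qed

lemma Qpos_antisym:
  assumes "x \<in> Qpos S" "- x \<in> Qpos S" shows "x = 0"
proof -
  have "crd a x = 0" if "a \<in> S" for a
    using assms that by (force simp: Qpos_def crd_simps)
  then have "(\<Sum>a\<in>S. crd a x *\<^sub>R a) = 0" by simp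
  then show ?thesis using assms by (simp add: Qpos_def Qlat_def)
qed

lemma pairing_simple:
  assumes "a \<in> \<Delta>" "b \<in> \<Delta>"
  shows "pairing D a b \<in> \<int>" "a \<noteq> b \<Longrightarrow> pairing D a b \<le> 0"
proof -
  show "pairing D a b \<le> 0" if "a \<noteq> b"
    using datum assms that by (auto simp: kac_moody_datum_def)
  show "pairing D a b \<in> \<int>"
  proof (cases "a = b")
    case True
    then show ?thesis using form_simple_pos[OF assms(1)] by (simp add: pairing_self)
  next
    case False
    then show ?thesis using datum assms by (auto simp: kac_moody_datum_def)
  qed
qed

lemma form_simple_nonpos:
  assumes "a \<in> \<Delta>" "b \<in> \<Delta>" "a \<noteq> b" shows "form D a b \<le> 0"
  using pairing_simple(2)[OF assms] form_simple_pos[OF assms(2)]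
  by (simp add: pairing_alt divide_le_0_iff)

lemma Qlat_pairing:
  assumes "x \<in> Qlat S" "S \<subseteq> \<Delta>" "b \<in> \<Delta>" shows "pairing D x b \<in> \<int>"
proof -
  have "pairing D x b = pairing D (\<Sum>a\<in>S. crd a x *\<^sub>R a) b" using assms(1) by (simp add: Qlat_def)
  also have "\<dots> = (\<Sum>a\<in>S. crd a x * pairing D a b)"
    by (simp add: linear_sum[OF pairing_linear] pairing_simps)
  also have "\<dots> \<in> \<int>" using assms pairing_simple
    by (intro Ints_sum Ints_mult) (auto simp: Qlat_def)
  finally show ?thesis .
qed

lemma Qlat_refl:
  assumes "x \<in> Qlat S" "S \<subseteq> \<Delta>" "b \<in> S" shows "\<sigma> b x \<in> Qlat S"
  unfolding root_refl_def using assms Qlat_pairing[OF assms(1,2)] Qlat_simple[of S b]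
    Qlat_add[of x S "- pairing D x b *\<^sub>R b"] Qlat_scale[of b S "- pairing D x b"]
  by auto

lemma Qlat_refl_prod:
  assumes "set xs \<subseteq> S" "S \<subseteq> \<Delta>" "x \<in> Qlat S" shows "refl_prod D xs x \<in> Qlat S"
  using assms by (induction xs) (auto simp: refl_prod_simps Qlat_refl)

section \<open>Words, parabolic subgroups and relative length\<close>

lemma simple_nonisotropic: "a \<in> \<Delta> \<Longrightarrow> form D a a \<noteq> 0"
  using form_simple_pos by fastforce

lemma refl_prod_isometry:
  assumes "\<And>x. x \<in> set xs \<Longrightarrow> form D x x \<noteq> 0" shows "isometry (refl_prod D xs)"
  using assms by (induction xs) (auto simp: refl_prod_simps isometry_id intro!: isometry_comp refl_isometry)

lemma group_isometry:
  assumes "w \<in> refl_group D S" "S \<subseteq> \<Delta>" shows "isometry w"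
  using assms simple_nonisotropic by (fastforce simp: refl_group_def intro!: refl_prod_isometry)

lemma group_word: "set xs \<subseteq> S \<Longrightarrow> refl_prod D xs \<in> refl_group D S"
  by (auto simp: refl_group_def)

lemma group_id: "id \<in> refl_group D S"
  using group_word[of "[]"] by (simp add: refl_prod_simps)

lemma group_comp: "u \<in> refl_group D S \<Longrightarrow> w \<in> refl_group D S \<Longrightarrow> u \<circ> w \<in> refl_group D S"
  by (force simp: refl_group_def simp flip: refl_prod_append)

lemma group_refl: "a \<in> S \<Longrightarrow> \<sigma> a \<in> refl_group D S"
  using group_word[of "[a]" S] by (simp add: refl_prod_simps)

lemma group_mono: "S \<subseteq> T \<Longrightarrow> refl_group D S \<subseteq> refl_group D T"
  by (auto simp: refl_group_def)

lemma refl_prod_rev: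
  assumes "set xs \<subseteq> \<Delta>"
  shows "refl_prod D xs \<circ> refl_prod D (rev xs) = id"
  using assms
proof (induction xs)
  case (Cons x xs)
  have "refl_prod D (x # xs) \<circ> refl_prod D (rev (x # xs)) =
      \<sigma> x \<circ> (refl_prod D xs \<circ> refl_prod D (rev xs)) \<circ> \<sigma> x"
    by (simp add: refl_prod_simps refl_prod_append comp_assoc)
  also have "refl_prod D xs \<circ> refl_prod D (rev xs) = id" by (rule Cons.IH) (use Cons.prems in simp)
  also have "\<sigma> x \<circ> id \<circ> \<sigma> x = id"
    using Cons.prems by (simp only: comp_id) (simp add: refl_invol_comp[OF simple_nonisotropic] del: o_apply)
  finally show ?case .
qed (simp add: refl_prod_simps)

lemma inv_refl_prod:
  assumes "set xs \<subseteq> \<Delta>" shows "inv (refl_prod D xs) = refl_prod D (rev xs)"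
  using refl_prod_rev[OF assms] refl_prod_rev[of "rev xs"] assms
  by (intro inv_unique_comp) auto

lemma group_inv:
  assumes "w \<in> refl_group D S" "S \<subseteq> \<Delta>" shows "inv w \<in> refl_group D S"
  using assms unfolding refl_group_def by (force simp: inv_refl_prod)

text \<open>Length relative to any set of generators; for \<open>\<Delta>\<close> it is
  \<open>len\<close>. The reduction to rank two compares lengths in a rank two subgroup with lengths
  in the group generated by \<open>S\<close>.\<close>

definition wlen :: "'v set \<Rightarrow> ('v \<Rightarrow> 'v) \<Rightarrow> nat" where
  "wlen S w = (LEAST n. \<exists>xs. set xs \<subseteq> S \<and> length xs = n \<and> w = refl_prod D xs)"

lemma len_eq_wlen: "len D w = wlen \<Delta> w"
  by (simp add: len_def wlen_def)

lemma wlen_le: "set xs \<subseteq> S \<Longrightarrow> wlen S (refl_prod D xs) \<le> length xs"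
  unfolding wlen_def by (rule Least_le) auto

lemma reduced_word:
  assumes "w \<in> refl_group D S"
  obtains xs where "set xs \<subseteq> S" "length xs = wlen S w" "w = refl_prod D xs"
proof -
  have "\<exists>n. \<exists>xs. set xs \<subseteq> S \<and> length xs = n \<and> w = refl_prod D xs"
    using assms by (auto simp: refl_group_def)
  from LeastI_ex[OF this] show ?thesis using that unfolding wlen_def by blast
qed

lemma wlen_comp_le:
  assumes "u \<in> refl_group D S" "w \<in> refl_group D S"
  shows "wlen S (u \<circ> w) \<le> wlen S u + wlen S w"
proof -
  obtain xs where "set xs \<subseteq> S" "length xs = wlen S u" "u = refl_prod D xs"
    using reduced_word[OF assms(1)] .
  moreover obtain ys where "set ys \<subseteq> S" "length ys = wlen S w" "w = refl_prod D ys"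
    using reduced_word[OF assms(2)] .
  ultimately show ?thesis using wlen_le[of "xs @ ys" S] by (simp add: refl_prod_append)
qed

lemma wlen_mono:
  assumes "S \<subseteq> T" "w \<in> refl_group D S" shows "wlen T w \<le> wlen S w"
  using reduced_word[OF assms(2)] wlen_le[of _ T] assms(1) by (metis order_trans)

lemma wlen_id: "wlen S id = 0"
  using wlen_le[of "[]" S] by (simp add: refl_prod_simps)

lemma wlen_refl: "a \<in> S \<Longrightarrow> wlen S (\<sigma> a) \<le> 1"
  using wlen_le[of "[a]" S] by (simp add: refl_prod_simps)

lemma comp_refl_refl: "a \<in> \<Delta> \<Longrightarrow> w \<circ> \<sigma> a \<circ> \<sigma> a = w"
  by (simp add: comp_assoc refl_invol_comp[OF simple_nonisotropic])

lemma refl_comp_refl: "a \<in> \<Delta> \<Longrightarrow> \<sigma> a \<circ> (\<sigma> a \<circ> w) = w"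
  by (simp add: o_assoc refl_invol_comp[OF simple_nonisotropic])

lemma wlen_comp_refl:
  assumes "w \<in> refl_group D S" "a \<in> S" "S \<subseteq> \<Delta>"
  shows "wlen S (w \<circ> \<sigma> a) \<le> wlen S w + 1" "wlen S w \<le> wlen S (w \<circ> \<sigma> a) + 1"
proof -
  have 1: "wlen S (w \<circ> \<sigma> a) \<le> wlen S w + 1" if "w \<in> refl_group D S" for w
    using wlen_comp_le[OF that group_refl[OF assms(2)]] wlen_refl[OF assms(2)] by linarith
  show "wlen S (w \<circ> \<sigma> a) \<le> wlen S w + 1" by (rule 1[OF assms(1)])
  show "wlen S w \<le> wlen S (w \<circ> \<sigma> a) + 1"
    using 1[of "w \<circ> \<sigma> a"] assms comp_refl_refl[of a w] group_comp group_refl by (metis subsetD)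
qed

lemma wlen_inv:
  assumes "w \<in> refl_group D S" "S \<subseteq> \<Delta>" shows "wlen S (inv w) = wlen S w"
proof -
  have le: "wlen S (inv w) \<le> wlen S w" if w: "w \<in> refl_group D S" for w
  proof -
    obtain xs where "set xs \<subseteq> S" "length xs = wlen S w" "w = refl_prod D xs"
      using reduced_word[OF w] .
    then show ?thesis using wlen_le[of "rev xs" S] assms(2) by (simp add: inv_refl_prod)
  qed
  have "inv (inv w) = w" using group_isometry[OF assms] by (simp add: isometry_def inv_inv_eq)
  then show ?thesis using le[OF assms(1)] le[OF group_inv[OF assms]] by simp
qed

section \<open>The exchange condition and the sign of roots\<close>

definition sign_coherent :: "'v set \<Rightarrow> bool" where
  "sign_coherent S \<longleftrightarrow> (\<forall>w\<in>refl_group D S. \<forall>c\<in>S. w c \<in> Qpos S \<or> - w c \<in> Qpos S)"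

text \<open>The reflection in \<open>a\<close> changes only the coordinate at \<open>a\<close>, so
  every other coordinate of \<open>x\<close> is both nonnegative and nonpositive.\<close>

lemma simple_refl_pos_neg:
  assumes "S \<subseteq> \<Delta>" "a \<in> S" "x \<in> Qpos S" "- \<sigma> a x \<in> Qpos S"
  shows "x = crd a x *\<^sub>R a"
proof -
  have "crd b x = 0" if "b \<in> S" "b \<noteq> a" for b
  proof -
    have "crd b (\<sigma> a x) = crd b x"
      using that assms(1,2) by (simp add: root_refl_def crd_simps crd_simple subset_iff)
    then show ?thesis using assms(3,4) that by (force simp: Qpos_def crd_simps)
  qed
  then have "(\<Sum>b\<in>S. crd b x *\<^sub>R b) = (\<Sum>b\<in>S. if b = a then crd a x *\<^sub>R a else 0)"
    by (intro sum.cong) auto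
  then show ?thesis using assms finite_sub[OF assms(1)] by (simp add: Qpos_def Qlat_def)
qed

lemma isometry_nonzero: "isometry w \<Longrightarrow> c \<in> \<Delta> \<Longrightarrow> w c \<noteq> 0"
  using simple_nonisotropic[of c] by (auto simp: isometry_def form_bilinear dest!: spec[of _ c])

text \<open>As the letters act from the right, \<open>x\<close> changes sign at some letter
  \<open>b\<close>. Just before, its image is positive and \<open>b\<close> makes it negative, so it
  is a multiple of \<open>b\<close>; conjugation turns \<open>\<sigma> x\<close> into
  \<open>\<sigma> b\<close>, which cancels that letter. Sign coherence is a hypothesis because it is
  known in rank two before it is known in general, and the general case uses exchange in rank
  two.\<close>

lemma exchange:
  assumes S: "S \<subseteq> \<Delta>" and coh: "sign_coherent S"
    and x: "x = u c" "u \<in> refl_group D S" "c \<in> S" "x \<in> Qpos S"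
    and xs: "set xs \<subseteq> S" "- refl_prod D xs x \<in> Qpos S"
  shows "\<exists>k<length xs. refl_prod D xs \<circ> \<sigma> x = refl_prod D (take k xs @ drop (Suc k) xs)"
  using xs
proof (induction xs)
  case Nil
  then have "x = 0" using x Qpos_antisym by (simp add: refl_prod_simps)
  then show ?case using isometry_nonzero[OF group_isometry[OF x(2) S], of c] x S by auto
next
  case (Cons b xs)
  let ?w = "refl_prod D xs"
  have w: "?w \<in> refl_group D S" and iso: "isometry ?w"
    using Cons.prems S group_word[of xs S] group_isometry[of ?w S] by auto
  have root: "?w x = (?w \<circ> u) c" "?w \<circ> u \<in> refl_group D S"
    using x w group_comp by auto
  show ?case
  proof (cases "- ?w x \<in> Qpos S")
    case True
    then obtain k where "k < length xs" "?w \<circ> \<sigma> x = refl_prod D (take k xs @ drop (Suc k) xs)"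
      using Cons.IH Cons.prems(1) by (metis insert_subset list.simps(15))
    then show ?thesis
      by (intro exI[of _ "Suc k"])
        (simp only: refl_prod_simps comp_assoc length_Cons Suc_less_eq take_Suc_Cons drop_Suc_Cons
          append_Cons simp_thms)
  next
    case False
    then have pos: "?w x \<in> Qpos S"
      using coh root x(3) unfolding sign_coherent_def by metis
    have b: "b \<in> S" "b \<in> \<Delta>" using Cons.prems S by auto
    have eq: "?w x = crd b (?w x) *\<^sub>R b"
      using simple_refl_pos_neg[OF S b(1) pos] Cons.prems by (simp add: refl_prod_simps)
    have "?w x \<noteq> 0"
      using isometry_nonzero[OF group_isometry[OF root(2) S], of c] root(1) x(3) S by auto
    then have "\<sigma> (?w x) = \<sigma> b" using eq refl_scale by (metis scale_eq_0_iff)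
    then have "?w \<circ> \<sigma> x = \<sigma> b \<circ> ?w" using isometry_refl[OF iso] by simp
    then have "\<sigma> b \<circ> ?w \<circ> \<sigma> x = ?w" using refl_comp_refl[OF b(2)] by (simp only: comp_assoc)
    then show ?thesis
      by (intro exI[of _ 0])
        (simp only: refl_prod_simps length_Cons zero_less_Suc take_0 drop_Suc_Cons drop_0 append_Nil simp_thms)
  qed
qed

lemma exchange_wlen:
  assumes S: "S \<subseteq> \<Delta>" and coh: "sign_coherent S"
    and x: "x = u c" "u \<in> refl_group D S" "c \<in> S" "x \<in> Qpos S"
    and w: "w \<in> refl_group D S" "- w x \<in> Qpos S"
  shows "wlen S (w \<circ> \<sigma> x) < wlen S w"
proof -
  obtain xs where xs: "set xs \<subseteq> S" "length xs = wlen S w" "w = refl_prod D xs"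
    using reduced_word[OF w(1)] .
  then obtain k where k: "k < length xs"
    "w \<circ> \<sigma> x = refl_prod D (take k xs @ drop (Suc k) xs)"
    using exchange[OF S coh x] w by blast
  have "set (take k xs @ drop (Suc k) xs) \<subseteq> S"
    using xs(1) set_take_subset[of k xs] set_drop_subset[of "Suc k" xs] by auto
  from wlen_le[OF this] k xs(2) show ?thesis by simp
qed

lemma pos_of_wlen:
  assumes "S \<subseteq> \<Delta>" "sign_coherent S" "w \<in> refl_group D S" "c \<in> S"
    "wlen S w \<le> wlen S (w \<circ> \<sigma> c)"
  shows "w c \<in> Qpos S"
proof (rule ccontr)
  assume "w c \<notin> Qpos S"
  then have "- w c \<in> Qpos S" using assms unfolding sign_coherent_def by blast
  from exchange_wlen[OF assms(1,2) _ group_id assms(4) Qpos_simple[OF assms(1,4)] assms(3) this]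
  show False using assms(5) by simp
qed

text \<open>
  In rank two a vector of mixed signs with integral coordinates is longer than both simple roots,
  since these form an obtuse angle.
\<close>

lemma sign_coherent_rank2:
  assumes "a \<in> \<Delta>" "b \<in> \<Delta>" "a \<noteq> b"
  shows "sign_coherent {a, b}"
  unfolding sign_coherent_def
proof (intro ballI)
  fix w c assume w: "w \<in> refl_group D {a, b}" and c: "c \<in> {a, b}"
  have S: "{a, b} \<subseteq> \<Delta>" using assms by auto
  define x where "x = w c"
  have lat: "x \<in> Qlat {a, b}"
    using w c S Qlat_simple[of "{a, b}"] unfolding x_def refl_group_def
    by (auto intro!: Qlat_refl_prod)
  define m n where "m = crd a x" and "n = crd b x"
  have mn: "m \<in> \<int>" "n \<in> \<int>" and x: "x = m *\<^sub>R a + n *\<^sub>R b"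
    using lat assms(3) by (auto simp: Qlat_def m_def n_def)
  have q: "form D x x = form D c c"
    using group_isometry[OF w S] by (simp add: x_def isometry_def)
  have pos: "form D a a > 0" "form D b b > 0" using form_simple_pos assms by auto
  have ab: "form D a b \<le> 0" using form_simple_nonpos[OF assms] .
  have sq: "k * k \<ge> 1" if "k \<in> \<int>" "k \<noteq> 0" for k :: real
  proof -
    obtain i where i: "k = of_int i" using \<open>k \<in> \<int>\<close> by (auto elim: Ints_cases)
    then have "i * i \<ge> 1" using that by (simp add: int_one_le_iff_zero_less zero_less_mult_iff linorder_neq_iff disj_commute)
    then show ?thesis using i by (metis of_int_1_le_iff of_int_mult)
  qed
  have nomix: "\<not> m * n < 0"
  proof
    assume neg: "m * n < 0"
    have "form D x x = (m * m) * form D a a + 2 * (m * n) * form D a b + (n * n) * form D b b"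
      using form_sym[of a b] by (simp add: x form_bilinear algebra_simps)
    moreover have "m * n * form D a b \<ge> 0" using neg ab by (simp add: zero_le_mult_iff)

    moreover have "1 * form D a a \<le> (m * m) * form D a a" "1 * form D b b \<le> (n * n) * form D b b"
      using sq[of m] sq[of n] mn neg pos by (fastforce intro!: mult_right_mono)+
    moreover have "2 * (m * n) * form D a b = 2 * (m * n * form D a b)" by simp
    ultimately have "form D x x \<ge> form D a a + form D b b" by linarith
    then show False using q c pos by auto
  qed
  then have "(m \<ge> 0 \<and> n \<ge> 0) \<or> (m \<le> 0 \<and> n \<le> 0)" by (auto simp: mult_less_0_iff)
  then show "w c \<in> Qpos {a, b} \<or> - w c \<in> Qpos {a, b}"
    using lat Qlat_neg[OF lat] unfolding x_def[symmetric] Qpos_def m_def n_def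
    by (auto simp: crd_simps)
qed

lemma Qpos_image:
  assumes "S \<subseteq> \<Delta>" "x \<in> Qpos T" "linear v" "\<And>a. a \<in> T \<Longrightarrow> v a \<in> Qpos S"
  shows "v x \<in> Qpos S"
proof -
  have "x = (\<Sum>a\<in>T. crd a x *\<^sub>R a)" and c: "\<And>a. a \<in> T \<Longrightarrow> crd a x \<in> \<int> \<and> crd a x \<ge> 0"
    using assms(2) by (auto simp: Qpos_def Qlat_def)
  then have "v x = (\<Sum>a\<in>T. crd a x *\<^sub>R v a)"
    by (metis (no_types, lifting) linear_scale linear_sum sum.cong assms(3))
  moreover have "(\<Sum>a\<in>F. crd a x *\<^sub>R v a) \<in> Qpos S" if "F \<subseteq> T" for F
    using that by (induction F rule: infinite_finite_induct)
      (auto simp: Qpos_zero c assms(4) intro!: Qpos_add Qpos_scale)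
  ultimately show ?thesis by simp
qed

lemma wlen_last:
  assumes "w \<in> refl_group D S" "w \<noteq> id" "S \<subseteq> \<Delta>"
  obtains q where "q \<in> S" "wlen S (w \<circ> \<sigma> q) < wlen S w"
proof -
  obtain xs where xs: "set xs \<subseteq> S" "length xs = wlen S w" "w = refl_prod D xs"
    using reduced_word[OF assms(1)] .
  with assms(2) obtain ys q where ys: "xs = ys @ [q]"
    by (metis refl_prod_simps(1) rev_exhaust)
  then have q: "q \<in> S" "q \<in> \<Delta>" using xs assms by auto
  have "w \<circ> \<sigma> q = refl_prod D ys"
    using comp_refl_refl[OF q(2)] by (simp add: xs(3) ys refl_prod_append refl_prod_simps)
  then have "wlen S (w \<circ> \<sigma> q) < wlen S w"
    using wlen_le[of ys S] xs ys by auto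
  then show ?thesis using that q by blast
qed

text \<open>
  This is the classical argument of Deodhar and Humphreys: a coset representative of minimal length
  with respect to a rank two parabolic subgroup reduces the claim to rank two.
\<close>

lemma pos_of_wlen_le:
  assumes "S \<subseteq> \<Delta>" "w \<in> refl_group D S" "c \<in> S" "wlen S w \<le> wlen S (w \<circ> \<sigma> c)"
  shows "w c \<in> Qpos S"
  using assms(2-4)
proof (induction "wlen S w" arbitrary: w c rule: less_induct)
  case less
  note S = assms(1)
  show ?case
  proof (cases "w = id")
    case True
    then show ?thesis using Qpos_simple[OF S] less.prems by simp
  next
    case False
    obtain q where q: "q \<in> S" "wlen S (w \<circ> \<sigma> q) < wlen S w"
      using wlen_last[OF less.prems(1) False S] .
    have "q \<noteq> c" using q less.prems by auto
    define T where "T = {c, q}"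
    have T: "T \<subseteq> S" "T \<subseteq> \<Delta>" using q less.prems S by (auto simp: T_def)
    have coh: "sign_coherent T"
      unfolding T_def using T \<open>q \<noteq> c\<close> by (intro sign_coherent_rank2) (auto simp: T_def)
    \<comment> \<open>Factorizations of \<open>w\<close> with controlled length and left factor of
      length \<open>n\<close>. Minimizing \<open>n\<close> gives the minimal coset representative,
      and the descent \<open>q\<close> shows that it is shorter than \<open>w\<close>, so the
      induction hypothesis covers it.\<close>
    define fac where "fac n \<longleftrightarrow> (\<exists>v u. v \<in> refl_group D S \<and> u \<in> refl_group D T \<and> w = v \<circ> u \<and>
      wlen S v + wlen T u \<le> wlen S w \<and> wlen S v = n)" for n
    have "fac (wlen S (w \<circ> \<sigma> q))"
      unfolding fac_def
    proof (intro exI conjI)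
      show "w \<circ> \<sigma> q \<in> refl_group D S" using group_comp group_refl less.prems q by blast
      show "\<sigma> q \<in> refl_group D T" by (rule group_refl) (simp add: T_def)
      show "w = (w \<circ> \<sigma> q) \<circ> \<sigma> q" using comp_refl_refl[of q w] q S by auto
      show "wlen S (w \<circ> \<sigma> q) + wlen T (\<sigma> q) \<le> wlen S w"
        using q(2) wlen_refl[of q T] by (simp add: T_def)
    qed simp
    then have "fac (LEAST n. fac n)" and least: "(LEAST n. fac n) \<le> wlen S (w \<circ> \<sigma> q)"
      by (auto intro: LeastI Least_le)
    then obtain v u where vu: "v \<in> refl_group D S" "u \<in> refl_group D T" "w = v \<circ> u"
      "wlen S v + wlen T u \<le> wlen S w" "wlen S v = (LEAST n. fac n)"
      unfolding fac_def by blast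
    have "wlen S v \<le> wlen S (v \<circ> \<sigma> d)" if d: "d \<in> T" for d
    proof (rule ccontr)
      assume neg: "\<not> wlen S v \<le> wlen S (v \<circ> \<sigma> d)"
      have "fac (wlen S (v \<circ> \<sigma> d))"
        unfolding fac_def
      proof (intro exI conjI)
        show "v \<circ> \<sigma> d \<in> refl_group D S" using group_comp group_refl vu d T by blast
        show "\<sigma> d \<circ> u \<in> refl_group D T" using group_comp group_refl vu d by blast
        have "(v \<circ> \<sigma> d) \<circ> (\<sigma> d \<circ> u) = v \<circ> (\<sigma> d \<circ> (\<sigma> d \<circ> u))" by (simp only: comp_assoc)
        then show "w = (v \<circ> \<sigma> d) \<circ> (\<sigma> d \<circ> u)"
          using refl_comp_refl[of d u] d T vu by auto
        have "wlen T (\<sigma> d \<circ> u) \<le> 1 + wlen T u"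
          using wlen_comp_le[OF group_refl[OF d] vu(2)] wlen_refl[OF d] by linarith
        then show "wlen S (v \<circ> \<sigma> d) + wlen T (\<sigma> d \<circ> u) \<le> wlen S w"
          using neg vu(4) by linarith
      qed simp
      then have "(LEAST n. fac n) \<le> wlen S (v \<circ> \<sigma> d)" by (rule Least_le)
      then show False using neg vu(5) by simp
    qed
    then have v: "v d \<in> Qpos S" if "d \<in> T" for d
      using less.hyps[of v d] that T vu least q by auto
    \<comment> \<open>A shorter \<open>u \<circ> \<sigma> c\<close> would make
      \<open>w \<circ> \<sigma> c\<close> shorter than \<open>w\<close>.\<close>
    have "wlen T u \<le> wlen T (u \<circ> \<sigma> c)"
    proof (rule ccontr)
      assume neg: "\<not> wlen T u \<le> wlen T (u \<circ> \<sigma> c)"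
      have uc: "u \<circ> \<sigma> c \<in> refl_group D T"
        using group_comp[OF vu(2) group_refl] by (simp add: T_def)
      have "wlen S (w \<circ> \<sigma> c) \<le> wlen S v + wlen S (u \<circ> \<sigma> c)"
        using wlen_comp_le[OF vu(1)] uc group_mono[OF T(1)] by (auto simp: vu(3) comp_assoc)
      also have "\<dots> \<le> wlen S v + wlen T (u \<circ> \<sigma> c)" using wlen_mono[OF T(1) uc] by simp
      finally show False using neg vu(4) less.prems by simp
    qed
    then have "u c \<in> Qpos T" using pos_of_wlen[OF T(2) coh vu(2), of c] by (simp add: T_def)
    then show ?thesis
      using Qpos_image[OF S, of "u c" T v] v group_isometry[OF vu(1) S] vu(3)
      by (simp add: isometry_def)
  qed
qed

text \<open>The positivity criterion is applied to \<open>w\<close> and to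
  \<open>w \<circ> \<sigma> c\<close>, which sends \<open>c\<close> to \<open>- w c\<close>; equal
  lengths would make both signs positive and force \<open>w c\<close> to vanish.\<close>

lemma pos_or_neg:
  assumes "S \<subseteq> \<Delta>" "w \<in> refl_group D S" "c \<in> S"
  shows "w c \<in> Qpos S \<and> wlen S w < wlen S (w \<circ> \<sigma> c) \<or>
    - w c \<in> Qpos S \<and> wlen S (w \<circ> \<sigma> c) < wlen S w"
proof -
  have c: "c \<in> \<Delta>" using assms by auto
  have lin: "linear w" and nz: "w c \<noteq> 0"
    using group_isometry[OF assms(2,1)] isometry_nonzero c by (auto simp: isometry_def)
  have wc: "(w \<circ> \<sigma> c) c = - w c"
    using refl_self[OF simple_nonisotropic[OF c]] linear_neg[OF lin] by simp
  have 1: "wlen S w \<le> wlen S (w \<circ> \<sigma> c) \<Longrightarrow> w c \<in> Qpos S"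
    using pos_of_wlen_le[OF assms(1-3)] .
  have 2: "wlen S (w \<circ> \<sigma> c) \<le> wlen S w \<Longrightarrow> - w c \<in> Qpos S"
    using pos_of_wlen_le[OF assms(1) group_comp[OF assms(2) group_refl] assms(3), of c]
      assms(3) comp_refl_refl[OF c, of w] wc by simp
  have "wlen S w \<noteq> wlen S (w \<circ> \<sigma> c)" using 1 2 Qpos_antisym nz by force
  then show ?thesis using 1 2 by linarith
qed

lemma sign_coherent: "S \<subseteq> \<Delta> \<Longrightarrow> sign_coherent S"
  using pos_or_neg unfolding sign_coherent_def by blast

lemma group_Qlat:
  assumes "S \<subseteq> \<Delta>" "w \<in> refl_group D S" "x \<in> Qlat S" shows "w x \<in> Qlat S"
  using assms Qlat_refl_prod unfolding refl_group_def by blast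

section \<open>Heights and dominance\<close>

lemma height_linear: "linear (height D)"
  and height_simple: "a \<in> \<Delta> \<Longrightarrow> height D a = 1"
  using datum by (auto simp: kac_moody_datum_def)

lemmas height_simps = linear_add[OF height_linear] linear_diff[OF height_linear]
  linear_scale[OF height_linear] linear_neg[OF height_linear] linear_0[OF height_linear]

lemma height_Qlat:
  assumes "S \<subseteq> \<Delta>" "x \<in> Qlat S" shows "height D x = (\<Sum>a\<in>S. crd a x)" "height D x \<in> \<int>"
proof -
  have "height D x = height D (\<Sum>a\<in>S. crd a x *\<^sub>R a)" using assms by (simp add: Qlat_def)
  also have "\<dots> = (\<Sum>a\<in>S. crd a x)"
    using assms(1) by (auto simp: linear_sum[OF height_linear] height_simps height_simple
        intro!: sum.cong)
  finally show "height D x = (\<Sum>a\<in>S. crd a x)" .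
  then show "height D x \<in> \<int>" using assms(2) by (auto simp: Qlat_def)
qed

lemma height_Qpos:
  assumes "S \<subseteq> \<Delta>" "x \<in> Qpos S" shows "height D x \<ge> 0" "x \<noteq> 0 \<Longrightarrow> height D x \<ge> 1"
proof -
  have lat: "x \<in> Qlat S" and c: "\<And>a. a \<in> S \<Longrightarrow> crd a x \<ge> 0"
    using assms by (auto simp: Qpos_def)
  show 0: "height D x \<ge> 0" using height_Qlat(1)[OF assms(1) lat] c by (simp add: sum_nonneg)
  assume "x \<noteq> 0"
  have "height D x \<noteq> 0"
  proof
    assume "height D x = 0"
    then have "\<forall>a\<in>S. crd a x = 0"
      using height_Qlat(1)[OF assms(1) lat] c
        sum_nonneg_eq_0_iff[OF finite_sub[OF assms(1)], of "\<lambda>a. crd a x"] by simp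
    then have "(\<Sum>a\<in>S. crd a x *\<^sub>R a) = 0" by simp
    then show False using lat \<open>x \<noteq> 0\<close> by (simp add: Qlat_def)
  qed
  then show "height D x \<ge> 1"
    using 0 height_Qlat(2)[OF assms(1) lat] by (auto elim!: Ints_cases)
qed

lemma finite_Qpos_height:
  assumes "S \<subseteq> \<Delta>" shows "finite {x \<in> Qpos S. height D x \<le> h}"
proof -
  let ?Z = "(real_of_int ` {0..\<lfloor>h\<rfloor>})"
  have "x \<in> (\<lambda>f. \<Sum>a\<in>S. f a *\<^sub>R a) ` (S \<rightarrow>\<^sub>E ?Z)" if x: "x \<in> Qpos S" "height D x \<le> h" for x
  proof
    have lat: "x \<in> Qlat S" and c: "\<And>a. a \<in> S \<Longrightarrow> crd a x \<ge> 0 \<and> crd a x \<in> \<int>"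
      using x by (auto simp: Qpos_def Qlat_def)
    show "x = (\<Sum>a\<in>S. restrict (\<lambda>a. crd a x) S a *\<^sub>R a)" using lat by (simp add: Qlat_def)
    have "crd a x \<in> ?Z" if a: "a \<in> S" for a
    proof -
      have "crd a x \<le> (\<Sum>a\<in>S. crd a x)"
        using c a finite_sub[OF assms] by (intro member_le_sum) auto
      then have "crd a x \<le> h" using height_Qlat(1)[OF assms lat] x by simp
      moreover obtain k where "crd a x = of_int k" using c[OF a] by (auto elim: Ints_cases)
      ultimately show ?thesis using c[OF a] by (auto simp: le_floor_iff)
    qed
    then show "restrict (\<lambda>a. crd a x) S \<in> S \<rightarrow>\<^sub>E ?Z" by auto
  qed
  then have "{x \<in> Qpos S. height D x \<le> h} \<subseteq> (\<lambda>f. \<Sum>a\<in>S. f a *\<^sub>R a) ` (S \<rightarrow>\<^sub>E ?Z)" by blast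
  then show ?thesis
    using finite_PiE[of S "\<lambda>_. ?Z"] finite_sub[OF assms] finite_subset by blast
qed

text \<open>Removing the last letter \<open>q\<close> of a reduced word for \<open>w\<close> leaves
  \<open>w'\<close> with \<open>w' q\<close> positive, and the difference grows by
  \<open>pairing D \<eta> q\<close> times that root. Induction on the length adds up these terms;
  under strict dominance the last one has positive height.\<close>

lemma dominant_diff:
  assumes S: "S \<subseteq> \<Delta>" and w: "w \<in> refl_group D S"
    and dom: "\<And>c. c \<in> S \<Longrightarrow> pairing D \<eta> c \<in> \<int> \<and> pairing D \<eta> c \<ge> 0"
  shows "\<eta> - w \<eta> \<in> Qpos S" "(\<And>c. c \<in> S \<Longrightarrow> pairing D \<eta> c > 0) \<Longrightarrow> w \<noteq> id \<Longrightarrow> \<eta> - w \<eta> \<noteq> 0"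
proof -
  have step: "\<exists>w'\<in>refl_group D S. \<exists>q\<in>S. wlen S w' < wlen S w \<and> w' q \<in> Qpos S \<and> w' q \<noteq> 0 \<and>
      \<eta> - w \<eta> = (\<eta> - w' \<eta>) + pairing D \<eta> q *\<^sub>R w' q"
    if w: "w \<in> refl_group D S" "w \<noteq> id" for w
  proof -
    obtain q where q: "q \<in> S" "wlen S (w \<circ> \<sigma> q) < wlen S w" using wlen_last[OF w S] .
    let ?w = "w \<circ> \<sigma> q"
    have w': "?w \<in> refl_group D S" using group_comp group_refl q w by blast
    have qs: "q \<in> \<Delta>" using q S by auto
    have weq: "w = ?w \<circ> \<sigma> q" using comp_refl_refl[OF qs, of w] by simp
    have "?w q \<in> Qpos S" using pos_or_neg[OF S w' q(1)] q weq by auto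
    moreover have "w \<eta> = ?w \<eta> - pairing D \<eta> q *\<^sub>R ?w q"
      using group_isometry[OF w' S] fun_cong[OF weq, of \<eta>]
      by (simp only: comp_apply[of "?w" "\<sigma> q"]) (simp add: root_refl_def[of D q \<eta>] isometry_def linear_diff linear_scale del: o_apply)
    moreover have "?w q \<noteq> 0" using isometry_nonzero group_isometry w' S qs by blast
    ultimately show ?thesis using w' q by (intro bexI[of _ ?w] bexI[of _ q]) auto
  qed
  have *: "\<eta> - w \<eta> \<in> Qpos S" if "w \<in> refl_group D S" for w
    using that
  proof (induction "wlen S w" arbitrary: w rule: less_induct)
    case less
    show ?case
    proof (cases "w = id")
      case False
      then obtain w' q where "w' \<in> refl_group D S" "q \<in> S" "wlen S w' < wlen S w" "w' q \<in> Qpos S"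
        "\<eta> - w \<eta> = (\<eta> - w' \<eta>) + pairing D \<eta> q *\<^sub>R w' q"
        using step less.prems by blast
      then show ?thesis using less.hyps dom by (metis Qpos_add Qpos_scale)
    qed (simp add: Qpos_zero)
  qed
  show "\<eta> - w \<eta> \<in> Qpos S" using * w by blast
  assume pos: "\<And>c. c \<in> S \<Longrightarrow> pairing D \<eta> c > 0" and "w \<noteq> id"
  then obtain w' q where w': "w' \<in> refl_group D S" "q \<in> S" "w' q \<in> Qpos S" "w' q \<noteq> 0"
    and eq: "\<eta> - w \<eta> = (\<eta> - w' \<eta>) + pairing D \<eta> q *\<^sub>R w' q"
    using step w by blast
  have "height D (\<eta> - w \<eta>) > 0"
    using height_Qpos(1)[OF S *[OF w'(1)]] height_Qpos(2)[OF S w'(3,4)] pos[OF w'(2)]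
    by (simp add: eq height_simps add_nonneg_pos del: add_diff_eq)
  then show "\<eta> - w \<eta> \<noteq> 0" using height_simps by force
qed

section \<open>Real roots, left ascents and Bruhat covers\<close>

abbreviation weyl :: "('v \<Rightarrow> 'v) set" ("\<W>") where "\<W> \<equiv> refl_group D \<Delta>"

lemma weyl_group_eq_W: "weyl_group D = \<W>"
  by (simp add: weyl_group_def parabolic_def)

lemma weyl_isometry: "w \<in> \<W> \<Longrightarrow> isometry w"
  using group_isometry by blast

lemma weyl_inv_apply: "w \<in> \<W> \<Longrightarrow> inv w (w x) = x" "w \<in> \<W> \<Longrightarrow> w (inv w x) = x"
  using weyl_isometry[of w] by (auto simp: isometry_def bij_is_inj bij_is_surj surj_f_inv_f)

lemma weyl_neg: "w \<in> \<W> \<Longrightarrow> w (- x) = - w x"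
  using weyl_isometry[of w] by (simp add: isometry_def linear_neg)

lemma roots_iff: "x \<in> roots D \<longleftrightarrow> (\<exists>w\<in>\<W>. \<exists>c\<in>\<Delta>. x = w c)"
  unfolding roots_def weyl_group_eq_W by blast

lemma root_image: "w \<in> \<W> \<Longrightarrow> x \<in> roots D \<Longrightarrow> w x \<in> roots D"
  unfolding roots_iff using group_comp by (metis comp_apply)

lemma root_form_pos: "x \<in> roots D \<Longrightarrow> form D x x > 0"
  unfolding roots_iff using weyl_isometry form_simple_pos by (auto simp: isometry_def)

lemma simple_root: "a \<in> \<Delta> \<Longrightarrow> a \<in> roots D"
  unfolding roots_iff using group_id by (metis id_apply)

lemma root_neg: "x \<in> roots D \<Longrightarrow> - x \<in> roots D"
proof -
  assume "x \<in> roots D"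
  then obtain w c where w: "w \<in> \<W>" "c \<in> \<Delta>" "x = w c" unfolding roots_iff by blast
  then have "- x = (w \<circ> \<sigma> c) c" by (simp add: refl_self simple_nonisotropic weyl_neg)
  then show ?thesis unfolding roots_iff using w group_comp group_refl by blast
qed

lemma root_lattice: "x \<in> roots D \<Longrightarrow> x \<in> Qlat \<Delta>"
  unfolding roots_iff using group_Qlat Qlat_simple by blast

lemma root_refl_weyl: "x \<in> roots D \<Longrightarrow> \<sigma> x \<in> \<W>"
proof -
  assume "x \<in> roots D"
  then obtain w c where w: "w \<in> \<W>" "c \<in> \<Delta>" "x = w c" unfolding roots_iff by blast
  have "\<sigma> x = w \<circ> \<sigma> c \<circ> inv w"
    using isometry_refl[OF weyl_isometry[OF w(1)], of c] w(3) weyl_inv_apply[OF w(1)]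
    by (auto simp: fun_eq_iff)
  then show ?thesis using w group_comp group_refl group_inv by (metis subset_refl)
qed

lemma root_pairing_simple: "x \<in> Qlat \<Delta> \<Longrightarrow> y \<in> roots D \<Longrightarrow> pairing D x y \<in> \<int>"
proof -
  assume x: "x \<in> Qlat \<Delta>" and "y \<in> roots D"
  then obtain w c where w: "w \<in> \<W>" "c \<in> \<Delta>" "y = w c" unfolding roots_iff by blast
  have "pairing D x y = pairing D (w (inv w x)) (w c)" using w weyl_inv_apply(2)[OF w(1)] by simp
  also have "\<dots> = pairing D (inv w x) c" by (rule isometry_pairing[OF weyl_isometry[OF w(1)]])
  finally show ?thesis
    using Qlat_pairing[OF group_Qlat[OF _ group_inv[OF w(1)] x]] w(2) by auto
qed

lemma pos_root_iff: "x \<in> pos_roots D \<longleftrightarrow> x \<in> roots D \<and> x \<in> Qpos \<Delta>"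
proof safe
  assume x: "x \<in> pos_roots D"
  then show r: "x \<in> roots D" by (simp add: pos_roots_def)
  obtain c where c: "\<forall>p. c p \<ge> 0" "x = (\<Sum>p\<in>indices D. c p *\<^sub>R simple_root D p)"
    using x by (auto simp: pos_roots_def)
  have "crd a x \<ge> 0" for a
    unfolding c(2) using c(1)
    by (simp add: linear_sum[OF crd_linear] crd_simps) (intro sum_nonneg, auto simp: crd_simple)
  then show "x \<in> Qpos \<Delta>" using root_lattice[OF r] by (simp add: Qpos_def)
next
  assume x: "x \<in> roots D" "x \<in> Qpos \<Delta>"
  have inj: "inj_on (simple_root D) (indices D)" using datum by (simp add: kac_moody_datum_def)
  let ?c = "\<lambda>p. if p \<in> indices D then crd (simple_root D p) x else 0"
  have "x = (\<Sum>a\<in>\<Delta>. crd a x *\<^sub>R a)" using x by (simp add: Qpos_def Qlat_def)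
  also have "\<dots> = (\<Sum>p\<in>indices D. ?c p *\<^sub>R simple_root D p)"
    by (subst sum.reindex[OF inj]) (auto intro!: sum.cong)
  finally show "x \<in> pos_roots D"
    unfolding pos_roots_def using x by (auto simp: Qpos_def intro!: exI[of _ ?c])
qed

lemma root_cases:
  assumes "x \<in> roots D"
  shows "x \<in> pos_roots D \<and> - x \<notin> pos_roots D \<or> - x \<in> pos_roots D \<and> x \<notin> pos_roots D"
proof -
  obtain w c where w: "w \<in> \<W>" "c \<in> \<Delta>" "x = w c" using assms unfolding roots_iff by blast
  then have "x \<in> Qpos \<Delta> \<or> - x \<in> Qpos \<Delta>" using pos_or_neg by blast
  moreover have "x \<noteq> 0" using root_form_pos[OF assms] by (auto simp: form_bilinear)
  ultimately show ?thesis
    using Qpos_antisym[of x \<Delta>] assms root_neg[OF assms] unfolding pos_root_iff by blast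
qed

lemma simple_pos_root: "a \<in> \<Delta> \<Longrightarrow> a \<in> pos_roots D"
  by (simp add: pos_root_iff simple_root Qpos_simple)

lemma pos_root_root: "x \<in> pos_roots D \<Longrightarrow> x \<in> roots D"
  by (simp add: pos_root_iff)

lemma neg_root_iff: "x \<in> roots D \<Longrightarrow> - x \<in> pos_roots D \<longleftrightarrow> x \<notin> pos_roots D"
  using root_cases by blast

text \<open>Writing \<open>x = w c\<close> gives \<open>c = t *\<^sub>R inv w a\<close>. Thus
  \<open>t\<close> and the coordinate of \<open>inv w a\<close> at \<open>c\<close> are integers
  with product 1, and \<open>t\<close> is nonnegative.\<close>

lemma root_simple_multiple:
  assumes "x \<in> pos_roots D" "a \<in> \<Delta>" "x = t *\<^sub>R a" shows "x = a"
proof -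
  have r: "x \<in> roots D" and nn: "x \<in> Qpos \<Delta>" using assms(1) by (auto simp: pos_root_iff)
  obtain w c where w: "w \<in> \<W>" "c \<in> \<Delta>" "x = w c" using r unfolding roots_iff by blast
  have t: "t = crd a x" using assms by (simp add: crd_simps crd_simple)
  then have "t \<in> \<int>" "t \<ge> 0" using nn assms(2) by (auto simp: Qpos_def Qlat_def)
  have "t \<noteq> 0" using assms(3) root_form_pos[OF r] by (auto simp: form_bilinear)
  have lin: "linear (inv w)" using isometry_inv[OF weyl_isometry[OF w(1)]] by (simp add: isometry_def)
  have "c = t *\<^sub>R inv w a"
    using weyl_inv_apply(1)[OF w(1), of c] w(3) assms(3) linear_scale[OF lin] by metis
  then have "1 = t * crd c (inv w a)" using crd_simple[OF w(2), of c] by (metis crd_simps(3) real_scaleR_def)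
  moreover have "crd c (inv w a) \<in> \<int>"
    using group_Qlat[OF _ group_inv[OF w(1)] Qlat_simple[OF _ assms(2)]] w(2)
    unfolding Qlat_def by blast
  ultimately obtain i j where ij: "t = of_int i" "1 = real_of_int i * of_int j"
    using \<open>t \<in> \<int>\<close> by (metis Ints_cases)
  then have "i * j = 1" "i \<ge> 0" using \<open>t \<ge> 0\<close> by (simp_all flip: of_int_mult)
  then have "t = 1" using ij(1) by (auto simp: zmult_eq_1_iff)
  then show ?thesis using assms(3) by simp
qed

lemma len_refl_less:
  assumes "w \<in> \<W>" "x \<in> pos_roots D" "w x \<notin> pos_roots D"
  shows "len D (w \<circ> \<sigma> x) < len D w"
proof -
  have x: "x \<in> Qpos \<Delta>" "x \<in> roots D" using assms(2) by (auto simp: pos_root_iff)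
  obtain u c where u: "u \<in> \<W>" "c \<in> \<Delta>" "x = u c" using x unfolding roots_iff by blast
  have "- w x \<in> Qpos \<Delta>"
    using neg_root_iff[OF root_image[OF assms(1) x(2)]] assms(3) by (simp add: pos_root_iff)
  then show ?thesis
    using exchange_wlen[OF subset_refl sign_coherent[OF subset_refl] u(3,1,2) x(1) assms(1)]
    by (simp add: len_eq_wlen)
qed

lemma weyl_comp: "u \<in> \<W> \<Longrightarrow> w \<in> \<W> \<Longrightarrow> u \<circ> w \<in> \<W>"
  by (rule group_comp)

lemma weyl_inv: "w \<in> \<W> \<Longrightarrow> inv w \<in> \<W>"
  using group_inv by blast

lemma len_inv: "w \<in> \<W> \<Longrightarrow> len D (inv w) = len D w"
  using wlen_inv len_eq_wlen by simp

text \<open>For \<open>w\<close> in the Weyl group and simple \<open>a\<close> this is a left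
  ascent: left multiplication by \<open>\<sigma> a\<close> lengthens \<open>w\<close>, see
  \<open>len_left_refl\<close>.\<close>

definition ascends :: "'v \<Rightarrow> ('v \<Rightarrow> 'v) \<Rightarrow> bool" where
  "ascends a w \<longleftrightarrow> inv w a \<in> pos_roots D"

lemma inv_comp_refl:
  assumes "w \<in> \<W>" "a \<in> \<Delta>" shows "inv (\<sigma> a \<circ> w) = inv w \<circ> \<sigma> a"
proof -
  have "bij (\<sigma> a)" "bij w"
    using refl_isometry[OF simple_nonisotropic[OF assms(2)]] weyl_isometry[OF assms(1)]
    by (auto simp: isometry_def)
  moreover have "inv (\<sigma> a) = \<sigma> a"
    by (rule inv_unique_comp) (rule refl_invol_comp[OF simple_nonisotropic[OF assms(2)]])+
  ultimately show ?thesis by (simp add: o_inv_distrib del: o_apply)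
qed

lemma len_left_refl:
  assumes "w \<in> \<W>" "a \<in> \<Delta>"
  shows "ascends a w \<Longrightarrow> len D (\<sigma> a \<circ> w) = len D w + 1"
    "\<not> ascends a w \<Longrightarrow> len D w = len D (\<sigma> a \<circ> w) + 1"
proof -
  have W: "\<sigma> a \<circ> w \<in> \<W>" using weyl_comp group_refl assms by blast
  have eq: "len D (\<sigma> a \<circ> w) = wlen \<Delta> (inv w \<circ> \<sigma> a)"
    using len_inv[OF W] assms by (simp add: inv_comp_refl len_eq_wlen)
  have eq': "len D w = wlen \<Delta> (inv w)" using len_inv[OF assms(1)] len_eq_wlen by simp
  have asc: "ascends a w \<longleftrightarrow> inv w a \<in> Qpos \<Delta>"
    using root_image[OF weyl_inv[OF assms(1)] simple_root[OF assms(2)]]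
    by (simp add: ascends_def pos_root_iff)
  have nz: "inv w a \<noteq> 0" using isometry_nonzero[OF weyl_isometry[OF weyl_inv]] assms by blast
  note * = pos_or_neg[OF subset_refl weyl_inv[OF assms(1)] assms(2)]
    wlen_comp_refl[OF weyl_inv[OF assms(1)] assms(2) subset_refl]
  show "ascends a w \<Longrightarrow> len D (\<sigma> a \<circ> w) = len D w + 1"
    using * Qpos_antisym[of "inv w a" \<Delta>] nz unfolding eq eq' asc by auto
  show "\<not> ascends a w \<Longrightarrow> len D w = len D (\<sigma> a \<circ> w) + 1"
    using * unfolding eq eq' asc by auto
qed

lemma ascends_refl:
  assumes "w \<in> \<W>" "a \<in> \<Delta>" shows "ascends a (\<sigma> a \<circ> w) \<longleftrightarrow> \<not> ascends a w"
proof -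
  have "inv (\<sigma> a \<circ> w) a = - inv w a"
    using inv_comp_refl[OF assms] refl_self[OF simple_nonisotropic[OF assms(2)]]
      weyl_neg[OF weyl_inv[OF assms(1)]] by simp
  then show ?thesis
    using neg_root_iff[OF root_image[OF weyl_inv[OF assms(1)] simple_root[OF assms(2)]]]
    by (simp add: ascends_def)
qed

lemma ascends_id: "a \<in> \<Delta> \<Longrightarrow> ascends a id"
  by (simp add: ascends_def simple_pos_root)

lemma ascends_root:
  assumes "w \<in> \<W>" "x \<in> pos_roots D"
  shows "w x = a \<Longrightarrow> ascends a w" "w x = - a \<Longrightarrow> \<not> ascends a w"
proof -
  show "w x = a \<Longrightarrow> ascends a w" using weyl_inv_apply(1)[OF assms(1), of x] assms by (simp add: ascends_def)
  assume "w x = - a"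
  then have "inv w a = - x"
    using weyl_inv_apply(1)[OF assms(1), of "- x"] weyl_neg[OF assms(1), of x] by simp
  then show "\<not> ascends a w" using neg_root_iff[OF pos_root_root[OF assms(2)]] assms(2)
    by (simp add: ascends_def)
qed

lemma refl_eq_imp_multiple:
  assumes "a \<in> \<Delta>" "x \<in> pos_roots D" "\<sigma> x = \<sigma> a" shows "x = a"
proof -
  have "- a = a - pairing D a x *\<^sub>R x"
    using refl_self[OF simple_nonisotropic[OF assms(1)]] assms(3) by (metis root_refl_def)
  then have eq: "pairing D a x *\<^sub>R x = 2 *\<^sub>R a" by (simp add: scaleR_2 algebra_simps)
  have "a \<noteq> 0" using simple_nonisotropic[OF assms(1)] by (auto simp: form_bilinear)
  then have "pairing D a x \<noteq> 0" using eq by auto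
  then have "x = (2 / pairing D a x) *\<^sub>R a"
    using arg_cong[OF eq, of "\<lambda>y. (1 / pairing D a x) *\<^sub>R y"] by simp
  then show ?thesis using root_simple_multiple assms by blast
qed

text \<open>Since \<open>a\<close> is a left descent of \<open>u \<circ> \<sigma> x\<close>, some
  reduced word for that product starts with \<open>a\<close>, and exchange recovers \<open>u\<close>
  by deleting one letter. If it is the leading \<open>a\<close>, then the reflections in
  \<open>u x\<close> and in \<open>a\<close> agree. Any other letter would leave a word for
  \<open>u\<close> that starts with \<open>a\<close> and is too short for \<open>a\<close> to be an
  ascent of \<open>u\<close>.\<close>

lemma lifting:
  assumes u: "u \<in> \<W>" and x: "x \<in> pos_roots D" and a: "a \<in> \<Delta>"
    and len: "len D (u \<circ> \<sigma> x) = len D u + 1" and asc: "ascends a u"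
    and desc: "\<not> ascends a (u \<circ> \<sigma> x)"
  shows "u x = a"
proof -
  let ?w = "u \<circ> \<sigma> x"
  have xr: "x \<in> roots D" and xp: "x \<in> Qpos \<Delta>" using x by (auto simp: pos_root_iff)
  have W: "?w \<in> \<W>" using weyl_comp u root_refl_weyl xr by blast
  have sx: "\<sigma> x \<circ> \<sigma> x = id" "\<sigma> x x = - x"
    using root_form_pos[OF xr] by (auto intro!: refl_invol_comp refl_self)
  have ux: "u x \<in> pos_roots D" using len_refl_less[OF u x] len by force
  have "- ?w x = u x" using sx(2) weyl_neg[OF u] by simp
  then have neg: "- ?w x \<in> Qpos \<Delta>" using ux by (simp add: pos_root_iff)
  have wsx: "?w \<circ> \<sigma> x = u" using sx(1) by (simp add: comp_assoc)
  have aW: "\<sigma> a \<circ> ?w \<in> \<W>" using weyl_comp group_refl a W by blast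
  obtain ts where ts: "set ts \<subseteq> \<Delta>" "length ts = len D (\<sigma> a \<circ> ?w)" "\<sigma> a \<circ> ?w = refl_prod D ts"
    using reduced_word[OF aW] unfolding len_eq_wlen .
  have w: "?w = refl_prod D (a # ts)"
    using ts(3) refl_comp_refl[OF a, of ?w] by (simp add: refl_prod_simps)
  have lts: "length ts = len D u" using ts(2) len_left_refl(2)[OF W a desc] len by simp
  obtain v c where v: "v \<in> \<W>" "c \<in> \<Delta>" "x = v c" using xr unfolding roots_iff by blast
  obtain k where k: "k < length (a # ts)"
    "refl_prod D (a # ts) \<circ> \<sigma> x = refl_prod D (take k (a # ts) @ drop (Suc k) (a # ts))"
    using exchange[OF subset_refl sign_coherent[OF subset_refl] v(3,1,2) xp, of "a # ts"]
      neg ts(1) a w by auto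
  have uk: "u = refl_prod D (take k (a # ts) @ drop (Suc k) (a # ts))" using k(2) wsx w by simp
  show ?thesis
  proof (cases k)
    case 0
    then have "u = \<sigma> a \<circ> ?w" using uk ts(3) by simp
    then have "\<sigma> a \<circ> u = ?w" using refl_comp_refl[OF a] by metis
    also have "\<dots> = \<sigma> (u x) \<circ> u" using isometry_refl[OF weyl_isometry[OF u]] by simp
    finally have "\<sigma> a = \<sigma> (u x)"
      using weyl_isometry[OF u] by (metis bij_is_surj isometry_def surj_fun_eq)
    then show ?thesis using refl_eq_imp_multiple[OF a ux] by simp
  next
    case (Suc m)
    then have "u = \<sigma> a \<circ> refl_prod D (take m ts @ drop (Suc m) ts)"
      using uk by (simp add: refl_prod_simps)
    then have "\<sigma> a \<circ> u = refl_prod D (take m ts @ drop (Suc m) ts)"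
      using refl_comp_refl[OF a] by metis
    moreover have "set (take m ts @ drop (Suc m) ts) \<subseteq> \<Delta>"
      using ts(1) set_take_subset[of m ts] set_drop_subset[of "Suc m" ts] by auto
    ultimately have "len D (\<sigma> a \<circ> u) \<le> length (take m ts @ drop (Suc m) ts)"
      using wlen_le len_eq_wlen by metis
    then have "len D (\<sigma> a \<circ> u) < len D u + 1" using k Suc lts by simp
    then show ?thesis using len_left_refl(1)[OF u a asc] by simp
  qed
qed

definition wsgn :: "('v \<Rightarrow> 'v) \<Rightarrow> int" where
  "wsgn w = (-1) ^ len D w"

lemma wsgn_comp_refl:
  assumes "w \<in> \<W>" "c \<in> \<Delta>" shows "wsgn (w \<circ> \<sigma> c) = - wsgn w"
proof -
  have "wlen \<Delta> w \<noteq> wlen \<Delta> (w \<circ> \<sigma> c)" using pos_or_neg[OF subset_refl assms] by auto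
  then have "len D (w \<circ> \<sigma> c) = len D w + 1 \<or> len D w = len D (w \<circ> \<sigma> c) + 1"
    using wlen_comp_refl[OF assms subset_refl] unfolding len_eq_wlen by linarith
  then show ?thesis unfolding wsgn_def by (elim disjE) simp_all
qed

end

section \<open>Folded galleries and wall crossings\<close>

lemma sorted_list_of_set_Un_less:
  assumes "finite A" "finite B" "\<And>a b. a \<in> A \<Longrightarrow> b \<in> B \<Longrightarrow> a < (b::'i::linorder)"
  shows "sorted_list_of_set (A \<union> B) = sorted_list_of_set A @ sorted_list_of_set B"
proof (rule sorted_distinct_set_unique)
  show "sorted (sorted_list_of_set A @ sorted_list_of_set B)"
    using assms by (auto simp: sorted_append less_imp_le)
  show "distinct (sorted_list_of_set A @ sorted_list_of_set B)"
    using assms by fastforce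
qed (use assms in auto)

text \<open>One construction serves the linear and the affine product, so that cutting and toggling
  are treated once.\<close>

definition ordprod :: "('i::linorder \<Rightarrow> 'v \<Rightarrow> 'v) \<Rightarrow> 'i set \<Rightarrow> 'v \<Rightarrow> 'v" where
  "ordprod f J = foldr (\<lambda>j g. f j \<circ> g) (sorted_list_of_set J) id"

lemma ordprod_empty [simp]: "ordprod f {} = id"
  by (simp add: ordprod_def)

lemma ordprod_single [simp]: "ordprod f {j} = f j"
  by (simp add: ordprod_def)

lemma foldr_comp_acc: "foldr (\<lambda>j g. f j \<circ> g) xs h = foldr (\<lambda>j g. f j \<circ> g) xs id \<circ> h"
proof
  show "foldr (\<lambda>j g. f j \<circ> g) xs h v = (foldr (\<lambda>j g. f j \<circ> g) xs id \<circ> h) v" for v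
    by (induction xs) simp_all
qed

lemma ordprod_Un:
  assumes "finite A" "finite B" "\<And>a b. a \<in> A \<Longrightarrow> b \<in> B \<Longrightarrow> a < b"
  shows "ordprod f (A \<union> B) = ordprod f A \<circ> ordprod f B"
proof -
  have "ordprod f (A \<union> B) =
      foldr (\<lambda>j g. f j \<circ> g) (sorted_list_of_set A) (foldr (\<lambda>j g. f j \<circ> g) (sorted_list_of_set B) id)"
    by (simp only: ordprod_def sorted_list_of_set_Un_less[OF assms] foldr_append)
  then show ?thesis unfolding ordprod_def by (subst (asm) foldr_comp_acc)
qed

lemma ordprod_insert_max:
  assumes "finite J" "\<forall>i\<in>J. i < j" shows "ordprod f (insert j J) = ordprod f J \<circ> f j"
  using ordprod_Un[OF assms(1), of "{j}" f] assms by simp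

text \<open>Cuts instead of indices: \<open>{..<i}\<close>, \<open>{..i}\<close> and
  \<open>UNIV\<close> are the positions before \<open>i\<close>, after \<open>i\<close> and at the
  end.\<close>

definition down :: "'i::linorder set \<Rightarrow> bool" where
  "down L \<longleftrightarrow> (\<forall>x\<in>L. \<forall>y. y \<le> x \<longrightarrow> y \<in> L)"

lemma down_simps [simp]: "down {..<i}" "down {..i}" "down UNIV" "down {}"
  by (auto simp: down_def)

lemma ordprod_split:
  assumes "finite J" "down L" "k \<in> L"
  shows "ordprod f (J \<inter> L) =
    ordprod f (J \<inter> {..<k}) \<circ> (if k \<in> J then f k else id) \<circ> ordprod f (J \<inter> L \<inter> {k<..})"
proof -
  have "J \<inter> L = (J \<inter> {..<k} \<union> J \<inter> {k}) \<union> (J \<inter> L \<inter> {k<..})"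
    using assms(2,3) unfolding down_def by (auto simp: not_less intro: less_imp_le)
  also have "ordprod f \<dots> = ordprod f (J \<inter> {..<k} \<union> J \<inter> {k}) \<circ> ordprod f (J \<inter> L \<inter> {k<..})"
    by (rule ordprod_Un) (use assms in auto)
  also have "ordprod f (J \<inter> {..<k} \<union> J \<inter> {k}) = ordprod f (J \<inter> {..<k}) \<circ> ordprod f (J \<inter> {k})"
    by (rule ordprod_Un) (use assms in auto)
  also have "ordprod f (J \<inter> {k}) = (if k \<in> J then f k else id)" by simp
  finally show ?thesis .
qed

definition toggle :: "'i \<Rightarrow> 'i set \<Rightarrow> 'i set" where
  "toggle k J = (if k \<in> J then J - {k} else insert k J)"

lemma toggle_toggle [simp]: "toggle k (toggle k J) = J"
  by (auto simp: toggle_def)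

lemma toggle_commute: "toggle k (toggle m J) = toggle m (toggle k J)"
  by (auto simp: toggle_def)

lemma mem_toggle: "i \<in> toggle k J \<longleftrightarrow> (if i = k then k \<notin> J else i \<in> J)"
  by (auto simp: toggle_def)

lemma finite_toggle [simp]: "finite (toggle k J) \<longleftrightarrow> finite J"
  by (auto simp: toggle_def)

lemma toggle_Int: "k \<notin> L \<Longrightarrow> toggle k J \<inter> L = J \<inter> L"
  by (auto simp: toggle_def)

text \<open>Inserting or deleting the factor at \<open>k\<close> amounts to left multiplication by
  \<open>z\<close>, its conjugate under the earlier factors. As \<open>z\<close> is an involution,
  both directions obey the same formula.\<close>

lemma ordprod_toggle:
  assumes "finite J" "down L" "k \<in> L"
    and conj: "ordprod f (J \<inter> {..<k}) \<circ> f k = z \<circ> ordprod f (J \<inter> {..<k})"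
    and z: "z \<circ> z = id"
  shows "ordprod f (toggle k J \<inter> L) = z \<circ> ordprod f (J \<inter> L)"
proof -
  let ?A = "ordprod f (J \<inter> {..<k})" and ?C = "ordprod f (J \<inter> L \<inter> {k<..})"
  have eqs: "toggle k J \<inter> {..<k} = J \<inter> {..<k}"
    "toggle k J \<inter> L \<inter> {k<..} = J \<inter> L \<inter> {k<..}"
    by (auto simp: toggle_def)
  have 1: "ordprod f (toggle k J \<inter> L) = ?A \<circ> (if k \<in> J then id else f k) \<circ> ?C"
    using ordprod_split[of "toggle k J" L k f] assms(1-3) unfolding eqs by (simp add: mem_toggle)
  have 2: "ordprod f (J \<inter> L) = ?A \<circ> (if k \<in> J then f k else id) \<circ> ?C"
    using ordprod_split[OF assms(1-3)] .
  show ?thesis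
  proof (cases "k \<in> J")
    case True
    have "z \<circ> (?A \<circ> f k \<circ> ?C) = (z \<circ> z) \<circ> ?A \<circ> ?C" by (simp only: conj comp_assoc)
    then show ?thesis using True 1 2 z by simp
  next
    case False
    then show ?thesis using 1 2 conj by (simp add: comp_assoc[symmetric] del: o_apply)
  qed
qed

section \<open>Roots and signed crossings along a gallery\<close>

locale lam_chain = kac_moody D for D :: "'v::real_vector root_datum" +
  fixes lam :: 'v and I :: "'i::linorder set" and \<beta> :: "'i \<Rightarrow> 'v"
  assumes dominant: "lam \<in> dominant_weights D"
    and chain: "lambda_chain D lam I \<beta>"
begin

definition prod_at :: "'i set \<Rightarrow> 'v \<Rightarrow> 'v" where
  "prod_at = ordprod (\<lambda>i. \<sigma> (\<beta> i))"

definition affine_prod :: "'i set \<Rightarrow> 'v \<Rightarrow> 'v" where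
  "affine_prod = ordprod (\<lambda>i. affine_refl D (\<beta> i) (level0 I \<beta> i))"

text \<open>The root at index \<open>i\<close> of the folding of \<open>J\<close> in closed form;
  \<open>folding\<close> proves that it agrees with the iterated \<open>fold_op\<close>.\<close>

definition root_at :: "'i set \<Rightarrow> 'i \<Rightarrow> 'v" where
  "root_at J i = prod_at (J \<inter> {..<i}) (\<beta> i)"

lemma refl_prod_sorted: "refl_prod D (map \<beta> (sorted_list_of_set J)) = prod_at J"
  by (simp add: refl_prod_def prod_at_def ordprod_def foldr_map comp_def)

lemma weight_eq: "weight D lam I \<beta> J = affine_prod J lam"
proof -
  have "foldr f xs v = foldr (\<lambda>j g. f j \<circ> g) xs id v" for f :: "'i \<Rightarrow> 'v \<Rightarrow> 'v" and xs v
    by (induction xs) auto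
  then show ?thesis unfolding weight_def affine_prod_def ordprod_def by blast
qed

lemma chain_pos: "i \<in> I \<Longrightarrow> \<beta> i \<in> pos_roots D"
  using chain by (auto simp: lambda_chain_def)

lemma chain_root: "i \<in> I \<Longrightarrow> \<beta> i \<in> roots D"
  using chain_pos pos_root_root by blast

lemma chain_finite: "finite {i \<in> I. \<beta> i = x}"
proof (cases "x \<in> pos_roots D")
  case False
  then have "{i \<in> I. \<beta> i = x} = {}" using chain_pos by auto
  then show ?thesis by (simp only: finite.emptyI)
qed (use chain in \<open>auto simp: lambda_chain_def\<close>)

lemma chain_card: "x \<in> pos_roots D \<Longrightarrow> real (card {i \<in> I. \<beta> i = x}) = pairing D lam x"
  using chain by (auto simp: lambda_chain_def)

lemma prod_at_weyl:
  assumes "finite J" "J \<subseteq> I" shows "prod_at J \<in> \<W>"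
  using assms unfolding prod_at_def
proof (induction J rule: finite_linorder_max_induct)
  case (insert j J)
  then show ?case
    using weyl_comp root_refl_weyl[OF chain_root, of j] by (simp add: ordprod_insert_max del: o_apply)
qed (simp add: group_id)

lemma affine_prod_alt:
  assumes "finite J" "J \<subseteq> I" shows "affine_prod J v = prod_at J v + affine_prod J 0"
proof -
  have "\<forall>v. affine_prod J v = prod_at J v + affine_prod J 0"
    using assms
  proof (induction J rule: finite_linorder_max_induct)
    case (insert j J)
    have lin: "linear (prod_at J)"
      using prod_at_weyl weyl_isometry insert by (auto simp: isometry_def)
    have IH: "affine_prod J v = prod_at J v + affine_prod J 0" for v using insert by blast
    have "affine_prod (insert j J) v = affine_prod J (affine_refl D (\<beta> j) (level0 I \<beta> j) v)" for v
      using insert.hyps unfolding affine_prod_def by (simp add: ordprod_insert_max)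
    then have A: "affine_prod (insert j J) v =
        prod_at J (affine_refl D (\<beta> j) (level0 I \<beta> j) v) + affine_prod J 0" for v
      using IH by metis
    have P: "prod_at (insert j J) v = prod_at J (\<sigma> (\<beta> j) v)" for v
      using insert.hyps unfolding prod_at_def by (simp add: ordprod_insert_max)
    show ?case
      unfolding A P by (simp add: affine_refl_def linear_add[OF lin] linear_0[OF refl_linear])
  qed (simp add: affine_prod_def prod_at_def)
  then show ?thesis by blast
qed

text \<open>
  A position in the gallery is given by the down-closed set \<open>L\<close> of the indices preceding it;
  \<open>crossings {..<i} x\<close> is the number \<open>N\<^sub>i(x)\<close> of the paper.
\<close>

definition hits :: "'i set \<Rightarrow> 'v \<Rightarrow> int" where
  "hits L x = int (card {i \<in> I. i \<in> L \<and> \<beta> i = x})"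

definition crossings :: "'i set \<Rightarrow> 'v \<Rightarrow> int" where
  "crossings L x = (if x \<in> pos_roots D then hits L x else 1 - hits L (- x))"

lemma chain_count_eq: "chain_count D I \<beta> i x = crossings {..<i} x"
  by (simp add: chain_count_def crossings_def hits_def)

lemma level0_eq: "i \<in> I \<Longrightarrow> level0 I \<beta> i = crossings {..<i} (\<beta> i)"
  using chain_pos by (simp add: level0_def crossings_def hits_def)

text \<open>The only consequence of condition (2) on chains that is needed.\<close>

lemma crossings_refl:
  assumes j: "j \<in> I" and x: "x \<in> roots D"
  shows "real_of_int (crossings {..<j} (\<sigma> (\<beta> j) x)) = real_of_int (crossings {..<j} x)
    + (if x = \<beta> j then 1 else 0) - (if x = - \<beta> j then 1 else 0)
    - real_of_int (crossings {..<j} (\<beta> j)) * pairing D (\<beta> j) x"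
proof -
  have bpos: "\<beta> j \<in> pos_roots D" and b: "\<beta> j \<in> roots D" using chain_pos chain_root j by auto
  have nz: "form D (\<beta> j) (\<beta> j) \<noteq> 0" "form D x x \<noteq> 0" using root_form_pos b x by force+
  have nb: "- \<beta> j \<notin> pos_roots D" "\<beta> j \<noteq> - \<beta> j"
    using root_cases[OF b] bpos by auto
  have self: "pairing D (\<beta> j) (\<beta> j) = 2" "pairing D (\<beta> j) (- \<beta> j) = - 2"
    using pairing_self[OF nz(1)] by (auto simp: pairing_minus_right)
  \<comment> \<open>The chain condition excludes \<open>x = \<beta> j\<close> and
    \<open>x = - \<beta> j\<close>. There the convention that the counts of opposite roots add up to
    1 produces the two correction terms.\<close>
  consider "x = \<beta> j" | "x = - \<beta> j" | "x \<noteq> \<beta> j" "x \<noteq> - \<beta> j" by blast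
  then show ?thesis
  proof cases
    case 1
    then show ?thesis using nb bpos self by (simp add: refl_self[OF nz(1)] crossings_def)
  next
    case 2
    have "\<sigma> (\<beta> j) (- \<beta> j) = \<beta> j"
      using refl_self[OF nz(1)] linear_neg[OF refl_linear] by simp
    then show ?thesis using 2 nb bpos self by (simp add: crossings_def)
  next
    case 3
    obtain k where k: "- pairing D (\<beta> j) x = real_of_int k"
      using root_pairing_simple[OF root_lattice[OF b] x] by (metis Ints_cases Ints_minus)
    have y: "\<sigma> (\<beta> j) x \<in> roots D" using root_image[OF root_refl_weyl[OF b] x] .
    have "form D (\<sigma> (\<beta> j) x) (\<sigma> (\<beta> j) x) = form D x x"
      using refl_isometry[OF nz(1)] by (simp add: isometry_def)
    \<comment> \<open>The coroot of the reflected root is brought into the shape in which the chain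
      condition applies.\<close>
    then have "coroot D (\<sigma> (\<beta> j) x) = (2 / form D x x) *\<^sub>R x -
        (2 / form D x x * pairing D x (\<beta> j)) *\<^sub>R \<beta> j"
      by (simp add: coroot_def root_refl_def scaleR_diff_right)
    also have "2 / form D x x * pairing D x (\<beta> j) = pairing D (\<beta> j) x * (2 / form D (\<beta> j) (\<beta> j))"
      using form_sym[of x "\<beta> j"] by (simp add: pairing_alt)
    also have "(2 / form D x x) *\<^sub>R x - (pairing D (\<beta> j) x * (2 / form D (\<beta> j) (\<beta> j))) *\<^sub>R \<beta> j
        = coroot D x + of_int k *\<^sub>R coroot D (\<beta> j)"
      by (simp add: coroot_def k[symmetric])
    finally have "coroot D (\<sigma> (\<beta> j) x) = coroot D x + of_int k *\<^sub>R coroot D (\<beta> j)" .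
    then have "chain_count D I \<beta> j (\<sigma> (\<beta> j) x) =
        chain_count D I \<beta> j x + k * chain_count D I \<beta> j (\<beta> j)"
      using chain j x b y 3 unfolding lambda_chain_def by blast
    moreover have "pairing D (\<beta> j) x = - real_of_int k" using k by simp
    ultimately show ?thesis using 3 by (simp add: chain_count_eq)
  qed
qed

text \<open>The sum in the definition of the levels, taken up to an arbitrary cut, with
  \<open>j \<notin> J\<close> in place of the sign being 1.\<close>

definition signed_crossings :: "'i set \<Rightarrow> 'i set \<Rightarrow> 'v \<Rightarrow> int" where
  "signed_crossings J L x = (\<Sum>j | j \<in> I \<and> j \<in> L \<and> j \<notin> J \<and> (root_at J j = x \<or> root_at J j = - x).
     root_sgn D (root_at J j))"

text \<open>\<open>I\<close> may be infinite, but the product before \<open>j\<close> is one of the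
  finitely many \<open>prod_at K\<close> with \<open>K \<subseteq> J\<close>. This pins
  \<open>\<beta> j\<close> to finitely many vectors, each of which occurs finitely often in the
  chain.\<close>

lemma finite_root_at:
  assumes "finite J" "J \<subseteq> I"
  shows "finite {j \<in> I. root_at J j = x \<or> root_at J j = - x}"
proof -
  let ?X = "\<Union>K\<in>Pow J. {j \<in> I. \<beta> j = inv (prod_at K) x} \<union> {j \<in> I. \<beta> j = inv (prod_at K) (- x)}"
  have "{j \<in> I. root_at J j = x \<or> root_at J j = - x} \<subseteq> ?X"
  proof
    fix j assume j: "j \<in> {j \<in> I. root_at J j = x \<or> root_at J j = - x}"
    have "prod_at (J \<inter> {..<j}) \<in> \<W>" using assms by (intro prod_at_weyl) auto
    then have "\<beta> j = inv (prod_at (J \<inter> {..<j})) (root_at J j)"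
      unfolding root_at_def by (simp add: weyl_inv_apply)
    then show "j \<in> ?X" using j by (intro UN_I[of "J \<inter> {..<j}"]) auto
  qed
  moreover have "finite ?X" using assms chain_finite by auto
  ultimately show ?thesis by (rule finite_subset)
qed

lemma root_at_restrict: "down L \<Longrightarrow> i \<in> L \<Longrightarrow> root_at (J \<inter> L) i = root_at J i"
proof -
  assume "down L" "i \<in> L"
  then have "J \<inter> L \<inter> {..<i} = J \<inter> {..<i}" by (auto simp: down_def)
  then show ?thesis by (simp add: root_at_def)
qed

lemma signed_crossings_restrict: "down L \<Longrightarrow> signed_crossings (J \<inter> L) L x = signed_crossings J L x"
  unfolding signed_crossings_def by (rule sum.cong) (auto simp: root_at_restrict)

text \<open>The roots \<open>\<beta> i\<close> are positive, so only the positive one of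
  \<open>x\<close> and \<open>- x\<close> can occur among them, and all its occurrences contribute
  the same sign.\<close>

lemma signed_run:
  assumes u: "u \<in> \<W>" and x: "x \<in> roots D" "u x \<in> pos_roots D"
  shows "(\<Sum>i | i \<in> I \<and> i \<in> R \<and> (u (\<beta> i) = u x \<or> u (\<beta> i) = - u x). root_sgn D (u (\<beta> i))) =
    (if x \<in> pos_roots D then hits R x else - hits R (- x))"
proof -
  have inj: "u y = u z \<longleftrightarrow> y = z" for y z using weyl_inv_apply(1)[OF u] by metis
  have eq: "u y = - u x \<longleftrightarrow> y = - x" for y using inj weyl_neg[OF u] by metis
  have neg: "- u x \<notin> pos_roots D" using root_cases[OF root_image[OF u x(1)]] x by auto
  show ?thesis
  proof (cases "x \<in> pos_roots D")
    case True
    then have "- x \<notin> pos_roots D" using root_cases x by blast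
    then have "\<beta> i \<noteq> - x" if "i \<in> I" for i using chain_pos[OF that] by auto
    then have "{i. i \<in> I \<and> i \<in> R \<and> (u (\<beta> i) = u x \<or> u (\<beta> i) = - u x)} = {i \<in> I. i \<in> R \<and> \<beta> i = x}"
      unfolding inj eq by blast
    then show ?thesis using True x by (simp add: root_sgn_def hits_def)
  next
    case False
    then have "\<beta> i \<noteq> x" if "i \<in> I" for i using chain_pos[OF that] by auto
    then have "{i. i \<in> I \<and> i \<in> R \<and> (u (\<beta> i) = u x \<or> u (\<beta> i) = - u x)} = {i \<in> I. i \<in> R \<and> \<beta> i = - x}"
      unfolding inj eq by blast
    then show ?thesis using False neg by (simp add: root_sgn_def hits_def weyl_neg[OF u])
  qed
qed

lemma hits_split:
  assumes "down L" "j \<in> L" "j \<in> I"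
  shows "hits L x = hits {..<j} x + (if \<beta> j = x then 1 else 0) + hits (L \<inter> {j<..}) x"
proof -
  let ?A = "{i \<in> I. i \<in> {..<j} \<and> \<beta> i = x}" and ?B = "{i \<in> {j}. \<beta> i = x}"
    and ?C = "{i \<in> I. i \<in> L \<inter> {j<..} \<and> \<beta> i = x}"
  have fin: "finite ?A" "finite ?C" using chain_finite[of x] by (auto elim: rev_finite_subset)
  have "{i \<in> I. i \<in> L \<and> \<beta> i = x} = ?A \<union> ?B \<union> ?C"
    using assms unfolding down_def by (auto intro: less_imp_le)
  moreover have "card (?A \<union> ?B \<union> ?C) = card (?A \<union> ?B) + card ?C"
    by (rule card_Un_disjoint) (use fin in auto)
  moreover have "card (?A \<union> ?B) = card ?A + card ?B"
    by (rule card_Un_disjoint) (use fin in auto)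
  moreover have "card ?B = (if \<beta> j = x then 1 else 0)" by (auto simp: card_1_singleton_iff)
  ultimately show ?thesis by (simp add: hits_def)
qed

text \<open>
  Folding a gallery at its \<open>j\<close>-th wall reflects the rest of the gallery in that wall, so the walls
  orthogonal to \<open>x\<close> crossed by the unfolded gallery become walls orthogonal to \<open>prod_at J x\<close>,
  translated by \<open>affine_prod J 0\<close>.
\<close>

lemma signed_crossings_eq:
  assumes "finite J" "J \<subseteq> I \<inter> L" "down L" "x \<in> roots D" "prod_at J x \<in> pos_roots D"
  shows "real_of_int (signed_crossings J L (prod_at J x)) =
    crossings L x + pairing D (affine_prod J 0) (prod_at J x)"
  using assms
proof (induction J arbitrary: L x rule: finite_linorder_max_induct)
  case empty
  have r: "root_at {} i = \<beta> i" for i by (simp add: root_at_def prod_at_def)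
  have "signed_crossings {} L x = hits L x"
    unfolding signed_crossings_def r
    using signed_run[OF group_id empty(3), of L] empty by (simp add: prod_at_def)
  then show ?case
    using empty by (simp add: crossings_def prod_at_def affine_prod_def pairing_simps)
next
  case (insert j J)
  let ?b = "\<beta> j" and ?J = "insert j J" and ?u = "prod_at J" and ?t = "affine_prod J 0"
  have j: "j \<in> I" "j \<in> L" and J: "J \<subseteq> I" "J \<subseteq> I \<inter> {..<j}" using insert.prems insert.hyps by auto
  have b: "?b \<in> roots D" and nz: "form D ?b ?b \<noteq> 0"
    using chain_root[OF j(1)] root_form_pos by force+
  have W: "?u \<in> \<W>" "prod_at ?J \<in> \<W>" using prod_at_weyl insert J j by auto
  note iso = weyl_isometry[OF W(1)]
  have pj: "prod_at ?J = ?u \<circ> \<sigma> ?b"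
    using insert unfolding prod_at_def by (simp add: ordprod_insert_max)
  define y where "y = \<sigma> ?b x"
  have y: "y \<in> roots D" unfolding y_def using root_image[OF root_refl_weyl[OF b]] insert by blast
  have uy: "prod_at ?J x = ?u y" by (simp add: pj y_def)
  define z where "z = ?u y"
  have z: "z \<in> pos_roots D" using insert.prems uy by (simp add: z_def)
  have IH: "real_of_int (signed_crossings J {..<j} z) = crossings {..<j} y + pairing D ?t z"
    using insert.IH[of "{..<j}" y] J y z unfolding z_def by simp
  have "affine_prod ?J 0 = affine_prod J (affine_refl D ?b (level0 I \<beta> j) 0)"
    using insert unfolding affine_prod_def by (simp add: ordprod_insert_max)
  also have "\<dots> = ?u (of_int (crossings {..<j} ?b) *\<^sub>R ?b) + ?t"
    using affine_prod_alt[of J "affine_refl D ?b (level0 I \<beta> j) 0"] insert J level0_eq[OF j(1)]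
    by (simp add: affine_refl_def linear_0[OF refl_linear])
  also have "\<dots> = of_int (crossings {..<j} ?b) *\<^sub>R ?u ?b + ?t"
    using iso by (simp add: isometry_def linear_scale)
  finally have t: "pairing D (affine_prod ?J 0) z =
      crossings {..<j} ?b * pairing D ?b y + pairing D ?t z"
    by (simp add: pairing_simps z_def isometry_pairing[OF iso])
  have "pairing D ?b y = pairing D (\<sigma> ?b (- ?b)) (\<sigma> ?b x)"
    unfolding y_def by (simp add: linear_neg[OF refl_linear] refl_self[OF nz])
  also have "\<dots> = - pairing D ?b x"
    by (simp add: isometry_pairing[OF refl_isometry[OF nz]] pairing_simps)
  finally have refl_y: "pairing D ?b y = - pairing D ?b x" .
  let ?P = "\<lambda>K i. root_at K i = z \<or> root_at K i = - z"
  let ?A = "{i. i \<in> I \<and> i \<in> {..<j} \<and> i \<notin> J \<and> ?P J i}"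
  let ?C = "{i. i \<in> I \<and> i \<in> L \<inter> {j<..} \<and> (prod_at ?J (\<beta> i) = z \<or> prod_at ?J (\<beta> i) = - z)}"
  have ra: "root_at ?J i = root_at J i" if "i < j" for i
  proof -
    have "?J \<inter> {..<i} = J \<inter> {..<i}" using that by auto
    then show ?thesis by (simp add: root_at_def)
  qed
  have rc: "root_at ?J i = prod_at ?J (\<beta> i)" if "i > j" for i
  proof -
    have "?J \<inter> {..<i} = ?J" using that insert.hyps by auto
    then show ?thesis by (simp add: root_at_def)
  qed
  have "i \<in> I \<and> i \<in> L \<and> i \<notin> ?J \<and> ?P ?J i \<longleftrightarrow> i \<in> ?A \<union> ?C" for i
  proof (cases i j rule: linorder_cases)
    case less
    then have "i \<in> L" using insert.prems(2) j unfolding down_def by (meson less_imp_le)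
    then show ?thesis using less ra[OF less] by auto
  next
    case greater
    then show ?thesis using rc[OF greater] insert.hyps(2) by auto
  qed simp
  then have "{i. i \<in> I \<and> i \<in> L \<and> i \<notin> ?J \<and> ?P ?J i} = ?A \<union> ?C" by blast
  then have "signed_crossings ?J L z = (\<Sum>i\<in>?A \<union> ?C. root_sgn D (root_at ?J i))"
    by (simp only: signed_crossings_def)
  also have "\<dots> = (\<Sum>i\<in>?A. root_sgn D (root_at ?J i)) + (\<Sum>i\<in>?C. root_sgn D (root_at ?J i))"
  proof (rule sum.union_disjoint)
    show "finite ?A"
      by (rule finite_subset[OF _ finite_root_at[of J z]]) (use insert.hyps J in auto)
    show "finite ?C"
      by (rule finite_subset[OF _ finite_root_at[of ?J z]]) (use insert.hyps J j rc in auto)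
  qed auto
  also have "(\<Sum>i\<in>?A. root_sgn D (root_at ?J i)) = signed_crossings J {..<j} z"
    unfolding signed_crossings_def by (rule sum.cong) (auto simp: ra)
  also have "(\<Sum>i\<in>?C. root_sgn D (root_at ?J i)) = (\<Sum>i\<in>?C. root_sgn D (prod_at ?J (\<beta> i)))"
    by (rule sum.cong) (auto simp: rc)
  also have "\<dots> = (if x \<in> pos_roots D then hits (L \<inter> {j<..}) x else - hits (L \<inter> {j<..}) (- x))"
    using signed_run[OF W(2) insert.prems(3), of "L \<inter> {j<..}"] z unfolding uy z_def[symmetric] by blast
  finally have S0: "signed_crossings ?J L z = signed_crossings J {..<j} z +
    (if x \<in> pos_roots D then hits (L \<inter> {j<..}) x else - hits (L \<inter> {j<..}) (- x))" .
  have S: "signed_crossings ?J L z = signed_crossings J {..<j} z +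
    (crossings L x - crossings {..<j} x - (if x = ?b then 1 else 0) + (if x = - ?b then 1 else 0))"
  proof -
    have 1: "x = ?b \<Longrightarrow> x \<in> pos_roots D" "x = - ?b \<Longrightarrow> x \<notin> pos_roots D"
      using chain_pos[OF j(1)] root_cases[OF b] by auto
    note split = hits_split[OF insert.prems(2) j(2,1)]
    show ?thesis
    proof (cases "x \<in> pos_roots D")
      case True
      then have "x \<noteq> - ?b" using 1 by blast
      then show ?thesis
        unfolding S0 using split[of x] True by (simp add: crossings_def)
    next
      case False
      then have "x \<noteq> ?b" using 1 by blast
      moreover have "?b = - x \<longleftrightarrow> x = - ?b" by auto
      ultimately show ?thesis
        unfolding S0 using split[of "- x"] False by (simp add: crossings_def)
    qed
  qed
  \<comment> \<open>The folded index \<open>j\<close> is missing from the signed sum; this deficit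
    cancels against the correction terms of \<open>crossings_refl\<close>.\<close>
  define p q :: real where "p = (if x = ?b then 1 else 0)" and "q = (if x = - ?b then 1 else 0)"
  have "real_of_int (signed_crossings ?J L z) =
      real_of_int (signed_crossings J {..<j} z) + (crossings L x - crossings {..<j} x - p + q)"
    unfolding S p_def q_def by (simp only: of_int_add of_int_diff of_int_0 of_int_1 if_distrib[of real_of_int])
  moreover have "real_of_int (crossings {..<j} y) =
      crossings {..<j} x + p - q - crossings {..<j} ?b * pairing D ?b x"
    unfolding y_def p_def q_def by (rule crossings_refl[OF j(1) insert.prems(3)])
  ultimately show ?case
    unfolding uy z_def[symmetric] t refl_y using IH by linarith
qed

section \<open>Refolding in a simple root\<close>

text \<open>At a wall \<open>i\<close> orthogonal to \<open>a\<close> and for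
  \<open>L = {..<i}\<close> this is the level at \<open>i\<close>, the offset being read off from
  the ascent before \<open>i\<close>. For \<open>L = UNIV\<close> no wall is involved and it is the
  pairing of the weight with \<open>a\<close>, see \<open>lev_UNIV\<close>.\<close>

definition lev :: "'i set \<Rightarrow> 'i set \<Rightarrow> 'v \<Rightarrow> int" where
  "lev J L a = signed_crossings J L a + (if ascends a (prod_at (J \<inter> L)) then 0 else - 1)"

lemma prod_at_Int_weyl: "finite J \<Longrightarrow> J \<subseteq> I \<Longrightarrow> prod_at (J \<inter> L) \<in> \<W>"
  by (rule prod_at_weyl) auto

definition unfolded_level :: "('v \<Rightarrow> 'v) \<Rightarrow> 'i set \<Rightarrow> 'v \<Rightarrow> int" where
  "unfolded_level u L a = (if ascends a u then hits L (inv u a) else - hits L (- inv u a))"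

text \<open>At a descent the 1 in the \<open>crossings\<close> of a negative root cancels the -1 in
  \<open>lev\<close>. What remains is the signed count in the unfolded gallery and the translation
  by the folds.\<close>

lemma lev_eq:
  assumes "finite J" "J \<subseteq> I" "down L" "a \<in> \<Delta>"
  shows "real_of_int (lev J L a) =
    unfolded_level (prod_at (J \<inter> L)) L a + pairing D (affine_prod (J \<inter> L) 0) a"
proof -
  let ?u = "prod_at (J \<inter> L)" and ?x = "inv (prod_at (J \<inter> L)) a"
  have W: "?u \<in> \<W>" using prod_at_Int_weyl assms by blast
  have x: "?x \<in> roots D" using root_image[OF weyl_inv[OF W] simple_root[OF assms(4)]] .
  have ux: "?u ?x = a" using weyl_inv_apply(2)[OF W] .
  have "real_of_int (signed_crossings J L a) = crossings L ?x + pairing D (affine_prod (J \<inter> L) 0) a"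
    using signed_crossings_eq[of "J \<inter> L" L ?x] assms x simple_pos_root[OF assms(4)]
    unfolding ux signed_crossings_restrict[OF assms(3)] by auto
  then show ?thesis
    unfolding lev_def unfolded_level_def ascends_def crossings_def by simp
qed

text \<open>Over the whole chain a positive root is counted as often as its pairing with
  \<open>lam\<close> says, so the unfolded level becomes the pairing of \<open>lam\<close> with
  \<open>inv (prod_at J) a\<close>.\<close>

lemma lev_UNIV:
  assumes "finite J" "J \<subseteq> I" "a \<in> \<Delta>"
  shows "real_of_int (lev J UNIV a) = pairing D (weight D lam I \<beta> J) a"
proof -
  let ?u = "prod_at J" and ?x = "inv (prod_at J) a"
  have W: "?u \<in> \<W>" using prod_at_weyl assms by blast
  have x: "?x \<in> roots D" using root_image[OF weyl_inv[OF W] simple_root[OF assms(3)]] .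
  have "real_of_int (unfolded_level ?u UNIV a) = pairing D lam ?x"
    using chain_card[of ?x] chain_card[of "- ?x"] neg_root_iff[OF x]
    by (auto simp: unfolded_level_def ascends_def hits_def pairing_minus_right)
  also have "\<dots> = pairing D (?u lam) a"
    using isometry_pairing[OF weyl_isometry[OF W], of lam ?x] weyl_inv_apply(2)[OF W] by simp
  finally show ?thesis
    using lev_eq[OF assms(1,2) _ assms(3), of UNIV] affine_prod_alt[OF assms(1,2), of lam]
    by (simp add: weight_eq pairing_simps)
qed

definition simple_wall :: "'i set \<Rightarrow> 'v \<Rightarrow> 'i \<Rightarrow> bool" where
  "simple_wall J a i \<longleftrightarrow> i \<in> I \<and> (root_at J i = a \<or> root_at J i = - a)"

lemma simple_wall_ascends:
  assumes "finite J" "J \<subseteq> I" "a \<in> \<Delta>" "simple_wall J a i"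
  shows "ascends a (prod_at (J \<inter> {..<i})) \<longleftrightarrow> root_at J i = a"
proof -
  have i: "i \<in> I" "root_at J i = a \<or> root_at J i = - a" using assms(4) by (auto simp: simple_wall_def)
  have "- a \<noteq> a"
    using root_cases[OF simple_root[OF assms(3)]] simple_pos_root[OF assms(3)] by auto
  then show ?thesis
    using i ascends_root[OF prod_at_Int_weyl[OF assms(1,2)] chain_pos[OF i(1)], of "{..<i}" a]
    unfolding root_at_def by auto
qed

text \<open>This is the geometric meaning of the level. If the root at the wall is
  \<open>- a\<close> instead of \<open>a\<close>, the sign is absorbed by that of
  \<open>unfolded_level\<close>, so that the hyperplane is always described with respect to
  \<open>a\<close>.\<close>

lemma affine_prod_conj:
  assumes "finite J" "J \<subseteq> I" "a \<in> \<Delta>" "simple_wall J a i"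
  shows "affine_prod (J \<inter> {..<i}) \<circ> affine_refl D (\<beta> i) (level0 I \<beta> i) =
    affine_refl D a (lev J {..<i} a) \<circ> affine_prod (J \<inter> {..<i})"
proof
  fix v
  let ?u = "prod_at (J \<inter> {..<i})" and ?t = "affine_prod (J \<inter> {..<i}) 0"
  let ?g = "root_at J i"
  have i: "i \<in> I" and g: "?g = a \<or> ?g = - a" using assms(4) by (auto simp: simple_wall_def)
  have W: "?u \<in> \<W>" using prod_at_Int_weyl assms by blast
  note iso = weyl_isometry[OF W]
  have lin: "linear ?u" using iso by (simp add: isometry_def)
  have ub: "?u (\<beta> i) = ?g" by (simp add: root_at_def)
  have inv: "inv ?u ?g = \<beta> i" using weyl_inv_apply(1)[OF W] ub by metis
  have l0: "level0 I \<beta> i = hits {..<i} (\<beta> i)" by (simp add: level0_def hits_def)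
  have alt: "affine_prod (J \<inter> {..<i}) w = ?u w + ?t" for w
    by (rule affine_prod_alt) (use assms in auto)
  have lev: "real_of_int (lev J {..<i} a) = unfolded_level ?u {..<i} a + pairing D ?t a"
    by (rule lev_eq) (use assms in auto)
  have asc: "ascends a ?u \<longleftrightarrow> ?g = a" using simple_wall_ascends[OF assms] .
  have *: "real_of_int (level0 I \<beta> i) *\<^sub>R ?g = (lev J {..<i} a - pairing D ?t a) *\<^sub>R a"
  proof (cases "?g = a")
    case True
    then show ?thesis using inv asc by (simp add: lev unfolded_level_def l0)
  next
    case False
    then have ga: "?g = - a" using g by blast
    then have "inv ?u a = - \<beta> i"
      using inv weyl_neg[OF weyl_inv[OF W], of a] by (metis minus_minus)
    then show ?thesis using ga False asc by (simp add: lev unfolded_level_def l0)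
  qed
  have sg: "\<sigma> ?g = \<sigma> a" using g refl_minus by auto
  have us: "?u (\<sigma> (\<beta> i) v) = \<sigma> a (?u v)"
    using isometry_refl[OF iso, of "\<beta> i"] ub sg by (metis comp_apply)
  have "(affine_prod (J \<inter> {..<i}) \<circ> affine_refl D (\<beta> i) (level0 I \<beta> i)) v =
      \<sigma> a (?u v) + real_of_int (level0 I \<beta> i) *\<^sub>R ?g + ?t"
    unfolding comp_apply alt[of "affine_refl D (\<beta> i) (level0 I \<beta> i) v"]
    by (simp add: affine_refl_def linear_add[OF lin] linear_scale[OF lin] us ub)
  also have "\<dots> = \<sigma> a (?u v) + (lev J {..<i} a - pairing D ?t a) *\<^sub>R a + ?t" by (simp add: *)
  also have "\<dots> = (affine_refl D a (lev J {..<i} a) \<circ> affine_prod (J \<inter> {..<i})) v"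
    by (simp add: alt[of v] affine_refl_def linear_add[OF refl_linear] root_refl_def[of D a ?t] algebra_simps)
  finally show "(affine_prod (J \<inter> {..<i}) \<circ> affine_refl D (\<beta> i) (level0 I \<beta> i)) v =
    (affine_refl D a (lev J {..<i} a) \<circ> affine_prod (J \<inter> {..<i})) v" .
qed

lemma affine_refl_invol: "a \<in> \<Delta> \<Longrightarrow> affine_refl D a k \<circ> affine_refl D a k = id"
  by (rule ext)
    (simp add: affine_refl_def linear_add[OF refl_linear] linear_scale[OF refl_linear]
      refl_invol refl_self simple_nonisotropic)

lemma prod_at_conj:
  assumes "finite J" "J \<subseteq> I" "simple_wall J a i"
  shows "prod_at (J \<inter> {..<i}) \<circ> \<sigma> (\<beta> i) = \<sigma> a \<circ> prod_at (J \<inter> {..<i})"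
proof -
  have "prod_at (J \<inter> {..<i}) \<circ> \<sigma> (\<beta> i) = \<sigma> (root_at J i) \<circ> prod_at (J \<inter> {..<i})"
    unfolding root_at_def by (rule isometry_refl[OF weyl_isometry[OF prod_at_Int_weyl[OF assms(1,2)]]])
  moreover have "\<sigma> (root_at J i) = \<sigma> a" using assms(3) by (auto simp: simple_wall_def refl_minus)
  ultimately show ?thesis by (simp only:)
qed

lemma prod_at_toggle:
  assumes "finite J" "J \<subseteq> I" "a \<in> \<Delta>" "simple_wall J a k" "down L" "k \<in> L"
  shows "prod_at (toggle k J \<inter> L) = \<sigma> a \<circ> prod_at (J \<inter> L)"
    "affine_prod (toggle k J \<inter> L) = affine_refl D a (lev J {..<k} a) \<circ> affine_prod (J \<inter> L)"
proof -
  show "prod_at (toggle k J \<inter> L) = \<sigma> a \<circ> prod_at (J \<inter> L)"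
    unfolding prod_at_def
  proof (rule ordprod_toggle[OF assms(1,5,6)])
    show "ordprod (\<lambda>i. \<sigma> (\<beta> i)) (J \<inter> {..<k}) \<circ> \<sigma> (\<beta> k) = \<sigma> a \<circ> ordprod (\<lambda>i. \<sigma> (\<beta> i)) (J \<inter> {..<k})"
      using prod_at_conj[OF assms(1,2,4)] unfolding prod_at_def .
    show "\<sigma> a \<circ> \<sigma> a = id" using refl_invol_comp[OF simple_nonisotropic[OF assms(3)]] .
  qed
  show "affine_prod (toggle k J \<inter> L) = affine_refl D a (lev J {..<k} a) \<circ> affine_prod (J \<inter> L)"
    unfolding affine_prod_def
  proof (rule ordprod_toggle[OF assms(1,5,6)])
    show "ordprod (\<lambda>i. affine_refl D (\<beta> i) (level0 I \<beta> i)) (J \<inter> {..<k}) \<circ> affine_refl D (\<beta> k) (level0 I \<beta> k)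
      = affine_refl D a (lev J {..<k} a) \<circ> ordprod (\<lambda>i. affine_refl D (\<beta> i) (level0 I \<beta> i)) (J \<inter> {..<k})"
      using affine_prod_conj[OF assms(1-4)] unfolding affine_prod_def .
  qed (rule affine_refl_invol[OF assms(3)])
qed

lemma root_at_toggle:
  assumes "finite J" "J \<subseteq> I" "a \<in> \<Delta>" "simple_wall J a k"
  shows "root_at (toggle k J) i = (if k < i then \<sigma> a (root_at J i) else root_at J i)"
proof (cases "k < i")
  case True
  then show ?thesis using prod_at_toggle(1)[OF assms, of "{..<i}"] by (simp add: root_at_def)
next
  case False
  then show ?thesis using toggle_Int[of k "{..<i}" J] by (simp add: root_at_def)
qed

text \<open>Beyond \<open>k\<close> all roots are reflected in \<open>a\<close>, which only
  exchanges \<open>a\<close> and \<open>- a\<close>.\<close>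

lemma simple_wall_toggle:
  assumes "finite J" "J \<subseteq> I" "a \<in> \<Delta>" "simple_wall J a k"
  shows "simple_wall (toggle k J) a i \<longleftrightarrow> simple_wall J a i"
proof -
  have "\<sigma> a x = a \<longleftrightarrow> x = - a" "\<sigma> a x = - a \<longleftrightarrow> x = a" for x
    using refl_invol[OF simple_nonisotropic[OF assms(3)]] refl_self[OF simple_nonisotropic[OF assms(3)]]
      linear_neg[OF refl_linear] by (metis minus_minus)+
  then show ?thesis unfolding simple_wall_def root_at_toggle[OF assms] by auto
qed

section \<open>Admissibility and the persistence of ascents\<close>

definition adm :: "'i set \<Rightarrow> bool" where
  "adm J \<longleftrightarrow> finite J \<and> J \<subseteq> I \<and>
     (\<forall>j\<in>J. len D (prod_at (J \<inter> {..<j}) \<circ> \<sigma> (\<beta> j)) = len D (prod_at (J \<inter> {..<j})) + 1)"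

lemma adm_finite: "adm J \<Longrightarrow> finite J" and adm_subset: "adm J \<Longrightarrow> J \<subseteq> I"
  by (auto simp: adm_def)

lemma prod_at_atMost:
  assumes "finite J" "j \<in> J" shows "prod_at (J \<inter> {..j}) = prod_at (J \<inter> {..<j}) \<circ> \<sigma> (\<beta> j)"
proof -
  have "J \<inter> {..j} = insert j (J \<inter> {..<j})" using assms by auto
  then show ?thesis unfolding prod_at_def using assms by (simp add: ordprod_insert_max)
qed

lemma take_sorted_list_of_set:
  assumes "finite J" "k < length (sorted_list_of_set J)"
  shows "take k (sorted_list_of_set J) = sorted_list_of_set (J \<inter> {..<sorted_list_of_set J ! k})"
proof -
  let ?xs = "sorted_list_of_set J"
  have srt: "sorted_wrt (<) ?xs" by (rule strict_sorted_list_of_set)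
  have "set (take k ?xs) = J \<inter> {..<?xs ! k}"
  proof (intro set_eqI iffI)
    fix x assume "x \<in> set (take k ?xs)"
    then obtain m where "m < k" "x = ?xs ! m" using assms by (auto simp: in_set_conv_nth)
    then show "x \<in> J \<inter> {..<?xs ! k}"
      using assms srt set_sorted_list_of_set[OF assms(1)] nth_mem[of m ?xs]
      by (auto simp: sorted_wrt_iff_nth_less)
  next
    fix x assume x: "x \<in> J \<inter> {..<?xs ! k}"
    then obtain m where m: "m < length ?xs" "x = ?xs ! m"
      using set_sorted_list_of_set[OF assms(1)] by (metis IntD1 in_set_conv_nth)
    have "m < k"
    proof (rule ccontr)
      assume "\<not> m < k"
      then have "?xs ! k \<le> ?xs ! m" using m assms by (intro sorted_nth_mono) auto
      then show False using x m by auto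
    qed
    then show "x \<in> set (take k ?xs)" using m by (auto simp: in_set_conv_nth intro!: exI[of _ m])
  qed
  moreover have "sorted_wrt (<) (take k ?xs)" using srt by (rule sorted_wrt_take)
  ultimately show ?thesis using assms
    by (intro sorted_distinct_set_unique) (auto simp: strict_sorted_iff)
qed

lemma admissible_iff: "admissible D I \<beta> J \<longleftrightarrow> adm J"
proof (cases "finite J \<and> J \<subseteq> I")
  case True
  let ?xs = "sorted_list_of_set J" and ?ys = "map \<beta> (sorted_list_of_set J)"
  have cover: "bruhat_cover D (refl_prod D (take k ?ys)) (refl_prod D (take (Suc k) ?ys)) \<longleftrightarrow>
      len D (prod_at (J \<inter> {..<?xs ! k}) \<circ> \<sigma> (\<beta> (?xs ! k))) = len D (prod_at (J \<inter> {..<?xs ! k})) + 1"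
    if k: "k < length ?xs" for k
  proof -
    have m: "?xs ! k \<in> J" using nth_mem[OF k] True by auto
    have 1: "refl_prod D (take k ?ys) = prod_at (J \<inter> {..<?xs ! k})"
      by (simp add: take_map take_sorted_list_of_set[OF _ k] True refl_prod_sorted)
    have "take (Suc k) ?ys = take k ?ys @ [\<beta> (?xs ! k)]" using k by (simp add: take_Suc_conv_app_nth)
    then have 2: "refl_prod D (take (Suc k) ?ys) = prod_at (J \<inter> {..<?xs ! k}) \<circ> \<sigma> (\<beta> (?xs ! k))"
      using 1 by (simp add: refl_prod_append refl_prod_simps)
    have "\<beta> (?xs ! k) \<in> pos_roots D" using m True chain_pos by auto
    then show ?thesis unfolding 1 2 bruhat_cover_def by auto
  qed
  have "J = set ?xs" using True by simp
  then have all: "(\<forall>j\<in>J. Q j) \<longleftrightarrow> (\<forall>k<length ?xs. Q (?xs ! k))" for Q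
    by (metis in_set_conv_nth)
  show ?thesis
    unfolding admissible_def adm_def Let_def all length_map using True cover by blast
qed (auto simp: admissible_def adm_def)

text \<open>If the root at a fold were negative, the reflection would shorten the product instead of
  giving a cover.\<close>

lemma adm_root_at_pos: "adm J \<Longrightarrow> j \<in> J \<Longrightarrow> root_at J j \<in> pos_roots D"
proof (rule ccontr)
  assume j: "adm J" "j \<in> J" "root_at J j \<notin> pos_roots D"
  then have "len D (prod_at (J \<inter> {..<j}) \<circ> \<sigma> (\<beta> j)) < len D (prod_at (J \<inter> {..<j}))"
    by (intro len_refl_less prod_at_Int_weyl chain_pos) (auto simp: adm_def root_at_def)
  then show False using j unfolding adm_def by auto
qed

lemma ascends_step:
  assumes "adm J" "a \<in> \<Delta>" "j \<in> J" "root_at J j \<noteq> a" "ascends a (prod_at (J \<inter> {..<j}))"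
  shows "ascends a (prod_at (J \<inter> {..j}))"
proof (rule ccontr)
  have J: "finite J" "J \<subseteq> I" "j \<in> I" using assms by (auto simp: adm_def)
  assume "\<not> ascends a (prod_at (J \<inter> {..j}))"
  then have "\<not> ascends a (prod_at (J \<inter> {..<j}) \<circ> \<sigma> (\<beta> j))"
    using prod_at_atMost[OF J(1) assms(3)] by simp
  moreover have "len D (prod_at (J \<inter> {..<j}) \<circ> \<sigma> (\<beta> j)) = len D (prod_at (J \<inter> {..<j})) + 1"
    using assms(1,3) unfolding adm_def by blast
  ultimately have "prod_at (J \<inter> {..<j}) (\<beta> j) = a"
    using lifting[OF prod_at_Int_weyl[OF J(1,2)] chain_pos[OF J(3)] assms(2)] assms(5) by blast
  then show False using assms(4) by (simp add: root_at_def)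
qed

text \<open>Only a fold at the root \<open>a\<close> itself can end an ascent, by the lifting
  property. The induction strips off the last fold between the two cuts.\<close>

lemma ascends_mono:
  assumes "adm J" "a \<in> \<Delta>" "down L" "down L'" "L \<subseteq> L'" "ascends a (prod_at (J \<inter> L))"
    and "\<And>j. j \<in> J \<Longrightarrow> j \<in> L' \<Longrightarrow> j \<notin> L \<Longrightarrow> root_at J j \<noteq> a"
  shows "ascends a (prod_at (J \<inter> L'))"
  using assms(4,5,7)
proof (induction "card (J \<inter> (L' - L))" arbitrary: L')
  case 0
  then have "J \<inter> L' = J \<inter> L" using adm_finite[OF assms(1)] by auto
  then show ?case using assms(6) by simp
next
  case (Suc n)
  let ?K = "J \<inter> (L' - L)"
  have fin: "finite ?K" "?K \<noteq> {}" using Suc(2) adm_finite[OF assms(1)] by (auto simp: card_gt_0_iff)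
  define j where "j = Max ?K"
  have j: "j \<in> ?K" unfolding j_def using Max_in[OF fin] .
  have max: "i \<le> j" if "i \<in> ?K" for i unfolding j_def using Max_ge[OF fin(1) that] .
  have sub: "L \<subseteq> {..<j}" using j assms(3) unfolding down_def by (auto simp: not_le[symmetric])
  have low: "i \<in> L'" if "i < j" for i
    using that j Suc.prems(1) unfolding down_def by (blast intro: less_imp_le)
  have "i \<in> ?K \<longleftrightarrow> i \<in> insert j (J \<inter> ({..<j} - L))" for i
    using j max[of i] low[of i] by (cases i j rule: linorder_cases) auto
  then have "?K = insert j (J \<inter> ({..<j} - L))" by blast
  then have "n = card (J \<inter> ({..<j} - L))" using Suc(2) fin(1) by simp
  then have "ascends a (prod_at (J \<inter> {..<j}))"
  proof (rule Suc.hyps(1))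
    show "\<And>i. i \<in> J \<Longrightarrow> i \<in> {..<j} \<Longrightarrow> i \<notin> L \<Longrightarrow> root_at J i \<noteq> a"
      using Suc.prems(3) low by blast
  qed (use sub in auto)
  then have "ascends a (prod_at (J \<inter> {..j}))"
    using ascends_step[OF assms(1,2)] j Suc.prems(3) by blast
  moreover have "i \<le> j" if "i \<in> J \<inter> L'" for i
    using that max[of i] subsetD[OF sub, of i] by (cases "i \<in> L") auto
  then have "i \<in> J \<inter> {..j} \<longleftrightarrow> i \<in> J \<inter> L'" for i
    using j low[of i] by (cases i j rule: linorder_cases) auto
  then have "J \<inter> {..j} = J \<inter> L'" by blast
  ultimately show ?case by simp
qed

lemma lev_cong: "down L \<Longrightarrow> J \<inter> L = J' \<inter> L \<Longrightarrow> lev J L a = lev J' L a"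
  unfolding lev_def using signed_crossings_restrict[of L J a] signed_crossings_restrict[of L J' a] by simp

text \<open>
  The lattice path of the simple root \<open>a\<close> has level \<open>lv J a k\<close> at the \<open>k\<close>-th wall orthogonal to
  \<open>a\<close> and goes up just before (after) that wall iff \<open>pre J a k\<close> (\<open>post J a k\<close>). The number of
  walls itself stands for the end of the gallery, the index \<open>\<infinity>\<close> of the paper.
\<close>

definition walls :: "'i set \<Rightarrow> 'v \<Rightarrow> 'i list" where
  "walls J a = sorted_list_of_set {i. simple_wall J a i}"

definition stage :: "'i set \<Rightarrow> 'v \<Rightarrow> nat \<Rightarrow> 'i set" where
  "stage J a k = (if k < length (walls J a) then {..<walls J a ! k} else UNIV)"

definition pre :: "'i set \<Rightarrow> 'v \<Rightarrow> nat \<Rightarrow> bool" where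
  "pre J a k \<longleftrightarrow> ascends a (prod_at (J \<inter> stage J a k))"

definition post :: "'i set \<Rightarrow> 'v \<Rightarrow> nat \<Rightarrow> bool" where
  "post J a k \<longleftrightarrow> ascends a (prod_at (J \<inter> {..walls J a ! k}))"

definition lv :: "'i set \<Rightarrow> 'v \<Rightarrow> nat \<Rightarrow> int" where
  "lv J a k = lev J (stage J a k) a"

lemma down_stage [simp]: "down (stage J a k)"
  by (simp add: stage_def)

lemma set_walls: "finite J \<Longrightarrow> J \<subseteq> I \<Longrightarrow> set (walls J a) = {i. simple_wall J a i}"
  using finite_root_at[of J a] by (simp add: walls_def simple_wall_def)

lemma walls_less_iff:
  assumes "j < length (walls J a)" "k < length (walls J a)"
  shows "walls J a ! j < walls J a ! k \<longleftrightarrow> j < k"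
proof -
  have "sorted_wrt (<) (walls J a)" unfolding walls_def by (rule strict_sorted_list_of_set)
  then show ?thesis
    using assms by (metis linorder_less_linear order_less_asym sorted_wrt_nth_less)
qed

lemma walls_mem_stage:
  "j < length (walls J a) \<Longrightarrow> k \<le> length (walls J a) \<Longrightarrow> walls J a ! j \<in> stage J a k \<longleftrightarrow> j < k"
  by (auto simp: stage_def walls_less_iff)

lemma walls_simple_wall:
  "finite J \<Longrightarrow> J \<subseteq> I \<Longrightarrow> k < length (walls J a) \<Longrightarrow> simple_wall J a (walls J a ! k)"
  using set_walls nth_mem by blast

lemma simple_wall_nth:
  assumes "finite J" "J \<subseteq> I" "simple_wall J a i"
  obtains k where "k < length (walls J a)" "i = walls J a ! k"
  using assms set_walls[OF assms(1,2), of a] by (metis in_set_conv_nth mem_Collect_eq)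

text \<open>A fold at the root \<open>a\<close> would sit on a wall orthogonal to \<open>a\<close>,
  and none lies strictly between two consecutive ones.\<close>

lemma between_mono:
  assumes "adm J" "a \<in> \<Delta>" "k < length (walls J a)" "{..walls J a ! k} \<subseteq> L" "L \<subseteq> L'"
    "L' \<subseteq> stage J a (Suc k)" "down L" "down L'" "ascends a (prod_at (J \<inter> L))"
  shows "ascends a (prod_at (J \<inter> L'))"
proof (rule ascends_mono[OF assms(1,2,7,8,5,9)])
  fix j assume j: "j \<in> J" "j \<in> L'" "j \<notin> L"
  show "root_at J j \<noteq> a"
  proof
    assume "root_at J j = a"
    then have "simple_wall J a j" using j adm_subset[OF assms(1)] by (auto simp: simple_wall_def)
    then obtain i where i: "i < length (walls J a)" "j = walls J a ! i"
      using simple_wall_nth adm_finite adm_subset assms(1) by metis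
    then have "i < Suc k" using assms(3,6) j walls_mem_stage[of i J a "Suc k"] by auto
    moreover have "k < i"
      using subsetD[OF assms(4), of j] j(3) i walls_less_iff[OF assms(3) i(1)] by (auto simp: not_le[symmetric])
    ultimately show False by simp
  qed
qed

context
  fixes J a assumes adm: "adm J" and a: "a \<in> \<Delta>"
begin

lemma finite_J: "finite J" and J_subset: "J \<subseteq> I"
  using adm adm_finite adm_subset by auto

lemma pre_iff:
  "k < length (walls J a) \<Longrightarrow> pre J a k \<longleftrightarrow> root_at J (walls J a ! k) = a"
  using simple_wall_ascends[OF finite_J J_subset a walls_simple_wall[OF finite_J J_subset]] by (simp add: pre_def stage_def)

lemma pre_0: "pre J a 0"
proof -
  have "ascends a (prod_at (J \<inter> {}))" using ascends_id[OF a] by (simp add: prod_at_def)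
  then show ?thesis
    unfolding pre_def
  proof (rule ascends_mono[OF adm a, rotated 3])
    fix j assume j: "j \<in> J" "j \<in> stage J a 0"
    show "root_at J j \<noteq> a"
    proof
      assume "root_at J j = a"
      then have "simple_wall J a j" using j J_subset by (auto simp: simple_wall_def)
      then obtain i where "i < length (walls J a)" "j = walls J a ! i"
        using simple_wall_nth finite_J J_subset by metis
      then show False using j walls_mem_stage[of i J a 0] by simp
    qed
  qed auto
qed

lemma post_imp_pre:
  assumes "k < length (walls J a)" "post J a k" shows "pre J a (Suc k)"
  unfolding pre_def
  by (rule between_mono[OF adm a assms(1), of "{..walls J a ! k}"])
    (use assms walls_less_iff[of k J a "Suc k"] in \<open>auto simp: post_def stage_def\<close>)

text \<open>Folds of an admissible set occur at positive roots, hence here at \<open>a\<close> and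
  not at \<open>- a\<close>; left multiplication by \<open>\<sigma> a\<close> then turns the ascent
  into a descent.\<close>

lemma wall_mem:
  assumes "k < length (walls J a)" "walls J a ! k \<in> J" shows "pre J a k" "\<not> post J a k"
proof -
  let ?w = "walls J a ! k"
  have sw: "simple_wall J a ?w" using walls_simple_wall[OF finite_J J_subset assms(1)] .
  have "root_at J ?w = a"
    using sw adm_root_at_pos[OF adm assms(2)] neg_root_iff[OF simple_root[OF a]] simple_pos_root[OF a]
    by (auto simp: simple_wall_def)
  then show p: "pre J a k" using pre_iff assms by simp
  have "prod_at (J \<inter> {..?w}) = \<sigma> a \<circ> prod_at (J \<inter> {..<?w})"
    using prod_at_atMost[OF finite_J assms(2)] prod_at_conj[OF finite_J J_subset sw] by simp
  then show "\<not> post J a k"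
    using p ascends_refl[OF prod_at_Int_weyl[OF finite_J J_subset] a, of "{..<?w}"] assms
    by (simp add: post_def pre_def stage_def)
qed

lemma wall_notmem:
  assumes "k < length (walls J a)" "walls J a ! k \<notin> J" shows "post J a k \<longleftrightarrow> pre J a k"
proof -
  have "J \<inter> {..walls J a ! k} = J \<inter> {..<walls J a ! k}"
    using assms by (auto simp: order.strict_iff_order)
  then show ?thesis using assms by (simp add: post_def pre_def stage_def)
qed

lemma lv_0: "lv J a 0 = 0"
proof -
  have "{j. j \<in> I \<and> j \<in> stage J a 0 \<and> j \<notin> J \<and> (root_at J j = a \<or> root_at J j = - a)} = {}"
  proof (intro equals0I)
    fix j assume j: "j \<in> {j. j \<in> I \<and> j \<in> stage J a 0 \<and> j \<notin> J \<and> (root_at J j = a \<or> root_at J j = - a)}"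
    then have "simple_wall J a j" by (auto simp: simple_wall_def)
    then obtain i where "i < length (walls J a)" "j = walls J a ! i"
      using simple_wall_nth finite_J J_subset by metis
    then show False using j walls_mem_stage[of i J a 0] by simp
  qed
  then have "signed_crossings J (stage J a 0) a = 0" unfolding signed_crossings_def by (simp only: sum.empty)
  then show ?thesis using pre_0 by (simp add: lv_def lev_def pre_def)
qed

text \<open>Half a step is made just after wall \<open>k\<close> and half a step just before the
  next: two rises give 1, a fall followed by a rise 0, two falls -1. A rise followed by a fall is
  excluded by \<open>post_imp_pre\<close>.\<close>

lemma lv_Suc:
  assumes k: "k < length (walls J a)"
  shows "lv J a (Suc k) = lv J a k + (if post J a k then 1 else if pre J a (Suc k) then 0 else - 1)"
proof -
  let ?w = "walls J a ! k"
  let ?A = "\<lambda>k. {j. j \<in> I \<and> j \<in> stage J a k \<and> j \<notin> J \<and> (root_at J j = a \<or> root_at J j = - a)}"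
  have sw: "simple_wall J a ?w" using walls_simple_wall[OF finite_J J_subset k] .
  have finA: "finite (?A k)" by (rule finite_subset[OF _ finite_root_at[OF finite_J J_subset, of a]]) auto
  have notin: "?w \<notin> ?A k" using walls_mem_stage[of k J a k] k by simp
  have "j \<in> ?A (Suc k) \<longleftrightarrow> j \<in> (if ?w \<in> J then ?A k else insert ?w (?A k))" for j
  proof (cases "simple_wall J a j")
    case True
    then obtain i where i: "i < length (walls J a)" "j = walls J a ! i"
      using simple_wall_nth finite_J J_subset by metis
    have "j = ?w \<longleftrightarrow> i = k" using walls_less_iff[OF i(1) k] walls_less_iff[OF k i(1)] i by force
    moreover have "j \<in> stage J a (Suc k) \<longleftrightarrow> i < Suc k" "j \<in> stage J a k \<longleftrightarrow> i < k"
      using walls_mem_stage[of i J a] i k by auto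
    ultimately show ?thesis using True by (auto simp: simple_wall_def less_Suc_eq)
  next
    case False
    then show ?thesis using sw by (auto simp: simple_wall_def)
  qed
  then have "?A (Suc k) = (if ?w \<in> J then ?A k else insert ?w (?A k))" by blast
  then have S: "signed_crossings J (stage J a (Suc k)) a = signed_crossings J (stage J a k) a +
      (if ?w \<in> J then 0 else root_sgn D (root_at J ?w))"
    unfolding signed_crossings_def using sum.insert[OF finA notin, of "\<lambda>j. root_sgn D (root_at J j)"]
    by (cases "?w \<in> J") simp_all
  have sg: "root_sgn D (root_at J ?w) = (if pre J a k then 1 else - 1)"
    using pre_iff[OF k] sw simple_pos_root[OF a] neg_root_iff[OF simple_root[OF a]]
    by (auto simp: root_sgn_def simple_wall_def)
  show ?thesis
    using wall_mem[OF k] wall_notmem[OF k] post_imp_pre[OF k]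
    unfolding lv_def lev_def S sg by (fold pre_def) auto
qed

end

text \<open>Toggling two consecutive walls reflects the segment between them and translates what
  follows. At the last wall the second toggle is absent and the segment runs to the end of the
  gallery.\<close>

definition refold :: "'v \<Rightarrow> nat \<Rightarrow> 'i set \<Rightarrow> 'i set" where
  "refold a k J = toggle (walls J a ! k)
     (if Suc k < length (walls J a) then toggle (walls J a ! Suc k) J else J)"

text \<open>The path rises into wall \<open>k\<close> and falls after the next wall, unless the
  gallery ends there. The flag \<open>b\<close> says that the segment in between rises, so that the
  turn is not at wall \<open>k\<close>; refolding flips the flag.\<close>

definition swappable :: "'i set \<Rightarrow> 'v \<Rightarrow> nat \<Rightarrow> bool \<Rightarrow> bool" where
  "swappable J a k b \<longleftrightarrow> k < length (walls J a) \<and> pre J a k \<and> post J a k = b \<and>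
     pre J a (Suc k) = b \<and> (Suc k < length (walls J a) \<longrightarrow> \<not> post J a (Suc k))"

lemma refold_basic:
  assumes "finite J" "J \<subseteq> I" "a \<in> \<Delta>" "k < length (walls J a)"
  shows "finite (refold a k J)" "refold a k J \<subseteq> I"
    "simple_wall (refold a k J) a = simple_wall J a" "walls (refold a k J) a = walls J a"
    "refold a k (refold a k J) = J"
    "stage (refold a k J) a = stage J a"
proof -
  let ?n = "length (walls J a)"
  define J0 where "J0 = (if Suc k < ?n then toggle (walls J a ! Suc k) J else J)"
  have sw: "i < ?n \<Longrightarrow> simple_wall J a (walls J a ! i)" for i
    using walls_simple_wall[OF assms(1,2)] .
  have sub: "toggle i K \<subseteq> I" if "simple_wall J a i" "K \<subseteq> I" for i K
    using that by (auto simp: toggle_def simple_wall_def)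
  have J0: "finite J0" "J0 \<subseteq> I" using assms sub[OF sw] by (auto simp: J0_def)
  have w0: "simple_wall J0 a = simple_wall J a"
    using simple_wall_toggle[OF assms(1-3) sw, of "Suc k"] by (auto simp: J0_def)
  have R: "refold a k J = toggle (walls J a ! k) J0" by (simp add: refold_def J0_def)
  show "finite (refold a k J)" "refold a k J \<subseteq> I" using J0 sub sw assms by (auto simp: R)
  show w1: "simple_wall (refold a k J) a = simple_wall J a"
    using simple_wall_toggle[OF J0 assms(3), of "walls J a ! k"] sw[OF assms(4)] unfolding R w0 by auto
  then show w2: "walls (refold a k J) a = walls J a" by (simp add: walls_def)
  then show "stage (refold a k J) a = stage J a" by (simp add: stage_def fun_eq_iff)
  show "refold a k (refold a k J) = J"
    unfolding refold_def[of a k "refold a k J"] w2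
    by (simp add: refold_def toggle_commute[of "walls J a ! Suc k" "walls J a ! k"])
qed

lemma refold_mem:
  assumes "k < length (walls J a)"
  shows "i \<in> refold a k J \<longleftrightarrow>
    (if i = walls J a ! k \<or> Suc k < length (walls J a) \<and> i = walls J a ! Suc k then i \<notin> J else i \<in> J)"
  using assms walls_less_iff[of k J a "Suc k"] by (auto simp: refold_def mem_toggle)

text \<open>Beyond both walls the two reflections in \<open>a\<close> cancel in the linear product,
  whereas the affine ones belong to parallel hyperplanes and leave a translation.\<close>

lemma refold_prod:
  assumes "finite J" "J \<subseteq> I" "a \<in> \<Delta>" "k < length (walls J a)" "down L"
  shows "walls J a ! k \<notin> L \<Longrightarrow> refold a k J \<inter> L = J \<inter> L"
    "walls J a ! k \<in> L \<Longrightarrow> L \<subseteq> stage J a (Suc k) \<Longrightarrow> prod_at (refold a k J \<inter> L) = \<sigma> a \<circ> prod_at (J \<inter> L)"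
    "walls J a ! k \<in> L \<Longrightarrow> L \<subseteq> stage J a (Suc k) \<Longrightarrow>
      affine_prod (refold a k J \<inter> L) = affine_refl D a (lv J a k) \<circ> affine_prod (J \<inter> L)"
    "Suc k < length (walls J a) \<Longrightarrow> walls J a ! Suc k \<in> L \<Longrightarrow> prod_at (refold a k J \<inter> L) = prod_at (J \<inter> L)"
    "Suc k < length (walls J a) \<Longrightarrow> walls J a ! Suc k \<in> L \<Longrightarrow> affine_prod (refold a k J \<inter> L) =
      affine_refl D a (lv J a k) \<circ> affine_refl D a (lv J a (Suc k)) \<circ> affine_prod (J \<inter> L)"
proof -
  let ?n = "length (walls J a)" and ?w = "walls J a ! k" and ?w' = "walls J a ! Suc k"
  define J0 where "J0 = (if Suc k < ?n then toggle ?w' J else J)"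
  have sw: "i < ?n \<Longrightarrow> simple_wall J a (walls J a ! i)" for i
    using walls_simple_wall[OF assms(1,2)] .
  have J0: "finite J0" "J0 \<subseteq> I"
    using assms sw[of "Suc k"] by (auto simp: J0_def toggle_def simple_wall_def)
  have sw0: "simple_wall J0 a ?w"
    using simple_wall_toggle[OF assms(1-3) sw, of "Suc k"] sw[OF assms(4)] by (auto simp: J0_def)
  have R: "refold a k J = toggle ?w J0" by (simp add: refold_def J0_def)
  have less: "Suc k < ?n \<Longrightarrow> ?w < ?w'" using walls_less_iff[of k J a "Suc k"] assms by simp
  have J0L: "J0 \<inter> M = J \<inter> M" if "Suc k < ?n \<Longrightarrow> ?w' \<notin> M" for M
    using that toggle_Int[of ?w' M J] by (auto simp: J0_def)
  have lev0: "lev J0 {..<?w} a = lv J a k"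
    using lev_cong[of "{..<?w}" J0 J a] J0L[of "{..<?w}"] less assms(4) by (force simp: lv_def stage_def)
  show "walls J a ! k \<notin> L \<Longrightarrow> refold a k J \<inter> L = J \<inter> L"
  proof -
    assume w: "?w \<notin> L"
    then have "Suc k < ?n \<Longrightarrow> ?w' \<notin> L" using less assms(5) unfolding down_def by (blast intro: less_imp_le)
    then show ?thesis unfolding R toggle_Int[OF w] by (rule J0L)
  qed
  have mid: "J0 \<inter> L = J \<inter> L" if "L \<subseteq> stage J a (Suc k)"
    by (rule J0L) (use that in \<open>auto simp: stage_def\<close>)
  show "walls J a ! k \<in> L \<Longrightarrow> L \<subseteq> stage J a (Suc k) \<Longrightarrow> prod_at (refold a k J \<inter> L) = \<sigma> a \<circ> prod_at (J \<inter> L)"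
    using prod_at_toggle(1)[OF J0 assms(3) sw0 assms(5)] mid by (simp add: R)
  show "walls J a ! k \<in> L \<Longrightarrow> L \<subseteq> stage J a (Suc k) \<Longrightarrow>
      affine_prod (refold a k J \<inter> L) = affine_refl D a (lv J a k) \<circ> affine_prod (J \<inter> L)"
    using prod_at_toggle(2)[OF J0 assms(3) sw0 assms(5)] mid lev0 by (simp add: R)
  assume n: "Suc k < ?n" and w': "?w' \<in> L"
  have w: "?w \<in> L" using w' less[OF n] assms(5) unfolding down_def by (blast intro: less_imp_le)
  have J0': "J0 = toggle ?w' J" using n by (simp add: J0_def)
  have lev': "lev J {..<?w'} a = lv J a (Suc k)" using n by (simp add: lv_def stage_def)
  have "prod_at (refold a k J \<inter> L) = \<sigma> a \<circ> (\<sigma> a \<circ> prod_at (J \<inter> L))"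
    unfolding R using prod_at_toggle(1)[OF J0 assms(3) sw0 assms(5) w]
      prod_at_toggle(1)[OF assms(1-3) sw[OF n] assms(5) w'] by (simp only: J0')
  then show "prod_at (refold a k J \<inter> L) = prod_at (J \<inter> L)" using refl_comp_refl[OF assms(3)] by simp
  show "affine_prod (refold a k J \<inter> L) =
      affine_refl D a (lv J a k) \<circ> affine_refl D a (lv J a (Suc k)) \<circ> affine_prod (J \<inter> L)"
    unfolding R using prod_at_toggle(2)[OF J0 assms(3) sw0 assms(5) w]
      prod_at_toggle(2)[OF assms(1-3) sw[OF n] assms(5) w'] lev0 lev' by (simp only: J0' comp_assoc)
qed

lemma affine_refl_twice:
  "a \<in> \<Delta> \<Longrightarrow> affine_refl D a k (affine_refl D a m v) = v + of_int (k - m) *\<^sub>R a"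
  by (simp add: affine_refl_def linear_add[OF refl_linear] linear_scale[OF refl_linear]
      refl_invol refl_self simple_nonisotropic algebra_simps)

lemma weight_refold:
  assumes "finite J" "J \<subseteq> I" "a \<in> \<Delta>" "k < length (walls J a)"
  shows "weight D lam I \<beta> (refold a k J) = weight D lam I \<beta> J + of_int (lv J a k - lv J a (Suc k)) *\<^sub>R a"
proof -
  let ?m = "weight D lam I \<beta> J"
  have "weight D lam I \<beta> (refold a k J) = affine_refl D a (lv J a k) (affine_refl D a (lv J a (Suc k)) ?m)"
  proof (cases "Suc k < length (walls J a)")
    case True
    then show ?thesis using refold_prod(5)[OF assms, of UNIV] by (simp add: weight_eq)
  next
    case False
    then have c: "stage J a (Suc k) = UNIV" by (simp add: stage_def)
    then have "lv J a (Suc k) = lev J UNIV a" by (simp add: lv_def)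
    \<comment> \<open>The endpoint lies on the hyperplane of its own level, so the absent second
      toggle does not change the formula.\<close>
    then have "affine_refl D a (lv J a (Suc k)) ?m = ?m"
      using lev_UNIV[OF assms(1-3)] by (simp add: affine_refl_def root_refl_def)
    then show ?thesis using refold_prod(3)[OF assms, of UNIV] c by (simp add: weight_eq)
  qed
  then show ?thesis by (simp add: affine_refl_twice[OF assms(3)])
qed

lemma refold_pre_post:
  assumes "finite J" "J \<subseteq> I" "a \<in> \<Delta>" "k < length (walls J a)"
  shows "j \<le> length (walls J a) \<Longrightarrow> pre (refold a k J) a j \<longleftrightarrow> (if j = Suc k then \<not> pre J a j else pre J a j)"
    "j < length (walls J a) \<Longrightarrow> post (refold a k J) a j \<longleftrightarrow> (if j = k then \<not> post J a j else post J a j)"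
proof -
  let ?n = "length (walls J a)"
  note basic = refold_basic[OF assms]
  have *: "ascends a (prod_at (refold a k J \<inter> L)) \<longleftrightarrow>
      (if walls J a ! k \<in> L \<and> \<not> (Suc k < ?n \<and> walls J a ! Suc k \<in> L) then \<not> ascends a (prod_at (J \<inter> L))
       else ascends a (prod_at (J \<inter> L)))"
    if L: "down L" for L
  proof -
    note R = refold_prod[OF assms L]
    consider "walls J a ! k \<notin> L" | "walls J a ! k \<in> L" "Suc k < ?n" "walls J a ! Suc k \<in> L"
      | "walls J a ! k \<in> L" "\<not> (Suc k < ?n \<and> walls J a ! Suc k \<in> L)" by blast
    then show ?thesis
    proof cases
      case 1
      moreover have "\<not> (Suc k < ?n \<and> walls J a ! Suc k \<in> L)"
        using 1 L walls_less_iff[of k J a "Suc k"] assms(4) unfolding down_def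
        by (meson lessI less_imp_le)
      ultimately show ?thesis using R(1) by simp
    next
      case 2
      then show ?thesis using R(4) by simp
    next
      case 3
      then have "L \<subseteq> stage J a (Suc k)" using L by (auto simp: stage_def down_def not_less[symmetric])
      then show ?thesis
        using 3 R(2) ascends_refl[OF prod_at_Int_weyl[OF assms(1,2)] assms(3), of L]
        by (simp del: o_apply)
    qed
  qed
  show "pre (refold a k J) a j \<longleftrightarrow> (if j = Suc k then \<not> pre J a j else pre J a j)" if "j \<le> ?n"
    unfolding pre_def basic using *[OF down_stage, of J a j] that assms(4) by (auto simp: walls_mem_stage)
  show "post (refold a k J) a j \<longleftrightarrow> (if j = k then \<not> post J a j else post J a j)" if "j < ?n"
    unfolding post_def basic
    using *[of "{..walls J a ! j}"] that assms(4) walls_less_iff[OF that, of k]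
      walls_less_iff[OF that, of "Suc k"] by (auto simp: not_less[symmetric])
qed

lemma swappable_mem:
  assumes "adm J" "a \<in> \<Delta>" "swappable J a k b"
  shows "walls J a ! k \<in> J \<longleftrightarrow> \<not> b" "Suc k < length (walls J a) \<Longrightarrow> walls J a ! Suc k \<in> J \<longleftrightarrow> b"
  using assms(3) wall_mem[OF assms(1,2)] wall_notmem[OF assms(1,2)] unfolding swappable_def by blast+

text \<open>Inside the reflected segment the path rises throughout or falls throughout, so left
  multiplication by \<open>\<sigma> a\<close> changes the lengths before and after each fold by the
  same amount and covers stay covers. A fold created at one of the two walls is a cover by the
  ascent or descent there. Only the step from \<open>k\<close> to \<open>Suc k\<close> changes,
  between 1 and -1, which shifts all later levels by 2.\<close>

lemma refold_swappable:
  assumes "adm J" "a \<in> \<Delta>" "swappable J a k b"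
  shows "adm (refold a k J)" "swappable (refold a k J) a k (\<not> b)"
    "j \<le> length (walls J a) \<Longrightarrow>
      lv (refold a k J) a j = lv J a j + (if k < j then (if b then - 2 else 2) else 0)"
proof -
  let ?n = "length (walls J a)" and ?R = "refold a k J" and ?w = "walls J a ! k" and ?w' = "walls J a ! Suc k"
  have k: "k < ?n" using assms(3) by (simp add: swappable_def)
  note J = adm_finite[OF assms(1)] adm_subset[OF assms(1)]
  note basic = refold_basic[OF J assms(2) k]
  note pp = refold_pre_post[OF J assms(2) k]
  note mem = swappable_mem[OF assms]
  note W = prod_at_Int_weyl[OF J]
  have cov: "len D (prod_at (J \<inter> {..<j}) \<circ> \<sigma> (\<beta> j)) = len D (prod_at (J \<inter> {..<j})) + 1" if "j \<in> J" for j
    using assms(1) that by (simp add: adm_def)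
  have less: "Suc k < ?n \<Longrightarrow> ?w < ?w'" using walls_less_iff[of k J a "Suc k"] k by simp
  have "len D (prod_at (?R \<inter> {..<j}) \<circ> \<sigma> (\<beta> j)) = len D (prod_at (?R \<inter> {..<j})) + 1"
    if j: "j \<in> ?R" for j
  proof -
    note R = refold_prod[OF J assms(2) k, of "{..<j}"]
    consider "j < ?w" | "j = ?w" | "j > ?w" "Suc k < ?n" "?w' < j" | "Suc k < ?n" "j = ?w'"
      | "?w < j" "Suc k < ?n \<longrightarrow> j < ?w'"
      by (meson linorder_less_linear)
    then show ?thesis
    proof cases
      case 1
      then have "j \<in> J" using j refold_mem[OF k, of j] less by (auto split: if_splits)
      then show ?thesis using R(1) 1 cov by simp
    next
      case 2
      then have b: "b" using j refold_mem[OF k, of j] mem by auto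
      have "prod_at (J \<inter> {..<j}) \<circ> \<sigma> (\<beta> j) = \<sigma> a \<circ> prod_at (J \<inter> {..<j})"
        using prod_at_conj[OF J walls_simple_wall[OF J k]] 2 by simp
      moreover have "ascends a (prod_at (J \<inter> {..<j}))"
        using assms(3) k 2 by (simp add: swappable_def pre_def stage_def)
      ultimately show ?thesis using R(1) 2 len_left_refl(1)[OF W assms(2)] by simp
    next
      case 3
      then have "j \<in> J" using j refold_mem[OF k, of j] by (auto split: if_splits)
      then show ?thesis using R(4) 3 cov by simp
    next
      case 4
      then have b: "\<not> b" using j refold_mem[OF k, of j] mem less by auto
      have c: "stage J a (Suc k) = {..<j}" using 4 by (simp add: stage_def)
      have R2: "prod_at (?R \<inter> {..<j}) = \<sigma> a \<circ> prod_at (J \<inter> {..<j})"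
        using R(2) 4 less c by simp
      have "prod_at (J \<inter> {..<j}) \<circ> \<sigma> (\<beta> j) = \<sigma> a \<circ> prod_at (J \<inter> {..<j})"
        using prod_at_conj[OF J walls_simple_wall[OF J 4(1)]] 4 by simp
      then have "prod_at (?R \<inter> {..<j}) \<circ> \<sigma> (\<beta> j) = prod_at (J \<inter> {..<j})"
        unfolding R2 comp_assoc using refl_comp_refl[OF assms(2)] by simp
      moreover have "\<not> ascends a (prod_at (J \<inter> {..<j}))"
        using assms(3) b c by (simp add: swappable_def pre_def)
      ultimately show ?thesis using len_left_refl(2)[OF W assms(2)] R2 by simp
    next
      case 5
      then have jJ: "j \<in> J" using j refold_mem[OF k, of j] by (auto split: if_splits)
      have c: "{..j} \<subseteq> stage J a (Suc k)" using 5 by (auto simp: stage_def)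
      then have c': "{..<j} \<subseteq> stage J a (Suc k)" by auto
      have R2: "prod_at (?R \<inter> {..<j}) = \<sigma> a \<circ> prod_at (J \<inter> {..<j})"
        using R(2) 5 c' by simp
      have up: "prod_at (J \<inter> {..j}) = prod_at (J \<inter> {..<j}) \<circ> \<sigma> (\<beta> j)"
        using prod_at_atMost[OF J(1) jJ] .
      have c'': "{..?w} \<subseteq> {..<j}" using 5 by auto
      \<comment> \<open>The ascent just after wall \<open>k\<close> persists forwards through the
        segment.\<close>
      have lo: "ascends a (prod_at (J \<inter> {..<j}))" "ascends a (prod_at (J \<inter> {..j}))" if b
        using between_mono[OF assms(1,2) k, of "{..?w}" "{..<j}"]
          between_mono[OF assms(1,2) k, of "{..?w}" "{..j}"] 5 less_imp_le[OF 5(1)] c c' c'' assms(3) that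
        by (auto simp: swappable_def post_def)
      \<comment> \<open>By contraposition the descent at the end of the segment persists backwards:
        an ascent inside would survive up to that end.\<close>
      have hi: "\<not> ascends a (prod_at (J \<inter> {..<j}))" "\<not> ascends a (prod_at (J \<inter> {..j}))" if "\<not> b"
        using between_mono[OF assms(1,2) k, of "{..<j}" "stage J a (Suc k)"]
          between_mono[OF assms(1,2) k, of "{..j}" "stage J a (Suc k)"] 5 less_imp_le[OF 5(1)] c c' c'' assms(3) that
        by (auto simp: swappable_def pre_def)
      have "len D (\<sigma> a \<circ> prod_at (J \<inter> {..j})) = len D (\<sigma> a \<circ> prod_at (J \<inter> {..<j})) + 1"
      proof (cases b)
        case True
        then show ?thesis
          using len_left_refl(1)[OF W assms(2)] lo cov[OF jJ] up by metis
      next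
        case False
        then show ?thesis
          using len_left_refl(2)[OF W assms(2), of "{..j}"] len_left_refl(2)[OF W assms(2), of "{..<j}"]
            hi cov[OF jJ] up by simp
      qed
      then show ?thesis unfolding R2 up comp_assoc .
    qed
  qed
  then show adm': "adm ?R" using basic by (simp add: adm_def)
  show "swappable ?R a k (\<not> b)"
    using assms(3) pp(1)[of k] pp(1)[of "Suc k"] pp(2)[of k] pp(2)[of "Suc k"] k
    unfolding swappable_def basic(4) by auto
  show "lv ?R a j = lv J a j + (if k < j then (if b then - 2 else 2) else 0)" if "j \<le> ?n"
    using that
  proof (induction j)
    case 0
    then show ?case using lv_0[OF assms(1,2)] lv_0[OF adm' assms(2)] by simp
  next
    case (Suc j)
    have "lv ?R a (Suc j) = lv ?R a j + (if post ?R a j then 1 else if pre ?R a (Suc j) then 0 else - 1)"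
      using lv_Suc[OF adm' assms(2), of j] Suc.prems basic(4) by simp
    moreover have "lv J a (Suc j) = lv J a j + (if post J a j then 1 else if pre J a (Suc j) then 0 else - 1)"
      using lv_Suc[OF assms(1,2), of j] Suc.prems by simp
    ultimately show ?case
      using Suc pp(1)[of "Suc j"] pp(2)[of j] assms(3) unfolding swappable_def
      by (cases j k rule: linorder_cases) auto
  qed
qed

section \<open>Root operators and string reversal\<close>

abbreviation wt :: "'i set \<Rightarrow> 'v" where "wt J \<equiv> weight D lam I \<beta> J"

text \<open>The range includes the end of the gallery; \<open>max_level_eq\<close> identifies the
  value with \<open>max_level\<close>.\<close>

definition peak :: "'i set \<Rightarrow> 'v \<Rightarrow> int" where
  "peak J a = Max (lv J a ` {..length (walls J a)})"

definition final :: "'i set \<Rightarrow> 'v \<Rightarrow> int" where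
  "final J a = lev J UNIV a"

lemma lv_last: "lv J a (length (walls J a)) = final J a"
  by (simp add: lv_def stage_def final_def)

lemma final_eq: "finite J \<Longrightarrow> J \<subseteq> I \<Longrightarrow> a \<in> \<Delta> \<Longrightarrow> real_of_int (final J a) = pairing D (wt J) a"
  by (simp add: final_def lev_UNIV)

lemma lv_le_peak: "j \<le> length (walls J a) \<Longrightarrow> lv J a j \<le> peak J a"
  unfolding peak_def by (rule Max_ge) auto

lemma final_le_peak: "final J a \<le> peak J a"
  using lv_le_peak[of "length (walls J a)" J a] by (simp add: lv_last)

lemma peak_attained: "\<exists>j\<le>length (walls J a). lv J a j = peak J a"
proof -
  have "peak J a \<in> lv J a ` {..length (walls J a)}" unfolding peak_def by (rule Max_in) auto
  then show ?thesis by auto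
qed

lemma peak_eqI:
  "j \<le> length (walls J a) \<Longrightarrow> lv J a j = t \<Longrightarrow> (\<And>i. i \<le> length (walls J a) \<Longrightarrow> lv J a i \<le> t) \<Longrightarrow> peak J a = t"
  unfolding peak_def by (rule Max_eqI) auto

lemma peak_nonneg: "adm J \<Longrightarrow> a \<in> \<Delta> \<Longrightarrow> peak J a \<ge> 0"
  using lv_le_peak[of 0 J a] lv_0 by simp

definition first_peak :: "'i set \<Rightarrow> 'v \<Rightarrow> nat" where
  "first_peak J a = (LEAST j. j \<le> length (walls J a) \<and> lv J a j = peak J a)"

definition last_peak :: "'i set \<Rightarrow> 'v \<Rightarrow> nat" where
  "last_peak J a = (GREATEST j. j \<le> length (walls J a) \<and> lv J a j = peak J a)"

text \<open>The root operators \<open>F\<^sub>p\<close> and \<open>E\<^sub>p\<close> of the paper, for \<open>a\<close> the \<open>p\<close>-th simple root.\<close>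

definition lower :: "'v \<Rightarrow> 'i set \<Rightarrow> 'i set" where
  "lower a J = refold a (first_peak J a - 1) J"

definition raise :: "'v \<Rightarrow> 'i set \<Rightarrow> 'i set" where
  "raise a J = refold a (last_peak J a) J"

text \<open>The path starts at level 0, so a positive maximum has a step before it. At the first
  maximum this step is a rise, so wall \<open>k\<close> is crossed upwards; rising again after the
  maximum would exceed it.\<close>

lemma first_peak:
  assumes J: "adm J" and a: "a \<in> \<Delta>" and pos: "peak J a > 0"
  shows "\<exists>k. first_peak J a = Suc k \<and> swappable J a k True \<and> lv J a (Suc k) = peak J a \<and>
    lv J a k = peak J a - 1 \<and> (\<forall>j\<le>k. lv J a j < peak J a)"
proof -
  let ?n = "length (walls J a)"
  have m: "first_peak J a \<le> ?n" "lv J a (first_peak J a) = peak J a"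
    using LeastI_ex[OF peak_attained, of J a] unfolding first_peak_def by auto
  have less: "lv J a j < peak J a" if "j < first_peak J a" for j
    using not_less_Least[OF that[unfolded first_peak_def]] lv_le_peak[of j J a] that m by auto
  have "first_peak J a \<noteq> 0" using m lv_0[OF J a] pos by (metis less_irrefl)
  then obtain k where k: "first_peak J a = Suc k" by (cases "first_peak J a") auto
  then have kn: "k < ?n" using m by simp
  have lt: "lv J a k < lv J a (Suc k)" using less[of k] k m by simp
  have post: "post J a k" using lt lv_Suc[OF J a kn] by (auto split: if_splits)
  have pre: "pre J a k" using wall_mem(2)[OF J a kn] wall_notmem[OF J a kn] post by blast
  have "\<not> post J a (Suc k)" if "Suc k < ?n"
    using lv_Suc[OF J a that] lv_le_peak[of "Suc (Suc k)" J a] that m k by (auto split: if_splits)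
  then have "swappable J a k True"
    using kn pre post post_imp_pre[OF J a kn post] by (simp add: swappable_def)
  moreover have "lv J a k = peak J a - 1" using post lv_Suc[OF J a kn] m k by simp
  ultimately show ?thesis using k m less by (auto simp: less_Suc_eq_le)
qed

lemma last_peak:
  assumes J: "adm J" and a: "a \<in> \<Delta>" and less: "final J a < peak J a"
  shows "swappable J a (last_peak J a) False" "lv J a (last_peak J a) = peak J a"
    "lv J a (Suc (last_peak J a)) = peak J a - 1"
    "\<And>j. last_peak J a < j \<Longrightarrow> j \<le> length (walls J a) \<Longrightarrow> lv J a j < peak J a"
proof -
  let ?n = "length (walls J a)" and ?k = "last_peak J a"
  have m: "?k \<le> ?n" "lv J a ?k = peak J a"
    using GreatestI_ex_nat[of "\<lambda>j. j \<le> ?n \<and> lv J a j = peak J a" ?n] peak_attained[of J a]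
    unfolding last_peak_def by auto
  have after: "lv J a j < peak J a" if "?k < j" "j \<le> ?n" for j
    using Greatest_le_nat[of "\<lambda>j. j \<le> ?n \<and> lv J a j = peak J a" j ?n] lv_le_peak[of j J a] that
    unfolding last_peak_def by force
  have "?k \<noteq> ?n" using m less lv_last[of J a] by auto
  then have kn: "?k < ?n" using m by simp
  have "lv J a (Suc ?k) < lv J a ?k" using after[of "Suc ?k"] kn m by simp
  then have np: "\<not> post J a ?k" "\<not> pre J a (Suc ?k)"
    and eq: "lv J a (Suc ?k) = lv J a ?k - 1"
    using lv_Suc[OF J a kn] by (auto split: if_splits)
  \<comment> \<open>A path falling into the peak would come from a level above it.\<close>
  have pre: "pre J a ?k"
  proof (rule ccontr)
    assume neg: "\<not> pre J a ?k"
    then obtain i where i: "?k = Suc i" using pre_0[OF J a] by (cases ?k) auto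
    then have "\<not> post J a i" using post_imp_pre[OF J a, of i] neg kn by auto
    then show False using lv_Suc[OF J a, of i] neg i kn m lv_le_peak[of i J a] by auto
  qed
  have "\<not> post J a (Suc ?k)" if "Suc ?k < ?n"
    using wall_mem(1)[OF J a that] wall_notmem[OF J a that] np by blast
  then have "swappable J a ?k False" using kn pre np by (simp add: swappable_def)
  then show "swappable J a ?k False" "lv J a ?k = peak J a" "lv J a (Suc ?k) = peak J a - 1"
    "\<And>j. ?k < j \<Longrightarrow> j \<le> ?n \<Longrightarrow> lv J a j < peak J a"
    using m eq after by auto
qed

lemma swappable_weight:
  assumes "adm J" "a \<in> \<Delta>" "swappable J a k b"
  shows "wt (refold a k J) = wt J - (if b then 1 else - 1) *\<^sub>R a"
proof -
  have k: "k < length (walls J a)" using assms(3) by (simp add: swappable_def)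
  have "lv J a k - lv J a (Suc k) = (if b then - 1 else 1)"
    using lv_Suc[OF assms(1,2) k] assms(3) by (auto simp: swappable_def)
  then show ?thesis
    using weight_refold[OF adm_finite[OF assms(1)] adm_subset[OF assms(1)] assms(2) k] by simp
qed

lemma swappable_walls:
  assumes "adm J" "a \<in> \<Delta>" "swappable J a k b"
  shows "walls (refold a k J) a = walls J a" "refold a k (refold a k J) = J"
  using refold_basic[OF adm_finite[OF assms(1)] adm_subset[OF assms(1)] assms(2)] assms(3)
  by (simp_all add: swappable_def)

text \<open>Levels beyond wall \<open>k\<close> drop by 2, and those up to \<open>k\<close> are at
  most \<open>peak J a - 1\<close>, the value attained at \<open>k\<close>. The new maximum is
  therefore reached at \<open>k\<close> for the last time, which is where \<open>raise\<close>
  acts.\<close>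

lemma lower:
  assumes J: "adm J" and a: "a \<in> \<Delta>" and pos: "peak J a > 0"
  shows "adm (lower a J)" "wt (lower a J) = wt J - a" "peak (lower a J) a = peak J a - 1"
    "final (lower a J) a = final J a - 2" "raise a (lower a J) = J"
proof -
  obtain k where k: "first_peak J a = Suc k" "swappable J a k True" "lv J a (Suc k) = peak J a"
    "lv J a k = peak J a - 1" "\<forall>j\<le>k. lv J a j < peak J a"
    using first_peak[OF assms] by blast
  have L: "lower a J = refold a k J" by (simp add: lower_def k)
  let ?n = "length (walls J a)"
  have kn: "k < ?n" using k by (simp add: swappable_def)
  note R = refold_swappable[OF J a k(2)] and W = swappable_walls[OF J a k(2)]
  show "adm (lower a J)" "wt (lower a J) = wt J - a"
    using R(1) swappable_weight[OF J a k(2)] by (simp_all add: L)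
  have lv': "lv (lower a J) a j = lv J a j + (if k < j then - 2 else 0)" if "j \<le> ?n" for j
    using R(3)[OF that] by (simp add: L)
  have len: "length (walls (lower a J) a) = ?n" using W by (simp add: L)
  show peak: "peak (lower a J) a = peak J a - 1"
  proof (rule peak_eqI[of k])
    fix i assume "i \<le> length (walls (lower a J) a)"
    then show "lv (lower a J) a i \<le> peak J a - 1"
      using lv'[of i] k(5)[rule_format, of i] lv_le_peak[of i J a] len by force
  qed (use kn lv'[of k] len k in simp_all)
  show "final (lower a J) a = final J a - 2"
    using lv'[of ?n] kn lv_last[of J a] lv_last[of "lower a J" a] len by simp
  have "last_peak (lower a J) a = k"
    unfolding last_peak_def
  proof (rule Greatest_equality)
    fix j assume j: "j \<le> length (walls (lower a J) a) \<and> lv (lower a J) a j = peak (lower a J) a"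
    then show "j \<le> k" using lv'[of j] lv_le_peak[of j J a] len peak by (force split: if_splits)
  qed (use kn lv'[of k] len k peak in simp)
  then show "raise a (lower a J) = J" using W(2) by (simp add: raise_def L)
qed

text \<open>Levels beyond the last peak \<open>k\<close> are at most \<open>peak J a - 1\<close> and
  increase by 2, so the new maximum is first reached at \<open>Suc k\<close>, which is where
  \<open>lower\<close> acts.\<close>

lemma raise:
  assumes J: "adm J" and a: "a \<in> \<Delta>" and less: "final J a < peak J a"
  shows "adm (raise a J)" "wt (raise a J) = wt J + a" "peak (raise a J) a = peak J a + 1"
    "final (raise a J) a = final J a + 2" "lower a (raise a J) = J"
proof -
  define k where "k = last_peak J a"
  note k = last_peak[OF assms, folded k_def]
  have L: "raise a J = refold a k J" by (simp add: raise_def k_def)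
  let ?n = "length (walls J a)"
  have kn: "k < ?n" using k by (simp add: swappable_def)
  note R = refold_swappable[OF J a k(1)] and W = swappable_walls[OF J a k(1)]
  show "adm (raise a J)" "wt (raise a J) = wt J + a"
    using R(1) swappable_weight[OF J a k(1)] by (simp_all add: L)
  have lv': "lv (raise a J) a j = lv J a j + (if k < j then 2 else 0)" if "j \<le> ?n" for j
    using R(3)[OF that] by (simp add: L)
  have len: "length (walls (raise a J) a) = ?n" using W by (simp add: L)
  show peak: "peak (raise a J) a = peak J a + 1"
  proof (rule peak_eqI[of "Suc k"])
    fix i assume "i \<le> length (walls (raise a J) a)"
    then show "lv (raise a J) a i \<le> peak J a + 1"
      using lv'[of i] k(4)[of i] lv_le_peak[of i J a] len by force
  qed (use kn lv'[of "Suc k"] len k in simp_all)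
  show "final (raise a J) a = final J a + 2"
    using lv'[of ?n] kn lv_last[of J a] lv_last[of "raise a J" a] len by simp
  have "first_peak (raise a J) a = Suc k"
    unfolding first_peak_def
  proof (rule Least_equality)
    fix j assume j: "j \<le> length (walls (raise a J) a) \<and> lv (raise a J) a j = peak (raise a J) a"
    then show "Suc k \<le> j" using lv'[of j] lv_le_peak[of j J a] len peak by (force split: if_splits)
  qed (use kn lv'[of "Suc k"] len k peak in simp)
  then show "lower a (raise a J) = J" using W(2) by (simp add: lower_def L)
qed

lemma lower_pow:
  assumes "adm J" "a \<in> \<Delta>" "int t \<le> peak J a"
  shows "adm ((lower a ^^ t) J) \<and> wt ((lower a ^^ t) J) = wt J - real t *\<^sub>R a \<and>
    peak ((lower a ^^ t) J) a = peak J a - int t \<and> final ((lower a ^^ t) J) a = final J a - 2 * int t \<and>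
    (raise a ^^ t) ((lower a ^^ t) J) = J"
  using assms(3)
proof (induction t)
  case (Suc t)
  let ?K = "(lower a ^^ t) J"
  have IH: "adm ?K" "wt ?K = wt J - real t *\<^sub>R a" "peak ?K a = peak J a - int t"
    "final ?K a = final J a - 2 * int t" "(raise a ^^ t) ?K = J" using Suc by auto
  then have pos: "peak ?K a > 0" using Suc.prems by simp
  note L = lower[OF IH(1) assms(2) pos]
  have "(raise a ^^ Suc t) ((lower a ^^ Suc t) J) = (raise a ^^ t) (raise a (lower a ?K))"
    by (subst funpow_Suc_right) simp
  then show ?case using L IH by (simp add: algebra_simps)
qed (use assms(1) in simp)

lemma raise_pow:
  assumes "adm J" "a \<in> \<Delta>" "int t \<le> peak J a - final J a"
  shows "adm ((raise a ^^ t) J) \<and> wt ((raise a ^^ t) J) = wt J + real t *\<^sub>R a \<and>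
    peak ((raise a ^^ t) J) a = peak J a + int t \<and> final ((raise a ^^ t) J) a = final J a + 2 * int t \<and>
    (lower a ^^ t) ((raise a ^^ t) J) = J"
  using assms(3)
proof (induction t)
  case (Suc t)
  let ?K = "(raise a ^^ t) J"
  have IH: "adm ?K" "wt ?K = wt J + real t *\<^sub>R a" "peak ?K a = peak J a + int t"
    "final ?K a = final J a + 2 * int t" "(lower a ^^ t) ?K = J" using Suc by auto
  then have pos: "final ?K a < peak ?K a" using Suc.prems by simp
  note L = raise[OF IH(1) assms(2) pos]
  have "(lower a ^^ Suc t) ((raise a ^^ Suc t) J) = (lower a ^^ t) (lower a (raise a ?K))"
    by (subst funpow_Suc_right) simp
  then show ?case using L IH by (simp add: algebra_simps)
qed (use assms(1) in simp)

text \<open>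
  For \<open>c = 0\<close> this reverses the \<open>a\<close>-strings; for \<open>c = 1\<close> it reverses the \<open>a\<close>-strings with their
  top elements removed.
\<close>

definition reflect :: "int \<Rightarrow> 'v \<Rightarrow> 'i set \<Rightarrow> 'i set" where
  "reflect c a J = (if final J a + c \<ge> 0 then (lower a ^^ nat (final J a + c)) J
     else (raise a ^^ nat (- (final J a + c))) J)"

text \<open>With \<open>d = final J a + c\<close> the string is traversed by \<open>d\<close> steps,
  after which \<open>final + c\<close> equals \<open>- d\<close> and the peak has dropped by
  \<open>d\<close>. Hence a second application moves back, and the bound persists because the old
  peak is nonnegative.\<close>

lemma reflect:
  assumes J: "adm J" and a: "a \<in> \<Delta>" and c: "c \<ge> 0" "final J a + c \<le> peak J a"
  shows "adm (reflect c a J)" "wt (reflect c a J) = wt J - of_int (final J a + c) *\<^sub>R a"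
    "final (reflect c a J) a + c \<le> peak (reflect c a J) a" "reflect c a (reflect c a J) = J"
proof -
  define d where "d = final J a + c"
  have "adm (reflect c a J) \<and> wt (reflect c a J) = wt J - of_int d *\<^sub>R a \<and>
      peak (reflect c a J) a = peak J a - d \<and> final (reflect c a J) a = final J a - 2 * d \<and>
      (if d \<ge> 0 then (raise a ^^ nat d) (reflect c a J) else (lower a ^^ nat (- d)) (reflect c a J)) = J"
  proof (cases "d \<ge> 0")
    case True
    then show ?thesis using lower_pow[OF J a, of "nat d"] c by (simp add: reflect_def d_def)
  next
    case False
    then show ?thesis using raise_pow[OF J a, of "nat (- d)"] peak_nonneg[OF J a] c
      by (simp add: reflect_def d_def flip: scaleR_minus_left)
  qed
  then have R: "adm (reflect c a J)" "wt (reflect c a J) = wt J - of_int d *\<^sub>R a"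
    "peak (reflect c a J) a = peak J a - d" "final (reflect c a J) a = final J a - 2 * d"
    "(if d \<ge> 0 then (raise a ^^ nat d) (reflect c a J) else (lower a ^^ nat (- d)) (reflect c a J)) = J"
    by blast+
  show "adm (reflect c a J)" "wt (reflect c a J) = wt J - of_int (final J a + c) *\<^sub>R a"
    using R by (simp_all add: d_def)
  show "final (reflect c a J) a + c \<le> peak (reflect c a J) a" using R c peak_nonneg[OF J a] by (simp add: d_def)
  have d': "final (reflect c a J) a + c = - d" using R by (simp add: d_def)
  show "reflect c a (reflect c a J) = J"
    using R(5) unfolding reflect_def[of c a "reflect c a J"] d'
    by (cases "d = 0") (auto split: if_splits)
qed

section \<open>Highest elements and finiteness\<close>

lemma weight_diff_Qpos:
  assumes "adm J" shows "lam - wt J \<in> Qpos \<Delta>"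
proof -
  have "finite J" "J \<subseteq> I" "\<forall>j\<in>J. root_at J j \<in> pos_roots D"
    using assms adm_finite adm_subset adm_root_at_pos by blast+
  then show ?thesis
  proof (induction J rule: finite_linorder_max_induct)
    case empty
    then show ?case by (simp add: weight_eq affine_prod_def Qpos_zero)
  next
    case (insert j J)
    let ?J = "insert j J"
    have j: "j \<in> I" and J: "J \<subseteq> I" using insert.prems by auto
    have "?J \<inter> {..<i} = J \<inter> {..<i}" if "i \<in> J" for i
      using insert.hyps that by (auto dest: order_less_trans)
    then have "root_at ?J i = root_at J i" if "i \<in> J" for i using that by (simp add: root_at_def)
    then have IH: "lam - wt J \<in> Qpos \<Delta>" using insert by auto
    have "?J \<inter> {..<j} = J" using insert.hyps by auto
    then have pos: "prod_at J (\<beta> j) \<in> pos_roots D" using insert.prems by (simp add: root_at_def)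
    have lin: "linear (prod_at J)"
      using weyl_isometry[OF prod_at_weyl[OF insert.hyps(1) J]] by (simp add: isometry_def)
    \<comment> \<open>The last fold lowers the weight by \<open>c\<close> times a positive root.
      That \<open>c\<close> is nonnegative follows since \<open>level0\<close> counts only the
      occurrences of \<open>\<beta> j\<close> before \<open>j\<close>.\<close>
    define c where "c = pairing D lam (\<beta> j) - real_of_int (level0 I \<beta> j)"
    have "wt ?J = affine_prod J (affine_refl D (\<beta> j) (level0 I \<beta> j) lam)"
      unfolding weight_eq affine_prod_def using insert.hyps by (simp add: ordprod_insert_max)
    also have "affine_refl D (\<beta> j) (level0 I \<beta> j) lam = lam - c *\<^sub>R \<beta> j"
      by (simp add: affine_refl_def root_refl_def c_def algebra_simps)
    also have "affine_prod J \<dots> = wt J - c *\<^sub>R prod_at J (\<beta> j)"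
      using affine_prod_alt[OF insert.hyps(1) J, of "lam - c *\<^sub>R \<beta> j"]
        affine_prod_alt[OF insert.hyps(1) J, of lam]
      by (simp add: weight_eq linear_diff[OF lin] linear_scale[OF lin])
    finally have eq: "lam - wt ?J = (lam - wt J) + c *\<^sub>R prod_at J (\<beta> j)" by simp
    have "card {i \<in> I. i < j \<and> \<beta> i = \<beta> j} \<le> card {i \<in> I. \<beta> i = \<beta> j}"
      by (rule card_mono[OF chain_finite]) auto
    then have "c \<ge> 0" "c \<in> \<int>"
      using chain_card[OF chain_pos[OF j], symmetric] by (simp_all add: c_def level0_def)
    then show ?case
      unfolding eq using IH pos by (intro Qpos_add Qpos_scale) (auto simp: pos_root_iff)
  qed
qed

lemma adm_empty: "adm {}"
  by (simp add: adm_def)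

lemma weight_empty: "wt {} = lam"
  by (simp add: weight_eq affine_prod_def)

lemma nontrivial_descends:
  assumes "w \<in> \<W>" "w \<noteq> id" obtains a where "a \<in> \<Delta>" "\<not> ascends a w"
proof -
  have "inv w \<noteq> id"
    using assms(2) weyl_inv_apply(2)[OF assms(1)] by (metis eq_id_iff)
  then obtain q where q: "q \<in> \<Delta>" "wlen \<Delta> (inv w \<circ> \<sigma> q) < wlen \<Delta> (inv w)"
    using wlen_last[OF weyl_inv[OF assms(1)]] by blast
  then have "- inv w q \<in> Qpos \<Delta>" using pos_or_neg[OF subset_refl weyl_inv[OF assms(1)] q(1)] by auto
  moreover have "inv w q \<noteq> 0"
    using isometry_nonzero[OF weyl_isometry[OF weyl_inv[OF assms(1)]] q(1)] .
  ultimately have "\<not> ascends q w" using Qpos_antisym by (auto simp: ascends_def pos_root_iff)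
  then show ?thesis using that q by blast
qed

text \<open>The last cover shows that the product is not the identity, so it has a left descent
  \<open>a\<close>. The path of \<open>a\<close> then falls at its end, and the level one wall
  earlier exceeds the endpoint.\<close>

lemma nonempty_not_highest:
  assumes "adm J" "J \<noteq> {}" obtains a where "a \<in> \<Delta>" "final J a < peak J a"
proof -
  note J = adm_finite[OF assms(1)] adm_subset[OF assms(1)]
  have j: "Max J \<in> J" using Max_in J assms by blast
  have "J \<inter> {..Max J} = J" using Max_ge[OF J(1)] by auto
  then have "len D (prod_at J) = len D (prod_at (J \<inter> {..<Max J})) + 1"
    using assms(1) j prod_at_atMost[OF J(1) j] by (simp add: adm_def)
  moreover have "len D id = 0" by (simp add: len_eq_wlen wlen_id)
  ultimately have "prod_at J \<noteq> id" by (metis add_is_0 zero_neq_one)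
  then obtain a where a: "a \<in> \<Delta>" "\<not> ascends a (prod_at J)"
    using nontrivial_descends prod_at_weyl[OF J] by blast
  let ?n = "length (walls J a)"
  have np: "\<not> pre J a ?n" using a by (simp add: pre_def stage_def)
  then obtain i where i: "?n = Suc i" using pre_0[OF assms(1) a(1)] by (cases ?n) auto
  then have "\<not> post J a i" using post_imp_pre[OF assms(1) a(1), of i] np by auto
  then have "lv J a ?n < lv J a i" using lv_Suc[OF assms(1) a(1), of i] np i by simp
  then have "final J a < peak J a" using lv_le_peak[of i J a] i lv_last[of J a] by simp
  then show ?thesis using that a by blast
qed

lemma simple_nonzero: "a \<in> \<Delta> \<Longrightarrow> a \<noteq> 0"
  using simple_nonisotropic[of a] by (auto simp: form_bilinear)

text \<open>Otherwise raising would give an admissible set of weight \<open>lam + a\<close>,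
  although all weights lie below \<open>lam\<close>.\<close>

lemma empty_highest:
  assumes "a \<in> \<Delta>" shows "final {} a = peak {} a"
proof (rule ccontr)
  assume "final {} a \<noteq> peak {} a"
  then have less: "final {} a < peak {} a" using final_le_peak[of "{}" a] by simp
  have "lam - wt (raise a {}) \<in> Qpos \<Delta>" using weight_diff_Qpos raise(1)[OF adm_empty assms less] .
  then have "- a \<in> Qpos \<Delta>" by (simp add: raise(2)[OF adm_empty assms less] weight_empty)
  then show False using Qpos_antisym[of a \<Delta>] Qpos_simple assms simple_nonzero by blast
qed

text \<open>Every nonempty admissible set is \<open>lower a\<close> of one whose weight is higher by
  \<open>a\<close>, and there are finitely many simple \<open>a\<close>; so \<open>n\<close> bounds
  the number of steps down from the empty set.\<close>

lemma finite_adm_height: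
  "finite {J. adm J \<and> height D (lam - wt J) \<le> real n}"
proof (induction n)
  case 0
  have "J = {}" if J: "adm J" "height D (lam - wt J) \<le> 0" for J
  proof (rule ccontr)
    assume "J \<noteq> {}"
    then obtain a where a: "a \<in> \<Delta>" "final J a < peak J a" using nonempty_not_highest[OF J(1)] by blast
    have "height D (lam - wt (raise a J)) \<ge> 0"
      using height_Qpos(1)[OF subset_refl weight_diff_Qpos[OF raise(1)[OF J(1) a]]] .
    then show False using J(2) by (simp add: raise(2)[OF J(1) a] height_simps height_simple[OF a(1)])
  qed
  then have "{J. adm J \<and> height D (lam - wt J) \<le> real 0} \<subseteq> {{}}" by auto
  then show ?case by (rule finite_subset) simp
next
  case (Suc n)
  let ?X = "\<lambda>n. {J. adm J \<and> height D (lam - wt J) \<le> real n}"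
  have "?X (Suc n) \<subseteq> insert {} (\<Union>a\<in>\<Delta>. lower a ` ?X n)"
  proof
    fix J assume "J \<in> ?X (Suc n)"
    then have J: "adm J" "height D (lam - wt J) \<le> real (Suc n)" by auto
    show "J \<in> insert {} (\<Union>a\<in>\<Delta>. lower a ` ?X n)"
    proof (cases "J = {}")
      case False
      then obtain a where a: "a \<in> \<Delta>" "final J a < peak J a" using nonempty_not_highest[OF J(1)] by blast
      have "raise a J \<in> ?X n"
        using raise(1,2)[OF J(1) a] J(2) by (simp add: height_simps height_simple[OF a(1)])
      then show ?thesis using raise(5)[OF J(1) a] a by (force intro: rev_image_eqI)
    qed simp
  qed
  moreover have "finite (insert {} (\<Union>a\<in>\<Delta>. lower a ` ?X n))" 
    using Suc finite_simples by (simp add: indices_def)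
  ultimately show ?case by (rule finite_subset)
qed

lemma finite_adm: "finite {J. adm J \<and> height D (wt J) \<ge> h}"
proof -
  have "{J. adm J \<and> height D (wt J) \<ge> h} \<subseteq>
      {J. adm J \<and> height D (lam - wt J) \<le> real (nat \<lceil>height D lam - h\<rceil>)}"
    by (auto simp: height_simps) linarith
  then show ?thesis using finite_adm_height by (rule finite_subset)
qed

section \<open>Cancellation of the sets with a wall above the endpoint\<close>

definition bad :: "'v set \<Rightarrow> 'i set \<Rightarrow> 'i set" where
  "bad S J = {i. \<exists>c\<in>S. simple_wall J c i \<and> final J c < lev J {..<i} c}"

lemma finite_bad:
  assumes "adm J" "S \<subseteq> \<Delta>" shows "finite (bad S J)"
proof -
  have "bad S J \<subseteq> (\<Union>c\<in>S. {i \<in> I. root_at J i = c \<or> root_at J i = - c})"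
    by (auto simp: bad_def simple_wall_def)
  moreover have "finite \<dots>"
    using finite_sub[OF assms(2)] finite_root_at adm_finite adm_subset assms(1) by simp
  ultimately show ?thesis by (rule finite_subset)
qed

lemma final_less_peak_iff:
  assumes "adm J" "c \<in> \<Delta>"
  shows "final J c < peak J c \<longleftrightarrow> (\<exists>i. simple_wall J c i \<and> final J c < lev J {..<i} c)"
proof
  note J = adm_finite[OF assms(1)] adm_subset[OF assms(1)]
  assume less: "final J c < peak J c"
  obtain j where j: "j \<le> length (walls J c)" "lv J c j = peak J c" using peak_attained by blast
  then have "j < length (walls J c)" using less lv_last[of J c] by (cases "j = length (walls J c)") auto
  then show "\<exists>i. simple_wall J c i \<and> final J c < lev J {..<i} c"
    using j less walls_simple_wall[OF J] by (intro exI[of _ "walls J c ! j"]) (auto simp: lv_def stage_def)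
next
  note J = adm_finite[OF assms(1)] adm_subset[OF assms(1)]
  assume "\<exists>i. simple_wall J c i \<and> final J c < lev J {..<i} c"
  then obtain k where "k < length (walls J c)" "final J c < lev J {..<walls J c ! k} c"
    using simple_wall_nth[OF J] by metis
  then show "final J c < peak J c" using lv_le_peak[of k J c] by (simp add: lv_def stage_def)
qed

lemma bad_empty_iff:
  assumes "adm J" "S \<subseteq> \<Delta>" shows "bad S J = {} \<longleftrightarrow> (\<forall>c\<in>S. final J c = peak J c)"
proof -
  have "bad S J = {} \<longleftrightarrow> (\<forall>c\<in>S. \<not> (\<exists>i. simple_wall J c i \<and> final J c < lev J {..<i} c))"
    unfolding bad_def by blast
  also have "\<dots> \<longleftrightarrow> (\<forall>c\<in>S. \<not> final J c < peak J c)"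
    using final_less_peak_iff[OF assms(1)] assms(2) by blast
  also have "\<dots> \<longleftrightarrow> (\<forall>c\<in>S. final J c = peak J c)"
    using final_le_peak[of J] by (metis less_irrefl order_le_imp_less_or_eq)
  finally show ?thesis .
qed

lemma simple_wall_unique:
  assumes "a \<in> \<Delta>" "c \<in> \<Delta>" "simple_wall J a i" "simple_wall J c i" shows "a = c"
proof -
  have "a = c \<or> a = - c" using assms(3,4) by (auto simp: simple_wall_def)
  moreover have "a \<noteq> - c"
    using simple_pos_root assms(1,2) neg_root_iff[OF simple_root] by metis
  ultimately show ?thesis by blast
qed

text \<open>
  Lowering changes a folded gallery only up to its first wall of maximal level, and everything
  after that is translated as a whole.
\<close>

lemma lower_bad:
  assumes J: "adm J" and a: "a \<in> \<Delta>" and S: "S \<subseteq> \<Delta>" "a \<in> S"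
    and pos: "peak J a > 0" and less: "final J a < peak J a"
  shows "bad S (lower a J) \<noteq> {}" "Max (bad S (lower a J)) = Max (bad S J)"
    "c \<in> \<Delta> \<Longrightarrow> simple_wall (lower a J) c (Max (bad S J)) \<longleftrightarrow> simple_wall J c (Max (bad S J))"
proof -
  obtain k where k: "first_peak J a = Suc k" "swappable J a k True" "lv J a (Suc k) = peak J a"
    "lv J a k = peak J a - 1" "\<forall>j\<le>k. lv J a j < peak J a"
    using first_peak[OF J a pos] by blast
  let ?n = "length (walls J a)" and ?J = "lower a J"
  have L: "?J = refold a k J" by (simp add: lower_def k)
  have kn: "k < ?n" using k by (simp add: swappable_def)
  have "Suc k \<noteq> ?n" using k(3) less lv_last[of J a] by auto
  then have sk: "Suc k < ?n" using kn by simp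
  define w where "w = walls J a ! Suc k"
  note Jf = adm_finite[OF J] adm_subset[OF J]
  note low = lower[OF J a pos]
  note Jf' = adm_finite[OF low(1)] adm_subset[OF low(1)]
  have sw: "simple_wall J a w" unfolding w_def by (rule walls_simple_wall[OF Jf sk])
  have sw': "simple_wall ?J a = simple_wall J a"
    using refold_basic(3)[OF Jf a kn] by (simp add: L)
  have walls': "walls ?J a = walls J a" using swappable_walls[OF J a k(2)] by (simp add: L)
  \<comment> \<open>A cut containing the wall \<open>w\<close> of the first peak sees both toggles:
    the linear product is unchanged and the affine one is translated by \<open>- a\<close>.\<close>
  have P: "prod_at (?J \<inter> X) = prod_at (J \<inter> X)"
    "affine_prod (?J \<inter> X) 0 = affine_prod (J \<inter> X) 0 - a" if "down X" "w \<in> X" for X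
    using refold_prod(4,5)[OF Jf a kn that(1) sk] that(2) k(3,4)
      affine_refl_twice[OF a, of "lv J a k" "lv J a (Suc k)"] by (simp_all add: L w_def)
  \<comment> \<open>Levels and endpoint shift by the same amount, so violations beyond
    \<open>w\<close> are unaffected.\<close>
  have lev': "real_of_int (lev ?J X c) = lev J X c - pairing D a c" if "down X" "w \<in> X" "c \<in> \<Delta>" for X c
    using lev_eq[OF Jf' that(1,3)] lev_eq[OF Jf that(1,3)] P[OF that(1,2)] by (simp add: pairing_simps)
  have fin': "real_of_int (final ?J c) = final J c - pairing D a c" if "c \<in> \<Delta>" for c
    unfolding final_def using lev'[of UNIV c] that by simp
  have ra: "root_at ?J i = root_at J i" if "w < i" for i
    using P(1)[of "{..<i}"] that by (simp add: root_at_def)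
  have key: "simple_wall ?J c i \<longleftrightarrow> simple_wall J c i"
    "simple_wall J c i \<Longrightarrow> final ?J c < lev ?J {..<i} c \<longleftrightarrow> final J c < lev J {..<i} c"
    if "w \<le> i" "c \<in> \<Delta>" for c i
  proof -
    have "(simple_wall ?J c i \<longleftrightarrow> simple_wall J c i) \<and>
      (simple_wall J c i \<longrightarrow> (final ?J c < lev ?J {..<i} c \<longleftrightarrow> final J c < lev J {..<i} c))"
    proof (cases "w = i")
      \<comment> \<open>The cut before \<open>w\<close> omits \<open>w\<close>, so the translation
        argument does not apply. Only the path of \<open>a\<close> has a wall there, and its level
        and its endpoint both drop by 2.\<close>
      case True
      have c: "simple_wall J c i \<longleftrightarrow> c = a" "simple_wall ?J c i \<longleftrightarrow> c = a"
        using simple_wall_unique[OF a that(2)] sw sw' True by metis+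
      have "lev ?J {..<i} a = lv ?J a (Suc k)" "lev J {..<i} a = lv J a (Suc k)"
        using sk True walls' by (simp_all add: lv_def stage_def w_def)
      moreover have "lv ?J a (Suc k) = lv J a (Suc k) - 2"
        using refold_swappable(3)[OF J a k(2), of "Suc k"] sk by (simp add: L)
      ultimately show ?thesis using c low(4) by auto
    next
      case False
      then have "w < i" using that by simp
      moreover have "(final ?J c < lev ?J {..<i} c) \<longleftrightarrow> final J c < lev J {..<i} c"
        using lev'[of "{..<i}" c] fin'[OF that(2)] \<open>w < i\<close> that(2) by simp linarith
      ultimately show ?thesis using ra by (simp add: simple_wall_def)
    qed
    then show "simple_wall ?J c i \<longleftrightarrow> simple_wall J c i"
      "simple_wall J c i \<Longrightarrow> final ?J c < lev ?J {..<i} c \<longleftrightarrow> final J c < lev J {..<i} c" by blast+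
  qed
  have eq: "i \<in> bad S ?J \<longleftrightarrow> i \<in> bad S J" if "w \<le> i" for i
    unfolding bad_def using key[OF that] S(1) by blast
  \<comment> \<open>The first peak exceeds the endpoint, so \<open>w\<close> is bad; hence the last
    bad wall lies in the range where nothing changes.\<close>
  have "lev J {..<w} a = peak J a" using k(3) sk by (simp add: lv_def stage_def w_def)
  then have w: "w \<in> bad S J" "w \<in> bad S ?J"
    using eq[of w] sw S less by (auto simp: bad_def)
  note fb = finite_bad[OF J S(1)] finite_bad[OF low(1) S(1)]
  have wM: "w \<le> Max (bad S J)" using Max_ge[OF fb(1) w(1)] .
  show "bad S ?J \<noteq> {}" using w by blast
  show M: "Max (bad S ?J) = Max (bad S J)"
  proof (rule Max_eqI[OF fb(2)])
    show "Max (bad S J) \<in> bad S ?J" using eq[OF wM] Max_in[OF fb(1)] w by blast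
    show "i \<le> Max (bad S J)" if "i \<in> bad S ?J" for i
      using that eq[of i] Max_ge[OF fb(1), of i] wM by (cases "w \<le> i") auto
  qed
  show "c \<in> \<Delta> \<Longrightarrow> simple_wall ?J c (Max (bad S J)) \<longleftrightarrow> simple_wall J c (Max (bad S J))"
    using key(1)[OF wM] by blast
qed

lemma lower_pow_bad:
  assumes J: "adm J" and a: "a \<in> \<Delta>" and S: "S \<subseteq> \<Delta>" "a \<in> S"
    and t: "int t \<le> peak J a" and less: "final J a < peak J a" and ne: "bad S J \<noteq> {}"
  shows "bad S ((lower a ^^ t) J) \<noteq> {} \<and> Max (bad S ((lower a ^^ t) J)) = Max (bad S J) \<and>
    (\<forall>c\<in>\<Delta>. simple_wall ((lower a ^^ t) J) c (Max (bad S J)) \<longleftrightarrow> simple_wall J c (Max (bad S J)))"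
  using t
proof (induction t)
  case (Suc t)
  let ?K = "(lower a ^^ t) J"
  have K: "adm ?K" "peak ?K a > 0" "final ?K a < peak ?K a"
    using lower_pow[OF J a, of t] Suc.prems less by auto
  have IH: "Max (bad S ?K) = Max (bad S J)"
    "\<forall>c\<in>\<Delta>. simple_wall ?K c (Max (bad S J)) \<longleftrightarrow> simple_wall J c (Max (bad S J))"
    using Suc by auto
  show ?case using lower_bad[OF K(1) a S K(2,3)] IH by auto
qed (use ne in auto)

definition bad_root :: "'v set \<Rightarrow> 'i set \<Rightarrow> 'v" where
  "bad_root S J = (THE a. a \<in> S \<and> simple_wall J a (Max (bad S J)))"

lemma bad_root:
  assumes "adm J" "S \<subseteq> \<Delta>" "bad S J \<noteq> {}"
  shows "bad_root S J \<in> S" "simple_wall J (bad_root S J) (Max (bad S J))"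
    "final J (bad_root S J) < peak J (bad_root S J)"
proof -
  have "Max (bad S J) \<in> bad S J" using Max_in finite_bad assms by blast
  then obtain a where a: "a \<in> S" "simple_wall J a (Max (bad S J))" "final J a < lev J {..<Max (bad S J)} a"
    unfolding bad_def by blast
  have "bad_root S J = a"
    unfolding bad_root_def
  proof (rule the_equality)
    fix c assume "c \<in> S \<and> simple_wall J c (Max (bad S J))"
    then show "c = a" using simple_wall_unique[of c a J "Max (bad S J)"] a assms(2) by auto
  qed (use a in simp)
  then show "bad_root S J \<in> S" "simple_wall J (bad_root S J) (Max (bad S J))"
    "final J (bad_root S J) < peak J (bad_root S J)"
    using a final_less_peak_iff[OF assms(1)] assms(2) by blast+
qed

text \<open>The constant 1 is the pairing of \<open>weyl_vec D\<close> with a simple root, so that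
  the weight shifted by \<open>weyl_vec D\<close> is reflected exactly.\<close>

definition cancel :: "'v set \<Rightarrow> 'i set \<Rightarrow> 'i set" where
  "cancel S J = reflect 1 (bad_root S J) J"

text \<open>The map is an involution because the image has the same last bad wall and the same root
  there. Lowering preserves both; for a raised set this is read backwards, by lowering it to
  \<open>J\<close>.\<close>

lemma cancel:
  assumes J: "adm J" and S: "S \<subseteq> \<Delta>" and ne: "bad S J \<noteq> {}"
  shows "adm (cancel S J)" "bad S (cancel S J) \<noteq> {}" "bad_root S (cancel S J) = bad_root S J"
    "cancel S (cancel S J) = J"
    "wt (cancel S J) + weyl_vec D = \<sigma> (bad_root S J) (wt J + weyl_vec D)"
proof -
  define a where "a = bad_root S J"
  have aS: "a \<in> S" "simple_wall J a (Max (bad S J))" and less: "final J a < peak J a"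
    using bad_root[OF assms] by (simp_all add: a_def)
  have a: "a \<in> \<Delta>" using aS S by auto
  have R: "adm (reflect 1 a J)" "wt (reflect 1 a J) = wt J - of_int (final J a + 1) *\<^sub>R a"
    "final (reflect 1 a J) a + 1 \<le> peak (reflect 1 a J) a" "reflect 1 a (reflect 1 a J) = J"
    using reflect[OF J a, of 1] less by auto
  have C: "cancel S J = reflect 1 a J" by (simp add: cancel_def a_def)
  have inv: "bad S (reflect 1 a J) \<noteq> {} \<and> Max (bad S (reflect 1 a J)) = Max (bad S J) \<and>
    (\<forall>c\<in>\<Delta>. simple_wall (reflect 1 a J) c (Max (bad S J)) \<longleftrightarrow> simple_wall J c (Max (bad S J)))"
  proof (cases "final J a + 1 \<ge> 0")
    case True
    then show ?thesis
      using lower_pow_bad[OF J a S aS(1) _ less ne, of "nat (final J a + 1)"] less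
      by (simp add: reflect_def)
  next
    case False
    define t where "t = nat (- (final J a + 1))"
    let ?K = "(raise a ^^ t) J"
    have Kr: "reflect 1 a J = ?K" using False by (simp add: reflect_def t_def)
    have t: "int t \<le> peak J a - final J a" using peak_nonneg[OF J a] False by (simp add: t_def)
    have K: "adm ?K" "peak ?K a = peak J a + int t" "final ?K a = final J a + 2 * int t"
      "(lower a ^^ t) ?K = J"
      using raise_pow[OF J a t] by auto
    have lessK: "final ?K a < peak ?K a" using R(3) Kr by simp
    then have "bad S ?K \<noteq> {}" using bad_empty_iff[OF K(1) S] aS(1) by force
    then show ?thesis
      using lower_pow_bad[OF K(1) a S aS(1) _ lessK, of t] K peak_nonneg[OF J a] unfolding Kr by simp
  qed
  show "adm (cancel S J)" "bad S (cancel S J) \<noteq> {}" using R inv by (simp_all add: C)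
  show br: "bad_root S (cancel S J) = bad_root S J"
    unfolding bad_root_def C using inv S by (intro arg_cong[of _ _ The]) (auto simp: fun_eq_iff)
  show "cancel S (cancel S J) = J"
    using R(4) br by (simp add: cancel_def a_def)
  have "pairing D (weyl_vec D) a = 1" using datum a by (auto simp: kac_moody_datum_def)
  then show "wt (cancel S J) + weyl_vec D = \<sigma> (bad_root S J) (wt J + weyl_vec D)"
    unfolding C a_def[symmetric] R(2)
    using final_eq[OF adm_finite[OF J] adm_subset[OF J] a]
    by (simp add: root_refl_def pairing_simps algebra_simps)
qed

end

section \<open>Weyl characters and the branching rule\<close>

context kac_moody
begin

abbreviation rho :: 'v ("\<rho>") where "\<rho> \<equiv> weyl_vec D"

lemma rho_pairing: "a \<in> \<Delta> \<Longrightarrow> pairing D \<rho> a = 1"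
  using datum by (auto simp: kac_moody_datum_def)

text \<open>The exponent whose product with the term of \<open>w\<close> in the denominator,
  \<open>e^(w \<rho> - \<rho>)\<close>, is \<open>e^x\<close>.\<close>

definition shift :: "'v \<Rightarrow> ('v \<Rightarrow> 'v) \<Rightarrow> 'v" where
  "shift x w = x + (\<rho> - w \<rho>)"

lemma wsgn_id: "wsgn id = 1"
  by (simp add: wsgn_def len_eq_wlen wlen_id)

context
  fixes P :: "nat set" assumes P: "P \<subseteq> indices D"
begin

abbreviation (input) "SP \<equiv> simple_root D ` P"
abbreviation (input) "GP \<equiv> refl_group D (simple_root D ` P)"
abbreviation (input) "denom \<equiv> weyl_sum D P 0"

lemma S_sub: "SP \<subseteq> \<Delta>" using P by auto

lemma G_sub: "GP \<subseteq> \<W>" by (rule group_mono[OF S_sub])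

lemma rel_dominant_pairing:
  assumes "\<nu> \<in> rel_dominant D P" "c \<in> SP"
  shows "pairing D (\<nu> + \<rho>) c \<in> \<int> \<and> pairing D (\<nu> + \<rho>) c > 0"
proof -
  have "pairing D \<nu> c \<in> \<int>" "pairing D \<nu> c \<ge> 0"
    using assms by (auto simp: rel_dominant_def weight_lattice_def)
  moreover have "pairing D \<rho> c = 1" using rho_pairing assms S_sub by blast
  ultimately show ?thesis by (simp add: pairing_simps)
qed

lemma zero_rel_dominant: "0 \<in> rel_dominant D P"
  by (simp add: rel_dominant_def weight_lattice_def pairing_simps)

lemma orbit_diff:
  assumes "\<nu> \<in> rel_dominant D P" "w \<in> GP"
  shows "\<nu> + \<rho> - w (\<nu> + \<rho>) \<in> Qpos SP" "w \<noteq> id \<Longrightarrow> \<nu> + \<rho> - w (\<nu> + \<rho>) \<noteq> 0"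
  using dominant_diff[OF S_sub assms(2), of "\<nu> + \<rho>"] rel_dominant_pairing[OF assms(1)]
  by (meson less_imp_le)+

text \<open>A regular dominant vector has trivial stabilizer: a nontrivial element moves it by a
  nonzero vector.\<close>

lemma orbit_inj:
  assumes "\<nu> \<in> rel_dominant D P" "w \<in> GP" "w' \<in> GP" "w (\<nu> + \<rho>) = w' (\<nu> + \<rho>)"
  shows "w = w'"
proof -
  have W: "w \<in> \<W>" "w' \<in> \<W>" using assms G_sub by auto
  have "(inv w \<circ> w') (\<nu> + \<rho>) = \<nu> + \<rho>"
    using assms(4) weyl_inv_apply(1)[OF W(1)] by (metis comp_apply)
  moreover have "inv w \<circ> w' \<in> GP" using group_comp group_inv[OF _ S_sub] assms by blast
  ultimately have "inv w \<circ> w' = id" using orbit_diff(2)[OF assms(1)] by force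
  then have "w (inv w (w' v)) = w v" for v by (metis comp_apply id_apply)
  then show ?thesis using weyl_inv_apply(2)[OF W(1)] by (metis ext)
qed

lemma weyl_sum_eq: "weyl_sum D P \<nu> x = (\<Sum>w | w \<in> GP \<and> w (\<nu> + \<rho>) - \<rho> = x. wsgn w)"
  by (simp add: weyl_sum_def wsgn_def parabolic_def)

lemma weyl_sum_orbit:
  assumes "\<nu> \<in> rel_dominant D P" "w \<in> GP"
  shows "weyl_sum D P \<nu> (w (\<nu> + \<rho>) - \<rho>) = wsgn w"
proof -
  have "{w'. w' \<in> GP \<and> w' (\<nu> + \<rho>) - \<rho> = w (\<nu> + \<rho>) - \<rho>} = {w}"
    using orbit_inj[OF assms(1)] assms(2) by auto
  then show ?thesis unfolding weyl_sum_eq by (simp only: sum.insert sum.empty) simp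
qed

lemma weyl_sum_nonzero:
  assumes "weyl_sum D P \<nu> x \<noteq> 0" obtains w where "w \<in> GP" "x = w (\<nu> + \<rho>) - \<rho>"
proof -
  have "{w. w \<in> GP \<and> w (\<nu> + \<rho>) - \<rho> = x} \<noteq> {}" using assms unfolding weyl_sum_eq by (metis sum.empty)
  then show ?thesis using that by blast
qed

lemma wsgn_nonzero: "wsgn w \<noteq> 0"
  by (simp add: wsgn_def)

lemma rho_diff:
  assumes "w \<in> GP" shows "\<rho> - w \<rho> \<in> Qpos SP" "w \<noteq> id \<Longrightarrow> height D (\<rho> - w \<rho>) \<ge> 1"
  using orbit_diff[OF zero_rel_dominant assms] height_Qpos(2)[OF S_sub] by simp_all

lemma height_shift:
  assumes "w \<in> GP" shows "height D (shift x w) \<ge> height D x"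
    "w \<noteq> id \<Longrightarrow> height D (shift x w) \<ge> height D x + 1"
  using rho_diff[OF assms] height_Qpos(1)[OF S_sub rho_diff(1)[OF assms]]
  by (simp_all add: shift_def height_simps)

lemma shift_id: "shift x id = x"
  by (simp add: shift_def)

lemma shift_inj: "inj_on (shift x) GP"
proof (rule inj_onI)
  fix w w' assume w: "w \<in> GP" "w' \<in> GP" and "shift x w = shift x w'"
  then have "w (0 + \<rho>) = w' (0 + \<rho>)" by (simp add: shift_def)
  then show "w = w'" using orbit_inj[OF zero_rel_dominant w] by simp
qed

text \<open>The exponents of the denominator are indexed injectively by the subgroup, which turns
  the product into a sum over group elements. The subgroup may be infinite, so a finite
  \<open>F\<close> carrying all nonzero terms is supplied by the caller.\<close>

lemma char_mult_denom:
  assumes "finite F" "F \<subseteq> GP" "\<And>w. w \<in> GP \<Longrightarrow> w \<notin> F \<Longrightarrow> f (shift x w) = 0"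
  shows "char_mult f denom x = (\<Sum>w\<in>F. f (shift x w) * wsgn w)"
proof -
  let ?F = "{w \<in> F. f (shift x w) \<noteq> 0}"
  have d: "denom (x - shift x w) = wsgn w" if "w \<in> GP" for w
    using weyl_sum_orbit[OF zero_rel_dominant that] by (simp add: shift_def)
  have "{\<mu>. f \<mu> \<noteq> 0 \<and> denom (x - \<mu>) \<noteq> 0} = shift x ` ?F"
  proof (intro set_eqI iffI)
    fix \<mu> assume \<mu>: "\<mu> \<in> {\<mu>. f \<mu> \<noteq> 0 \<and> denom (x - \<mu>) \<noteq> 0}"
    then obtain w where w: "w \<in> GP" "x - \<mu> = w (0 + \<rho>) - \<rho>" using weyl_sum_nonzero by blast
    then have "\<mu> = shift x w" by (simp add: shift_def algebra_simps)
    then show "\<mu> \<in> shift x ` ?F" using \<mu> w assms(3) by blast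
  qed (use d wsgn_nonzero assms(2) in auto)
  then have "char_mult f denom x = (\<Sum>\<mu>\<in>shift x ` ?F. f \<mu> * denom (x - \<mu>))"
    by (simp add: char_mult_def)
  also have "\<dots> = (\<Sum>w\<in>?F. f (shift x w) * denom (x - shift x w))"
    by (subst sum.reindex) (use assms(2) in \<open>auto intro: inj_on_subset[OF shift_inj]\<close>)
  also have "\<dots> = (\<Sum>w\<in>?F. f (shift x w) * wsgn w)"
    using assms(2) d by (intro sum.cong) auto
  also have "\<dots> = (\<Sum>w\<in>F. f (shift x w) * wsgn w)"
    using assms(1) by (intro sum.mono_neutral_left) auto
  finally show ?thesis .
qed

lemma finite_shift_support:
  assumes "\<And>h. finite {\<nu>. f \<nu> \<noteq> 0 \<and> height D \<nu> > h}"
  shows "finite {w \<in> GP. f (shift x w) \<noteq> 0}"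
proof (rule finite_imageD)
  have "shift x ` {w \<in> GP. f (shift x w) \<noteq> 0} \<subseteq> {\<nu>. f \<nu> \<noteq> 0 \<and> height D \<nu> > height D x - 1}"
    using height_shift(1)[of _ x] by force
  then show "finite (shift x ` {w \<in> GP. f (shift x w) \<noteq> 0})" using assms by (rule finite_subset)
  show "inj_on (shift x) {w \<in> GP. f (shift x w) \<noteq> 0}" by (rule inj_on_subset[OF shift_inj]) auto
qed

text \<open>At a point of maximal height where two quotients differ only the leading term contributes.\<close>

lemma char_mult_denom_cancel:
  assumes f: "f \<in> char_ring D P" and g: "g \<in> char_ring D P"
    and eq: "char_mult f denom = char_mult g denom"
  shows "f = g"
proof (rule ccontr)
  assume "f \<noteq> g"
  then obtain x0 where x0: "f x0 \<noteq> g x0" by auto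
  have ff: "\<And>h. finite {\<nu>. f \<nu> \<noteq> 0 \<and> height D \<nu> > h}" and gf: "\<And>h. finite {\<nu>. g \<nu> \<noteq> 0 \<and> height D \<nu> > h}"
    using f g by (auto simp: char_ring_def)
  define X where "X = {x. f x \<noteq> g x \<and> height D x \<ge> height D x0}"
  have "X \<subseteq> {\<nu>. f \<nu> \<noteq> 0 \<and> height D \<nu> > height D x0 - 1} \<union> {\<nu>. g \<nu> \<noteq> 0 \<and> height D \<nu> > height D x0 - 1}"
    by (auto simp: X_def)
  then have "finite X" using ff gf finite_subset by blast
  moreover have "X \<noteq> {}" using x0 by (auto simp: X_def)
  ultimately obtain x where x: "x \<in> X" "\<And>y. y \<in> X \<Longrightarrow> height D y \<le> height D x"
    using obtains_MAX[of X "height D"] by (metis Max_ge finite_imageI imageI)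
  let ?F = "insert id ({w \<in> GP. f (shift x w) \<noteq> 0} \<union> {w \<in> GP. g (shift x w) \<noteq> 0})"
  have fin: "finite ?F" using finite_shift_support[OF ff] finite_shift_support[OF gf] by simp
  have sub: "?F \<subseteq> GP" using group_id by auto
  have "char_mult f denom x = (\<Sum>w\<in>?F. f (shift x w) * wsgn w)"
    by (rule char_mult_denom[OF fin sub]) auto
  moreover have "char_mult g denom x = (\<Sum>w\<in>?F. g (shift x w) * wsgn w)"
    by (rule char_mult_denom[OF fin sub]) auto
  ultimately have "(\<Sum>w\<in>?F. f (shift x w) * wsgn w) = (\<Sum>w\<in>?F. g (shift x w) * wsgn w)"
    using eq by simp
  moreover have "(\<Sum>w\<in>?F - {id}. f (shift x w) * wsgn w) = (\<Sum>w\<in>?F - {id}. g (shift x w) * wsgn w)"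
  proof (rule sum.cong[OF refl])
    fix w assume "w \<in> ?F - {id}"
    then have "height D (shift x w) \<ge> height D x + 1" using height_shift(2) sub by blast
    then have "shift x w \<notin> X" "height D (shift x w) \<ge> height D x0" using x by (force simp: X_def)+
    then show "f (shift x w) * wsgn w = g (shift x w) * wsgn w" by (auto simp: X_def)
  qed
  ultimately have "f (shift x id) * wsgn id = g (shift x id) * wsgn id"
    using sum.remove[OF fin, of id "\<lambda>w. f (shift x w) * wsgn w"]
      sum.remove[OF fin, of id "\<lambda>w. g (shift x w) * wsgn w"] by simp
  then show False using x(1) by (simp add: shift_id wsgn_id X_def)
qed

lemma rel_char_eqI:
  assumes "f \<in> char_ring D P" "char_mult f denom = weyl_sum D P \<nu>"
  shows "rel_char D P \<nu> = f"
  unfolding rel_char_def using assms char_mult_denom_cancel by (intro the_equality) auto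

text \<open>Long division from the top: the denominator is 1 plus terms of lower height, so the
  coefficient at \<open>x\<close> is determined by those at the higher points
  \<open>shift x w\<close>. The natural number is fuel; anything above \<open>quot_depth\<close>
  suffices, because each shift raises the height by at least 1.\<close>

primrec quot_approx :: "'v \<Rightarrow> nat \<Rightarrow> 'v \<Rightarrow> int" where
  "quot_approx \<nu> 0 x = 0"
| "quot_approx \<nu> (Suc n) x = (if \<nu> - x \<in> Qpos SP then weyl_sum D P \<nu> x -
     (\<Sum>w | w \<in> GP \<and> w \<noteq> id \<and> \<nu> - shift x w \<in> Qpos SP. quot_approx \<nu> n (shift x w) * wsgn w) else 0)"

definition quot_depth :: "'v \<Rightarrow> 'v \<Rightarrow> nat" where
  "quot_depth \<nu> x = nat \<lfloor>height D (\<nu> - x)\<rfloor>"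

lemma quot_depth_shift:
  assumes "w \<in> GP" "w \<noteq> id" "\<nu> - shift x w \<in> Qpos SP"
  shows "quot_depth \<nu> (shift x w) < quot_depth \<nu> x"
proof -
  have "height D (\<nu> - shift x w) \<ge> 0" using height_Qpos(1)[OF S_sub assms(3)] .
  moreover have "height D (\<nu> - x) \<ge> height D (\<nu> - shift x w) + 1"
    using height_shift(2)[OF assms(1,2), of x] by (simp add: height_simps)
  ultimately have "\<lfloor>height D (\<nu> - shift x w)\<rfloor> \<ge> 0"
    "\<lfloor>height D (\<nu> - x)\<rfloor> \<ge> \<lfloor>height D (\<nu> - shift x w)\<rfloor> + 1" by linarith+
  then show ?thesis unfolding quot_depth_def by linarith
qed

lemma quot_approx_stable:
  "quot_depth \<nu> x < n \<Longrightarrow> quot_depth \<nu> x < m \<Longrightarrow> quot_approx \<nu> n x = quot_approx \<nu> m x"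
proof (induction n arbitrary: m x)
  case (Suc n)
  then obtain m' where m: "m = Suc m'" by (cases m) auto
  have "quot_approx \<nu> n (shift x w) = quot_approx \<nu> m' (shift x w)"
    if "w \<in> GP \<and> w \<noteq> id \<and> \<nu> - shift x w \<in> Qpos SP" for w
    using Suc.IH[of "shift x w" m'] quot_depth_shift[of w \<nu> x] that Suc.prems m by simp
  then show ?case unfolding m quot_approx.simps by (intro if_cong arg_cong2[of _ _ _ _ "(-)"] sum.cong refl) auto
qed simp

text \<open>The definite description in \<open>rel_char\<close> requires an actual quotient. The
  recursion stays inside the cone of points \<open>x\<close> with \<open>\<nu> - x\<close> in
  \<open>Qpos\<close>, which has finitely many points above any height; off this cone both sides of
  the equation vanish.\<close>

lemma rel_char_exists:
  assumes \<nu>: "\<nu> \<in> rel_dominant D P"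
  shows "\<exists>f\<in>char_ring D P. char_mult f denom = weyl_sum D P \<nu> \<and> (\<forall>x. f x \<noteq> 0 \<longrightarrow> \<nu> - x \<in> Qpos SP)"
proof -
  define f where "f x = quot_approx \<nu> (Suc (quot_depth \<nu> x)) x" for x
  have supp: "f x \<noteq> 0 \<Longrightarrow> \<nu> - x \<in> Qpos SP" for x by (auto simp: f_def split: if_splits)
  have fin: "finite {x. f x \<noteq> 0 \<and> height D x > h}" for h
  proof -
    have "{x. f x \<noteq> 0 \<and> height D x > h} \<subseteq> (\<lambda>y. \<nu> - y) ` {y \<in> Qpos SP. height D y \<le> height D \<nu> - h}"
    proof
      fix x assume "x \<in> {x. f x \<noteq> 0 \<and> height D x > h}"
      then have "\<nu> - x \<in> {y \<in> Qpos SP. height D y \<le> height D \<nu> - h}"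
        using supp by (auto simp: height_simps)
      then show "x \<in> (\<lambda>y. \<nu> - y) ` {y \<in> Qpos SP. height D y \<le> height D \<nu> - h}"
        by (rule rev_image_eqI) simp
    qed
    then show ?thesis using finite_Qpos_height[OF S_sub] finite_subset by blast
  qed
  have "x \<in> weight_lattice D P" if "f x \<noteq> 0" for x
    unfolding weight_lattice_def
  proof safe
    fix p assume p: "p \<in> P"
    then have "pairing D (\<nu> - x) (simple_root D p) \<in> \<int>"
      using Qlat_pairing[OF Qpos_Qlat[OF supp[OF that]] S_sub] S_sub by blast
    moreover have "pairing D \<nu> (simple_root D p) \<in> \<int>"
      using \<nu> p by (auto simp: rel_dominant_def weight_lattice_def)
    ultimately have "pairing D \<nu> (simple_root D p) - pairing D (\<nu> - x) (simple_root D p) \<in> \<int>"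
      by (rule Ints_diff[rotated])
    then show "pairing D x (simple_root D p) \<in> \<int>" by (simp add: pairing_simps)
  qed
  then have ring: "f \<in> char_ring D P" using fin by (simp add: char_ring_def)
  have rec: "f x = weyl_sum D P \<nu> x -
      (\<Sum>w | w \<in> GP \<and> w \<noteq> id \<and> \<nu> - shift x w \<in> Qpos SP. f (shift x w) * wsgn w)"
    if x: "\<nu> - x \<in> Qpos SP" for x
  proof -
    have "quot_approx \<nu> (quot_depth \<nu> x) (shift x w) = f (shift x w)"
      if "w \<in> GP \<and> w \<noteq> id \<and> \<nu> - shift x w \<in> Qpos SP" for w
      unfolding f_def using quot_approx_stable quot_depth_shift that by blast
    then show ?thesis
      using x unfolding f_def[of x] quot_approx.simps by (simp only: if_True) (auto intro!: sum.cong)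
  qed
  have "char_mult f denom x = weyl_sum D P \<nu> x" for x
  proof -
    let ?F = "{w. w \<in> GP \<and> w \<noteq> id \<and> \<nu> - shift x w \<in> Qpos SP}"
    have "finite ?F"
    proof (rule finite_imageD)
      have "shift x ` ?F \<subseteq> (\<lambda>y. \<nu> - y) ` {y \<in> Qpos SP. height D y \<le> height D \<nu> - height D x}"
      proof
        fix y assume "y \<in> shift x ` ?F"
        then obtain w where w: "w \<in> GP" "\<nu> - y \<in> Qpos SP" "y = shift x w" by blast
        then have "height D (\<nu> - y) \<le> height D \<nu> - height D x"
          using height_shift(1)[OF w(1), of x] by (simp add: height_simps)
        then show "y \<in> (\<lambda>y. \<nu> - y) ` {y \<in> Qpos SP. height D y \<le> height D \<nu> - height D x}"
          using w by (intro rev_image_eqI[of "\<nu> - y"]) auto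
      qed
      then show "finite (shift x ` ?F)" using finite_Qpos_height[OF S_sub] finite_subset by blast
      show "inj_on (shift x) ?F" by (rule inj_on_subset[OF shift_inj]) auto
    qed
    then have finF: "finite (insert id ?F)" by simp
    have sub: "insert id ?F \<subseteq> GP" using group_id by auto
    have "char_mult f denom x = (\<Sum>w\<in>insert id ?F. f (shift x w) * wsgn w)"
      by (rule char_mult_denom[OF finF sub]) (use supp in blast)
    also have "\<dots> = f x + (\<Sum>w\<in>?F. f (shift x w) * wsgn w)"
      using \<open>finite ?F\<close> by (subst sum.insert) (auto simp: shift_id wsgn_id)
    finally have eq: "char_mult f denom x = f x + (\<Sum>w\<in>?F. f (shift x w) * wsgn w)" .
    show ?thesis
    proof (cases "\<nu> - x \<in> Qpos SP")
      case True
      then show ?thesis using eq rec by simp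
    next
      case False
      have "\<nu> - shift x w \<notin> Qpos SP" if "w \<in> GP" for w
      proof
        assume "\<nu> - shift x w \<in> Qpos SP"
        then have "(\<nu> - shift x w) + (\<rho> - w \<rho>) \<in> Qpos SP" using rho_diff(1)[OF that] Qpos_add by blast
        then show False using False by (simp add: shift_def)
      qed
      then have "?F = {}" by blast
      then have "char_mult f denom x = f x" using eq by (simp only: sum.empty add_0_right)
      moreover have "f x = 0" using supp False by blast
      moreover have "weyl_sum D P \<nu> x = 0"
      proof (rule ccontr)
        assume "weyl_sum D P \<nu> x \<noteq> 0"
        then obtain w where w: "w \<in> GP" "x = w (\<nu> + \<rho>) - \<rho>" using weyl_sum_nonzero by blast
        then have "\<nu> - x = \<nu> + \<rho> - w (\<nu> + \<rho>)" by simp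
        then show False using orbit_diff(1)[OF \<nu> w(1)] False by metis
      qed
      ultimately show ?thesis by simp
    qed
  qed
  then show ?thesis using ring supp by (intro bexI[of _ f]) auto
qed

lemma rel_char:
  assumes "\<nu> \<in> rel_dominant D P"
  shows "rel_char D P \<nu> \<in> char_ring D P" "char_mult (rel_char D P \<nu>) denom = weyl_sum D P \<nu>"
    "rel_char D P \<nu> x \<noteq> 0 \<Longrightarrow> \<nu> - x \<in> Qpos SP"
  using rel_char_exists[OF assms] rel_char_eqI by metis+

end

end

context lam_chain
begin

section \<open>Weight multiplicities and the branching identity\<close>

definition mult :: "'v \<Rightarrow> int" where
  "mult \<nu> = int (card {J. adm J \<and> wt J = \<nu>})"

lemma finite_adm_weight: "finite {J. adm J \<and> wt J = \<nu>}"
  by (rule finite_subset[OF _ finite_adm[of "height D \<nu>"]]) auto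

lemma mult_nonzero: "mult \<nu> \<noteq> 0 \<longleftrightarrow> (\<exists>J. adm J \<and> wt J = \<nu>)"
  using finite_adm_weight[of \<nu>] by (auto simp: mult_def card_eq_0_iff)

lemma weight_integral: "adm J \<Longrightarrow> a \<in> \<Delta> \<Longrightarrow> pairing D (wt J) a \<in> \<int>"
  using final_eq[OF adm_finite adm_subset] by (metis Ints_of_int)

lemma mult_char_ring:
  assumes "P \<subseteq> indices D" shows "mult \<in> char_ring D P"
  unfolding char_ring_def
proof safe
  fix \<nu> assume "mult \<nu> \<noteq> 0"
  then show "\<nu> \<in> weight_lattice D P"
    using mult_nonzero weight_integral assms by (auto simp: weight_lattice_def)
next
  fix h
  have "{\<nu>. mult \<nu> \<noteq> 0 \<and> h < height D \<nu>} \<subseteq> wt ` {J. adm J \<and> height D (wt J) \<ge> h}"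
    using mult_nonzero by force
  then show "finite {\<nu>. mult \<nu> \<noteq> 0 \<and> h < height D \<nu>}"
    using finite_adm finite_subset by blast
qed

text \<open>Reversing the \<open>a\<close>-strings by \<open>reflect 0 a\<close> is a bijection
  between the two sets being counted.\<close>

lemma mult_refl:
  assumes a: "a \<in> \<Delta>" shows "mult (\<sigma> a \<nu>) = mult \<nu>"
proof -
  have R: "adm (reflect 0 a J)" "wt (reflect 0 a J) = \<sigma> a (wt J)" "reflect 0 a (reflect 0 a J) = J"
    if "adm J" for J
    using reflect[OF that a, of 0] final_le_peak[of J a] final_eq[OF adm_finite adm_subset a, of J] that
    by (simp_all add: root_refl_def)
  have inv: "\<sigma> a (\<sigma> a v) = v" for v using refl_invol[OF simple_nonisotropic[OF a]] .
  have "bij_betw (reflect 0 a) {J. adm J \<and> wt J = \<nu>} {J. adm J \<and> wt J = \<sigma> a \<nu>}"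
    by (rule bij_betw_byWitness[of _ "reflect 0 a"]) (use R inv in auto)
  then show ?thesis unfolding mult_def by (simp add: bij_betw_same_card)
qed

lemma mult_weyl:
  assumes "w \<in> \<W>" shows "mult (w \<nu>) = mult \<nu>"
proof -
  obtain xs where xs: "set xs \<subseteq> \<Delta>" "w = refl_prod D xs" using assms by (auto simp: refl_group_def)
  have "mult (refl_prod D xs \<nu>) = mult \<nu>"
    using xs(1) by (induction xs) (auto simp: refl_prod_simps mult_refl)
  then show ?thesis using xs by simp
qed

text \<open>
  By invariance of the multiset of weights, the product with the denominator is an alternating sum
  over pairs; \<open>cancel\<close> pairs off all terms with a bad index.
\<close>

lemma mult_denom:
  assumes P: "P \<subseteq> indices D" and S: "S = simple_root D ` P" and Q: "finite Q"
    and good: "\<And>J. J \<in> Q \<Longrightarrow> adm J \<and> bad S J = {}"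
    and all: "\<And>J w. adm J \<Longrightarrow> bad S J = {} \<Longrightarrow> w \<in> refl_group D S \<Longrightarrow> w (wt J + \<rho>) - \<rho> = x \<Longrightarrow> J \<in> Q"
  shows "char_mult mult (weyl_sum D P 0) x = (\<Sum>J\<in>Q. weyl_sum D P (wt J) x)"
proof -
  let ?G = "refl_group D S"
  have Sd: "S \<subseteq> \<Delta>" using P S by auto
  have GW: "?G \<subseteq> \<W>" by (rule group_mono[OF Sd])
  define F where "F = {w \<in> ?G. mult (shift x w) \<noteq> 0}"
  define A where "A w = {J. adm J \<and> w (wt J + \<rho>) - \<rho> = x}" for w
  define T where "T = Sigma F A"
  have A: "A w = {J. adm J \<and> wt J = inv w (shift x w)}" if "w \<in> ?G" for w
  proof -
    have W: "w \<in> \<W>" using that GW by blast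
    have lin: "linear w" using weyl_isometry[OF W] by (simp add: isometry_def)
    have "w (v + \<rho>) - \<rho> = x \<longleftrightarrow> v = inv w (shift x w)" for v
    proof -
      have "w (v + \<rho>) - \<rho> = x \<longleftrightarrow> w v = shift x w"
        by (auto simp: shift_def linear_add[OF lin] algebra_simps)
      also have "\<dots> \<longleftrightarrow> v = inv w (shift x w)" using weyl_inv_apply[OF W] by metis
      finally show ?thesis .
    qed
    then show ?thesis by (simp add: A_def)
  qed
  \<comment> \<open>By Weyl invariance the coefficient at \<open>shift x w\<close> counts the sets
    whose weight \<open>w\<close> carries to \<open>x\<close> under the action shifted by
    \<open>\<rho>\<close>.\<close>
  have cardA: "int (card (A w)) = mult (shift x w)" and finA: "finite (A w)" if "w \<in> ?G" for w
    using A[OF that] mult_weyl[OF weyl_inv, of w "shift x w"] that GW finite_adm_weight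
    by (auto simp: mult_def)
  have "finite {\<nu>. mult \<nu> \<noteq> 0 \<and> height D \<nu> > h}" for h
    using mult_char_ring[OF P] by (simp add: char_ring_def)
  then have finF: "finite F" unfolding F_def S by (rule finite_shift_support[OF P])
  have finT: "finite T" unfolding T_def using finF finA by (intro finite_SigmaI) (auto simp: F_def)
  have memT: "(w, J) \<in> T \<longleftrightarrow> w \<in> ?G \<and> adm J \<and> w (wt J + \<rho>) - \<rho> = x" for w J
  proof -
    have "w \<in> F" if w: "w \<in> ?G" "J \<in> A w"
    proof -
      have "card (A w) \<noteq> 0" using w finA by auto
      then show ?thesis using cardA[OF w(1)] w by (simp add: F_def)
    qed
    then show ?thesis by (auto simp: T_def A_def F_def)
  qed
  have "char_mult mult (weyl_sum D P 0) x = (\<Sum>w\<in>F. mult (shift x w) * wsgn w)"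
    by (rule char_mult_denom[OF P finF]) (auto simp: F_def S)
  also have "\<dots> = (\<Sum>w\<in>F. \<Sum>J\<in>A w. wsgn w)"
    using cardA by (intro sum.cong) (auto simp: F_def)
  also have "\<dots> = (\<Sum>(w, J)\<in>T. wsgn w)"
    unfolding T_def using finF finA by (intro sum.Sigma) (auto simp: F_def)
  also have "\<dots> = (\<Sum>(w, J)\<in>{p \<in> T. bad S (snd p) = {}}. wsgn w) + (\<Sum>(w, J)\<in>{p \<in> T. bad S (snd p) \<noteq> {}}. wsgn w)"
    by (subst sum.union_disjoint[symmetric]) (use finT in \<open>auto intro!: sum.cong\<close>)
  also have "(\<Sum>(w, J)\<in>{p \<in> T. bad S (snd p) \<noteq> {}}. wsgn w) = 0"
  proof -
    let ?B = "{p \<in> T. bad S (snd p) \<noteq> {}}"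
    \<comment> \<open>The reflection of the shifted weight by \<open>cancel\<close> is undone by the
      extra factor on the right of \<open>w\<close>, so the exponent \<open>x\<close> is kept while
      the sign changes.\<close>
    let ?f = "\<lambda>(w, J). (w \<circ> \<sigma> (bad_root S J), cancel S J)"
    have f: "?f p \<in> ?B \<and> ?f (?f p) = p \<and> wsgn (fst (?f p)) = - wsgn (fst p)" if "p \<in> ?B" for p
    proof -
      obtain w J where p: "p = (w, J)" by (cases p)
      have w: "w \<in> ?G" and J: "adm J" "bad S J \<noteq> {}" and x: "w (wt J + \<rho>) - \<rho> = x"
        using that memT p by auto
      note C = cancel[OF J(1) Sd J(2)]
      define a where "a = bad_root S J"
      have a: "a \<in> S" "a \<in> \<Delta>" using bad_root(1)[OF J(1) Sd J(2)] Sd by (auto simp: a_def)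
      have "w \<circ> \<sigma> a \<in> ?G" using group_comp group_refl w a by blast
      moreover have "(w \<circ> \<sigma> a) (wt (cancel S J) + \<rho>) - \<rho> = x"
        using C(5) x refl_invol[OF simple_nonisotropic[OF a(2)]] by (simp add: a_def[symmetric])
      ultimately have "?f p \<in> ?B" using C memT by (simp add: p a_def)
      moreover have "?f (?f p) = p"
        using C comp_refl_refl[OF a(2), of w] by (simp add: p a_def)
      moreover have "wsgn (fst (?f p)) = - wsgn (fst p)"
        using wsgn_comp_refl[OF _ a(2), of w] w GW by (auto simp: p a_def)
      ultimately show ?thesis by blast
    qed
    have bij: "bij_betw ?f ?B ?B"
      by (rule bij_betw_byWitness[of _ ?f]) (use f in auto)
    have "(\<Sum>p\<in>?B. wsgn (fst p)) = (\<Sum>p\<in>?B. wsgn (fst (?f p)))"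
      using sum.reindex_bij_betw[OF bij, of "\<lambda>p. wsgn (fst p)"] by simp
    also have "\<dots> = (\<Sum>p\<in>?B. - wsgn (fst p))" using f by (intro sum.cong) auto
    finally have "(\<Sum>p\<in>?B. wsgn (fst p)) = 0" by (simp add: sum_negf)
    then show ?thesis by (simp add: case_prod_unfold)
  qed
  also have "(\<Sum>(w, J)\<in>{p \<in> T. bad S (snd p) = {}}. wsgn w) =
      (\<Sum>(J, w)\<in>Sigma Q (\<lambda>J. {w. w \<in> ?G \<and> w (wt J + \<rho>) - \<rho> = x}). wsgn w)"
    by (rule sum.reindex_bij_witness[of _ prod.swap prod.swap]) (use memT good all in auto)
  also have "\<dots> = (\<Sum>J\<in>Q. \<Sum>w | w \<in> ?G \<and> w (wt J + \<rho>) - \<rho> = x. wsgn w)"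
  proof (rule sum.Sigma[symmetric, OF Q], intro ballI)
    fix J assume "J \<in> Q"
    then have "{w. w \<in> ?G \<and> w (wt J + \<rho>) - \<rho> = x} \<subseteq> fst ` T"
      using good memT by (force intro: rev_image_eqI)
    then show "finite {w. w \<in> ?G \<and> w (wt J + \<rho>) - \<rho> = x}" using finT finite_subset by blast
  qed
  also have "\<dots> = (\<Sum>J\<in>Q. weyl_sum D P (wt J) x)"
    by (rule sum.cong[OF refl]) (simp only: weyl_sum_eq[OF P] S)
  finally show ?thesis by simp
qed

text \<open>For the full index set the empty set alone has no bad wall, and its weight is
  \<open>lam\<close>; the product with the denominator is therefore the numerator of the
  character.\<close>

lemma weyl_char_eq_mult: "weyl_char D lam = mult"
  unfolding weyl_char_def
proof (rule rel_char_eqI[OF subset_refl mult_char_ring[OF subset_refl]])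
  have b: "bad \<Delta> J = {} \<longleftrightarrow> J = {}" if "adm J" for J
    using bad_empty_iff[OF that subset_refl] empty_highest nonempty_not_highest[OF that]
    by (metis less_irrefl)
  have "char_mult mult (weyl_sum D (indices D) 0) x = (\<Sum>J\<in>{{}}. weyl_sum D (indices D) (wt J) x)" for x
    by (rule mult_denom[OF subset_refl refl]) (use b adm_empty in auto)
  then show "char_mult mult (weyl_sum D (indices D) 0) = weyl_sum D (indices D) lam"
    by (simp add: fun_eq_iff weight_empty)
qed

text \<open>The endpoint equals the peak, and the peak is at least the starting level 0.\<close>

lemma good_rel_dominant:
  assumes "P \<subseteq> indices D" "adm J" "bad (simple_root D ` P) J = {}"
  shows "wt J \<in> rel_dominant D P"
proof -
  have sub: "simple_root D ` P \<subseteq> \<Delta>" using assms by auto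
  have "pairing D (wt J) a \<in> \<int> \<and> pairing D (wt J) a \<ge> 0" if "a \<in> simple_root D ` P" for a
    using bad_empty_iff[OF assms(2) sub] assms(3) that peak_nonneg[OF assms(2), of a] sub
      final_eq[OF adm_finite[OF assms(2)] adm_subset[OF assms(2)], of a]
      weight_integral[OF assms(2), of a] by (metis of_int_0_le_iff subsetD)
  then show ?thesis by (auto simp: rel_dominant_def weight_lattice_def)
qed

text \<open>Both sides have the same product with the denominator, namely the sum of
  \<open>weyl_sum D P (wt J)\<close> over the good \<open>J\<close>. Since a relative character is
  supported below its highest weight, only sets in the finite \<open>Q h\<close> contribute at
  points of height at least \<open>h\<close>, which makes the sum over \<open>J\<close> finite at
  each point.\<close>

lemma branching:
  assumes P: "P \<subseteq> indices D"
  shows "has_formal_sum (\<lambda>J. rel_char D P (wt J)) {J. adm J \<and> bad (simple_root D ` P) J = {}} mult"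
proof -
  let ?S = "simple_root D ` P"
  let ?B = "{J. adm J \<and> bad ?S J = {}}"
  let ?\<chi> = "\<lambda>J. rel_char D P (wt J)"
  define Q where "Q h = {J \<in> ?B. height D (wt J) \<ge> h}" for h
  have Sd: "?S \<subseteq> \<Delta>" using P by auto
  have finQ: "finite (Q h)" for h
    by (rule finite_subset[OF _ finite_adm[of h]]) (auto simp: Q_def)
  have \<chi>: "?\<chi> J \<in> char_ring D P" "char_mult (?\<chi> J) (weyl_sum D P 0) = weyl_sum D P (wt J)"
    "?\<chi> J x \<noteq> 0 \<Longrightarrow> wt J - x \<in> Qpos ?S" if "J \<in> ?B" for J x
    using rel_char[OF P good_rel_dominant[OF P]] that by auto
  have supp: "{J \<in> ?B. ?\<chi> J x \<noteq> 0} \<subseteq> Q h" if "h \<le> height D x" for x h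
  proof
    fix J assume J: "J \<in> {J \<in> ?B. ?\<chi> J x \<noteq> 0}"
    then have "height D (wt J - x) \<ge> 0" using height_Qpos(1)[OF Sd \<chi>(3)] by blast
    then show "J \<in> Q h" using J that by (simp add: Q_def height_simps)
  qed
  define g where "g x = (\<Sum>J | J \<in> ?B \<and> ?\<chi> J x \<noteq> 0. ?\<chi> J x)" for x
  have gQ: "g x = (\<Sum>J\<in>Q h. ?\<chi> J x)" if "h \<le> height D x" for x h
    unfolding g_def using supp[OF that] finQ[of h]
    by (intro sum.mono_neutral_left) (auto simp: Q_def)
  have ring: "g \<in> char_ring D P"
    unfolding char_ring_def
  proof safe
    fix x assume "g x \<noteq> 0"
    moreover have "g x = 0" if "\<forall>J\<in>?B. ?\<chi> J x = 0"
      unfolding g_def using that by (intro sum.neutral) auto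
    ultimately obtain J where "J \<in> ?B" "?\<chi> J x \<noteq> 0" by blast
    then show "x \<in> weight_lattice D P" using \<chi>(1) by (auto simp: char_ring_def)
  next
    fix h
    have "{x. g x \<noteq> 0 \<and> h < height D x} \<subseteq> (\<Union>J\<in>Q h. {x. ?\<chi> J x \<noteq> 0 \<and> h < height D x})"
    proof safe
      fix x assume "g x \<noteq> 0" and h: "h < height D x"
      then have "\<exists>J\<in>Q h. ?\<chi> J x \<noteq> 0" using gQ[of h x] by (metis less_imp_le sum.neutral)
      then show "x \<in> (\<Union>J\<in>Q h. {x. ?\<chi> J x \<noteq> 0 \<and> h < height D x})" using h by blast
    qed
    moreover have "finite {x. ?\<chi> J x \<noteq> 0 \<and> h < height D x}" if "J \<in> Q h" for J
      using \<chi>(1)[of J] that by (auto simp: Q_def char_ring_def)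
    ultimately show "finite {x. g x \<noteq> 0 \<and> h < height D x}"
      using finQ[of h] by (meson finite_UN_I finite_subset)
  qed
  have "char_mult g (weyl_sum D P 0) x = char_mult mult (weyl_sum D P 0) x" for x
  proof -
    let ?Q = "Q (height D x)"
    let ?G = "refl_group D ?S"
    define F where "F = (\<Union>J\<in>?Q. {w \<in> ?G. ?\<chi> J (shift x w) \<noteq> 0})"
    have "finite {w \<in> ?G. ?\<chi> J (shift x w) \<noteq> 0}" if "J \<in> ?Q" for J
      by (rule finite_shift_support[OF P]) (use \<chi>(1)[of J] that in \<open>auto simp: Q_def char_ring_def\<close>)
    then have F: "finite F" "F \<subseteq> ?G" using finQ by (auto simp: F_def)
    have out: "?\<chi> J (shift x w) = 0" if "w \<in> ?G" "w \<notin> F" "J \<in> ?Q" for w J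
      using that by (auto simp: F_def)
    have gs: "g (shift x w) = (\<Sum>J\<in>?Q. ?\<chi> J (shift x w))" if "w \<in> ?G" for w
      by (rule gQ[OF height_shift(1)[OF P that]])
    have "char_mult g (weyl_sum D P 0) x = (\<Sum>w\<in>F. g (shift x w) * wsgn w)"
      by (rule char_mult_denom[OF P F]) (use gs out in simp)
    also have "\<dots> = (\<Sum>w\<in>F. \<Sum>J\<in>?Q. ?\<chi> J (shift x w) * wsgn w)"
      using gs F(2) by (intro sum.cong) (auto simp: sum_distrib_right)
    also have "\<dots> = (\<Sum>J\<in>?Q. \<Sum>w\<in>F. ?\<chi> J (shift x w) * wsgn w)" by (rule sum.swap)
    also have "\<dots> = (\<Sum>J\<in>?Q. char_mult (?\<chi> J) (weyl_sum D P 0) x)"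
      using out by (intro sum.cong[OF refl] char_mult_denom[OF P F, symmetric]) auto
    also have "\<dots> = (\<Sum>J\<in>?Q. weyl_sum D P (wt J) x)"
      using \<chi>(2) by (intro sum.cong) (auto simp: Q_def)
    also have "\<dots> = char_mult mult (weyl_sum D P 0) x"
    proof (rule mult_denom[OF P refl finQ, symmetric])
      fix J w assume J: "adm J" "bad ?S J = {}" and w: "w \<in> ?G" "w (wt J + \<rho>) - \<rho> = x"
      have "wt J + \<rho> - w (wt J + \<rho>) \<in> Qpos ?S"
        by (rule orbit_diff(1)[OF P good_rel_dominant[OF P J] w(1)])
      then have "wt J - x \<in> Qpos ?S" using w(2) by (simp add: algebra_simps)
      from height_Qpos(1)[OF Sd this] show "J \<in> ?Q" using J by (simp add: Q_def height_simps)
    qed (simp add: Q_def)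
    finally show ?thesis .
  qed
  then have "g = mult"
    using char_mult_denom_cancel[OF P ring mult_char_ring[OF P]] by blast
  then have "mult x = (\<Sum>J | J \<in> ?B \<and> ?\<chi> J x \<noteq> 0. ?\<chi> J x)" for x
    using g_def[of x] by simp
  moreover have "finite {J \<in> ?B. ?\<chi> J x \<noteq> 0}" for x
    by (rule finite_subset[OF supp[OF order_refl] finQ])
  ultimately show ?thesis unfolding has_formal_sum_def by blast
qed

section \<open>Agreement with the foldings and levels in the statement\<close>

lemma folding_foldr:
  assumes "sorted_wrt (<) xs"
  shows "gam (foldr (fold_op D) xs (\<lambda>i. (\<beta> i, 1), v)) i = refl_prod D (map \<beta> (filter (\<lambda>j. j < i) xs)) (\<beta> i) \<and>
    eps (foldr (fold_op D) xs (\<lambda>i. (\<beta> i, 1), v)) i = (if i \<in> set xs then - 1 else 1)"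
  using assms
proof (induction xs arbitrary: i)
  case Nil
  then show ?case by (simp add: gam_def eps_def refl_prod_simps)
next
  case (Cons k xs)
  obtain g u where gu: "foldr (fold_op D) xs (\<lambda>i. (\<beta> i, 1), v) = (g, u)" by (meson surj_pair)
  have less: "\<And>j. j \<in> set xs \<Longrightarrow> k < j" using Cons.prems by simp
  have IH: "fst (g i) = refl_prod D (map \<beta> (filter (\<lambda>j. j < i) xs)) (\<beta> i)"
    "snd (g i) = (if i \<in> set xs then - 1 else 1)" for i
    using Cons.IH[of i] Cons.prems by (simp_all add: gu gam_def eps_def)
  have empty: "filter (\<lambda>j. j < i) xs = []" if "i \<le> k" for i
    unfolding filter_empty_conv using less that by (metis le_less_trans less_asym)
  \<comment> \<open>The smallest index is folded last. The folds at larger indices have left index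
    \<open>k\<close> untouched, so the new reflection is the one in \<open>\<beta> k\<close> and
    enters as the leftmost factor.\<close>
  have k: "fst (g k) = \<beta> k" by (simp add: IH empty refl_prod_simps)
  have st: "foldr (fold_op D) (k # xs) (\<lambda>i. (\<beta> i, 1), v) = (\<lambda>j. if j < k then g j
      else if j = k then (fst (g k), - snd (g k)) else (\<sigma> (fst (g k)) (fst (g j)), snd (g j)),
      \<sigma> (fst (g k)) u)"
    by (simp add: gu fold_op_def Let_def)
  consider "i < k" | "i = k" | "k < i" by (meson linorder_less_linear)
  then show ?case
  proof cases
    case 1
    then show ?thesis
      unfolding st using empty[of i] less[of i] by (auto simp: gam_def eps_def IH)
  next
    case 2
    then show ?thesis
      unfolding st using empty[of i] less[of i] by (auto simp: gam_def eps_def IH)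
  next
    case 3
    then show ?thesis
      unfolding st k gam_def eps_def by (auto simp: IH refl_prod_simps)
  qed
qed

lemma folding:
  assumes "finite J"
  shows "gam (folding_of D \<beta> J) i = root_at J i" "eps (folding_of D \<beta> J) i = (if i \<in> J then - 1 else 1)"
proof -
  have "filter (\<lambda>j. j < i) (sorted_list_of_set J) = sorted_list_of_set (J \<inter> {..<i})"
    using assms by (intro sorted_distinct_set_unique) (auto simp: sorted_wrt_filter)
  then show "gam (folding_of D \<beta> J) i = root_at J i"
    "eps (folding_of D \<beta> J) i = (if i \<in> J then - 1 else 1)"
    using folding_foldr[OF strict_sorted_list_of_set, of J "weyl_vec D" i] assms
    by (simp_all add: folding_of_def root_at_def refl_prod_sorted)
qed

text \<open>The sign is 1 exactly off \<open>J\<close>, and at a wall orthogonal to \<open>a\<close>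
  the root is positive exactly if the path rises there, so the two offsets agree.\<close>

lemma level_folding:
  assumes "finite J" "J \<subseteq> I" "a \<in> \<Delta>" "simple_wall J a i"
  shows "level D I (folding_of D \<beta> J) i = lev J {..<i} a"
proof -
  have g: "root_at J i = a \<or> root_at J i = - a" using assms(4) by (simp add: simple_wall_def)
  have "root_at J i \<in> pos_roots D \<longleftrightarrow> root_at J i = a"
    using g simple_pos_root[OF assms(3)] neg_root_iff[OF simple_root[OF assms(3)]] by auto
  then have "(if root_at J i \<in> pos_roots D then 0 else - 1) =
      (if ascends a (prod_at (J \<inter> {..<i})) then 0 else - 1 :: int)"
    using simple_wall_ascends[OF assms] by simp
  moreover have "{j. j \<in> I \<and> j < i \<and> eps (folding_of D \<beta> J) j = 1 \<and> (root_at J j = root_at J i \<or> root_at J j = - root_at J i)} =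
      {j. j \<in> I \<and> j \<in> {..<i} \<and> j \<notin> J \<and> (root_at J j = a \<or> root_at J j = - a)}"
    using g by (auto simp: folding(2)[OF assms(1)] split: if_splits)
  ultimately show ?thesis
    unfolding level_def lev_def signed_crossings_def folding(1)[OF assms(1)] by simp
qed

text \<open>The pairing of the weight is the level at the end of the gallery, so it supplies the
  value of \<open>lv\<close> at the index after the last wall.\<close>

lemma max_level_eq:
  assumes "adm J" "p \<in> indices D"
  shows "max_level D lam I \<beta> J p = real_of_int (peak J (simple_root D p))"
proof -
  let ?a = "simple_root D p"
  let ?W = "{i \<in> I. root_at J i = ?a \<or> root_at J i = - ?a}"
  have a: "?a \<in> \<Delta>" using assms by simp
  note J = adm_finite[OF assms(1)] adm_subset[OF assms(1)]
  let ?n = "length (walls J ?a)"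
  have W: "?W = (!) (walls J ?a) ` {..<?n}"
    using set_walls[OF J, of ?a] unfolding simple_wall_def by (auto simp: set_conv_nth)
  have "(\<lambda>i. level D I (folding_of D \<beta> J) i) ` ?W = (\<lambda>i. lev J {..<i} ?a) ` ?W"
    using level_folding[OF J a] by (intro image_cong) (auto simp: simple_wall_def)
  also have "\<dots> = lv J ?a ` {..<?n}"
    unfolding W image_image by (intro image_cong) (auto simp: lv_def stage_def)
  finally have 1: "(\<lambda>i. real_of_int (level D I (folding_of D \<beta> J) i)) ` ?W = real_of_int ` lv J ?a ` {..<?n}"
    by (metis image_image)
  have "{..?n} = insert ?n {..<?n}" by auto
  then have "real_of_int ` lv J ?a ` {..?n} = real_of_int ` lv J ?a ` {..<?n} \<union> {pairing D (wt J) ?a}"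
    using final_eq[OF J a] by (simp add: lv_last)
  then have "max_level D lam I \<beta> J p = Max (real_of_int ` lv J ?a ` {..?n})"
    unfolding max_level_def Let_def folding(1)[OF J(1)] 1 by simp
  also have "\<dots> = real_of_int (peak J ?a)"
    unfolding peak_def by (rule mono_Max_commute[symmetric]) (auto simp: mono_def)
  finally show ?thesis .
qed

lemma good_iff:
  assumes "P \<subseteq> indices D"
  shows "admissible D I \<beta> J \<and> (\<forall>p\<in>P. pairing D (wt J) (simple_root D p) = max_level D lam I \<beta> J p) \<longleftrightarrow>
    adm J \<and> bad (simple_root D ` P) J = {}"
proof (cases "adm J")
  case True
  have "pairing D (wt J) (simple_root D p) = max_level D lam I \<beta> J p \<longleftrightarrow>
      final J (simple_root D p) = peak J (simple_root D p)" if "p \<in> P" for p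
  proof -
    have p: "p \<in> indices D" "simple_root D p \<in> \<Delta>" using that assms by auto
    show ?thesis
      unfolding max_level_eq[OF True p(1)] final_eq[OF adm_finite[OF True] adm_subset[OF True] p(2), symmetric]
      by simp
  qed
  moreover have "simple_root D ` P \<subseteq> \<Delta>" using assms by (rule image_mono)
  ultimately show ?thesis
    using True bad_empty_iff[OF True, of "simple_root D ` P"] by (simp add: admissible_iff)
qed (simp add: admissible_iff)

end

theorem corollary8p4:
  fixes D :: "'v::real_vector root_datum"
    and lam :: 'v
    and I :: "'i::linorder set"
    and \<beta> :: "'i \<Rightarrow> 'v"
    and P :: "nat set"
  assumes "kac_moody_datum D"
    and "lam \<in> dominant_weights D"
    and "lambda_chain D lam I \<beta>"
    and "P \<subseteq> indices D"
  shows "let B = {J. admissible D I \<beta> J \<and>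
           (\<forall>p\<in>P. pairing D (weight D lam I \<beta> J) (simple_root D p) = max_level D lam I \<beta> J p)}
         in (\<forall>J\<in>B. weight D lam I \<beta> J \<in> rel_dominant D P) \<and>
            has_formal_sum (\<lambda>J. rel_char D P (weight D lam I \<beta> J)) B (weyl_char D lam)"
proof -
  interpret lam_chain D lam I \<beta>
    using assms by unfold_locales
  show ?thesis
    unfolding Let_def good_iff[OF assms(4)] weyl_char_eq_mult
    using branching[OF assms(4)] good_rel_dominant[OF assms(4)] by blast
qed

end
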